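(* Let $d\ge1$ and consider the nearest-neighbor random-cluster model on $\mathbb{Z}^d$ with cluster weight $q=2$ and free boundary conditions. Let $p_c=p_c(2)$ and $\tilde p_c=\tilde p_c(2)$ be the parameters defined in the context. Then $$p_c=\tilde p_c.$$ In particular, the phase transition is sharp: for every $p\in[0,1]$ with $p<p_c$ there exists $c=c(p)>0$ such that $\mu_{\mathbb{Z}^d,p,2}(0\leftrightarrow x)\le\exp(-c|x|)$ for every $x\in\mathbb{Z}^d$.
   Context: Fix a norm $|\cdot|$ on $\mathbb{Z}^d$ (the restriction of a norm on $\mathbb{R}^d$), and regard $\mathbb{Z}^d$ as a graph with nearest-neighbor edges. Random-cluster measure. For a finite subgraph $\Lambda=(V,E)$ of $\mathbb{Z}^d$, a percolation configuration is an element $\omega=(\omega_e)_{e\in E}\in\{0,1\}^E$, identified with the subgraph of $\Lambda$ with vertex set $V$ and edge set $\{e\in E:\omega_e=1\}$. An edge $e$ is open if $\omega_e=1$ and closed otherwise. Let $k(\omega)$ be the number of connected components of $\omega$ (isolated vertices included), $o(\omega)$ the number of open edges and $f(\omega)$ the number of closed edges. For $p\in[0,1]$ and $q>0$, the random-cluster measure on $\Lambda$ with free boundary conditions is the probability measure $$\mu_{\Lambda,p,q}(\omega)=\frac{q^{k(\omega)}}{Z}\,p^{o(\omega)}(1-p)^{f(\omega)},$$ where $Z$ is the normalizing constant. A finite set $S\subset\mathbb{Z}^d$ is identified with the subgraph whose vertex set is $S$ and whose edges are all nearest-neighbor edges with both endpoints in $S$. For $q\ge1$, $\mu_{\mathbb{Z}^d,p,q}$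 is the weak limit of the finite-volume free measures as the volume increases to $\mathbb{Z}^d$. Connectivity. $x\leftrightarrow y$ is the event that $x$ and $y$ are joined by a finite path of open edges. $0\leftrightarrow\infty$ is the event that for every $n\in\mathbb{N}$ there is $x\in\mathbb{Z}^d$ with $|x|\ge n$ and $0\leftrightarrow x$. Critical parameter $p_c$. For $q\ge 1$, $p_c=p_c(q)\in[0,1]$ is the parameter such that $\mu_{\mathbb{Z}^d,p,q}(0\leftrightarrow\infty)=0$ for $p<p_c$ and $\mu_{\mathbb{Z}^d,p,q}(0\leftrightarrow\infty)>0$ for $p>p_c$ (its existence is known). Critical parameter $\tilde p_c$. For a finite $S\subset\mathbb{Z}^d$ containing $0$, let $\Delta S$ be the set of nearest-neighbor edges of $\mathbb{Z}^d$ with exactly one endpoint in $S$; for $\{x,y\}\in\Delta S$ we always write $x\in S$ and $y\notin S$. With $q=2$, define $$\varphi_p(S):=p\sum_{\{x,y\}\in\Delta S}\mu_{S,p,2}(0\leftrightarrow x),$$ $$\tilde p_c:=\sup\{p\in[0,1]:\ \varphi_p(S)<1\ \text{for some finite } S\subset\mathbb{Z}^d \text{ containing } 0\}.$$ *)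

theory Defs
  imports "HOL-Probability.Probability"
begin

definition is_norm :: "(real ^ 'd \<Rightarrow> real) \<Rightarrow> bool" where
  "is_norm N \<longleftrightarrow>
     (\<forall>x. N x \<ge> 0) \<and> (\<forall>x. N x = 0 \<longleftrightarrow> x = 0) \<and>
     (\<forall>a x. N (a *\<^sub>R x) = \<bar>a\<bar> * N x) \<and> (\<forall>x y. N (x + y) \<le> N x + N y)"

definition lat :: "int ^ 'd \<Rightarrow> real ^ 'd" where
  "lat x = (\<chi> i. real_of_int (x $ i))"

type_synonym 'd edge = "(int ^ 'd) set"

definition lattice_edges :: "('d::finite) edge set" where
  "lattice_edges = {{x, y} | x y. (\<Sum>i\<in>UNIV. \<bar>x $ i - y $ i\<bar>) = 1}"

definition edges_in :: "(int ^ 'd::finite) set \<Rightarrow> 'd edge set" where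
  "edges_in S = {e \<in> lattice_edges. e \<subseteq> S}"

text \<open>
  A configuration on an edge set \<open>E\<close> is an extensional function \<open>\<omega> \<in> E \<rightarrow>\<^sub>E UNIV\<close> into
  \<open>bool\<close>, with \<open>True\<close> for open (value 1) and \<open>False\<close> for closed (value 0). The values of
  \<open>\<omega>\<close> outside \<open>E\<close> carry no information, so the edge set is passed along explicitly.
\<close>

type_synonym 'd config = "'d edge \<Rightarrow> bool"

definition open_edges :: "'d edge set \<Rightarrow> 'd config \<Rightarrow> 'd edge set" where
  "open_edges E \<omega> = {e \<in> E. \<omega> e}"

definition closed_edges :: "'d edge set \<Rightarrow> 'd config \<Rightarrow> 'd edge set" where
  "closed_edges E \<omega> = {e \<in> E. \<not> \<omega> e}"

definition joined :: "'d edge set \<Rightarrow> 'd config \<Rightarrow> int ^ 'd \<Rightarrow> int ^ 'd \<Rightarrow> bool" where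
  "joined E \<omega> x y \<longleftrightarrow> (x, y) \<in> {(u, v). {u, v} \<in> open_edges E \<omega>}\<^sup>*"

definition components :: "(int ^ 'd) set \<Rightarrow> 'd edge set \<Rightarrow> 'd config \<Rightarrow> (int ^ 'd) set set" where
  "components V E \<omega> = V // {(x, y). x \<in> V \<and> y \<in> V \<and> joined E \<omega> x y}"

definition rc_weight ::
    "(int ^ 'd) set \<Rightarrow> 'd edge set \<Rightarrow> real \<Rightarrow> real \<Rightarrow> 'd config \<Rightarrow> real" where
  "rc_weight V E p q \<omega> =
     q ^ card (components V E \<omega>) * p ^ card (open_edges E \<omega>) * (1 - p) ^ card (closed_edges E \<omega>)"

definition rc_partition :: "(int ^ 'd) set \<Rightarrow> 'd edge set \<Rightarrow> real \<Rightarrow> real \<Rightarrow> real" where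
  "rc_partition V E p q = (\<Sum>\<omega> \<in> E \<rightarrow>\<^sub>E UNIV. rc_weight V E p q \<omega>)"

definition rc_measure ::
    "(int ^ 'd) set \<Rightarrow> 'd edge set \<Rightarrow> real \<Rightarrow> real \<Rightarrow> 'd config measure" where
  "rc_measure V E p q =
     point_measure (E \<rightarrow>\<^sub>E UNIV) (\<lambda>\<omega>. ennreal (rc_weight V E p q \<omega> / rc_partition V E p q))"

abbreviation rc_vol :: "(int ^ 'd::finite) set \<Rightarrow> real \<Rightarrow> real \<Rightarrow> 'd config measure" where
  "rc_vol S p q \<equiv> rc_measure S (edges_in S) p q"

definition config_algebra :: "('d::finite) config measure" where
  "config_algebra = PiM lattice_edges (\<lambda>_. count_space UNIV)"

definition config_topology :: "('d::finite) config topology" where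
  "config_topology = product_topology (\<lambda>_. discrete_topology UNIV) lattice_edges"

text \<open>
  To compare measures on different volumes, a configuration on \<open>S\<close> is viewed as a
  configuration on the whole lattice in which all edges outside \<open>S\<close> are closed.
\<close>

definition extend_closed :: "(int ^ 'd::finite) set \<Rightarrow> 'd config \<Rightarrow> 'd config" where
  "extend_closed S \<omega> = (\<lambda>e \<in> lattice_edges. e \<in> edges_in S \<and> \<omega> e)"

definition is_weak_limit :: "real \<Rightarrow> real \<Rightarrow> ('d::finite) config measure \<Rightarrow> bool" where
  "is_weak_limit p q M \<longleftrightarrow>
     prob_space M \<and> sets M = sets config_algebra \<and>
     (\<forall>f :: 'd config \<Rightarrow> real.
        continuous_map config_topology euclideanreal f \<and> bounded (f ` topspace config_topology) \<longrightarrow>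
        ((\<lambda>S. \<integral>\<omega>. f (extend_closed S \<omega>) \<partial>rc_vol S p q) \<longlongrightarrow> (\<integral>\<omega>. f \<omega> \<partial>M))
          (finite_subsets_at_top UNIV))"

text \<open>Meaningful for \<open>q \<ge> 1\<close> and \<open>p \<in> {0..1}\<close>, where the weak limit exists.\<close>

definition rc_inf :: "real \<Rightarrow> real \<Rightarrow> ('d::finite) config measure" where
  "rc_inf p q = (THE M. is_weak_limit p q M)"

definition to_infinity :: "(real ^ 'd \<Rightarrow> real) \<Rightarrow> ('d::finite) config \<Rightarrow> bool" where
  "to_infinity N \<omega> \<longleftrightarrow> (\<forall>n::nat. \<exists>x. N (lat x) \<ge> real n \<and> joined lattice_edges \<omega> 0 x)"

definition perc_prob :: "(real ^ 'd::finite \<Rightarrow> real) \<Rightarrow> real \<Rightarrow> real \<Rightarrow> real" where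
  "perc_prob N p q = measure (rc_inf p q) {\<omega> \<in> space (rc_inf p q). to_infinity N \<omega>}"

definition conn_prob :: "real \<Rightarrow> real \<Rightarrow> int ^ 'd::finite \<Rightarrow> real" where
  "conn_prob p q x = measure (rc_inf p q) {\<omega> \<in> space (rc_inf p q). joined lattice_edges \<omega> 0 x}"

definition crit_p :: "(real ^ 'd::finite \<Rightarrow> real) \<Rightarrow> real \<Rightarrow> real" where
  "crit_p N q = (THE pc. pc \<in> {0..1} \<and>
     (\<forall>p\<in>{0..1}. (p < pc \<longrightarrow> perc_prob N p q = 0) \<and> (p > pc \<longrightarrow> perc_prob N p q > 0)))"

text \<open>Each edge with exactly one endpoint in \<open>S\<close> occurs once, as \<open>(x, y)\<close> with \<open>x\<close> inside.\<close>

definition boundary_edges :: "(int ^ 'd::finite) set \<Rightarrow> ((int ^ 'd) \<times> (int ^ 'd)) set" where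
  "boundary_edges S = {(x, y). {x, y} \<in> lattice_edges \<and> x \<in> S \<and> y \<notin> S}"

definition phi :: "real \<Rightarrow> (int ^ 'd::finite) set \<Rightarrow> real" where
  "phi p S = p * (\<Sum>(x, y) \<in> boundary_edges S.
     measure (rc_vol S p 2) {\<omega> \<in> space (rc_vol S p 2). joined (edges_in S) \<omega> 0 x})"

text \<open>The type argument carries the dimension \<open>CARD('d)\<close>.\<close>

definition crit_p_tilde :: "'d::finite itself \<Rightarrow> real" where
  "crit_p_tilde _ =
     Sup {p \<in> {0..1}. \<exists>S :: (int ^ 'd) set. finite S \<and> 0 \<in> S \<and> phi p S < 1}"

end

theory Submission
  imports Defs "HOL-Real_Asymp.Real_Asymp"
begin

text \<open>
  Write \<open>\<theta>(p)\<close> for the probability of \<open>0 \<leftrightarrow> \<infinity>\<close> under the free infinite-volume measure. Both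
  claims follow from two implications.

  If \<open>\<phi>\<^sub>p(S) < 1\<close> for some finite \<open>S\<close> containing the origin, then \<open>\<theta>(p) = 0\<close>. This is where \<open>q = 2\<close> is used.
  By the Edwards--Sokal coupling, connection probabilities are Ising correlations, and these satisfy
  the Simon--Lieb inequality (\<open>simon_lieb\<close>): the probability of \<open>u \<leftrightarrow> z\<close> in a volume is at most the sum,
  over the edges \<open>{x, y}\<close> leaving a neighbourhood \<open>S\<close> of \<open>u\<close>, of \<open>p\<close> times the probability of \<open>u \<leftrightarrow> x\<close>
  in \<open>S\<close> times that of \<open>y \<leftrightarrow> z\<close> in the whole volume. Summing over \<open>z\<close> bounds the expected cluster size
  by \<open>card S / (1 - \<phi>\<^sub>p(S))\<close>, uniformly in the volume. The inequality is proved by a switching argument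
  (\<open>ising_product\<close>): a product of two Ising partition functions is expanded over subsets \<open>M\<close> of the
  common edges in such a way that moving a pair of sources from one factor to the other costs nothing
  when the two sources are connected in \<open>M\<close>.

  If \<open>\<theta>(p) = 0\<close> and \<open>p' < p\<close>, then cluster sizes have exponential tails at \<open>p'\<close>, uniformly in the volume
  (\<open>cluster_domination\<close>, \<open>cluster_tail\<close>). This holds for every \<open>q \<ge> 1\<close>. Mark each vertex independently
  with a small probability \<open>1 - s\<close>. As \<open>\<theta>(p) = 0\<close>, the cluster of a vertex at \<open>p\<close> is unlikely to be marked.
  Conditioning the model at \<open>p\<close> on the cluster of the origin being unmarked decreases the odds of the
  edges met in an exploration of this cluster by a factor close to 1 only, and sprinkling from \<open>p'\<close> to
  \<open>p\<close> compensates for it. Hence the cluster at \<open>p'\<close> is dominated by an unmarked cluster at \<open>p\<close>, and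
  a cluster of size \<open>k\<close> is unmarked with probability \<open>s ^ k\<close>. It is essential that only free boundary
  conditions occur: what lies outside an explored cluster is a free model in a smaller volume, so its
  clusters are controlled by \<open>\<theta>(p)\<close>.

  Together: below the supremum defining the second critical parameter, \<open>\<theta>\<close> vanishes by the first
  implication and monotonicity of \<open>\<phi>\<close> in \<open>p\<close>. Above it \<open>\<theta>\<close> is positive, because otherwise the second
  implication would make \<open>\<phi>\<close> of a large cube small at some parameter above the supremum. So the two
  critical parameters agree, and the second implication is the exponential decay.

  All monotonicity statements come from one comparison theorem (\<open>rc_mean_comparison\<close>), a consequence of
  the four functions theorem. It also yields the infinite-volume measure: finite-volume means of
  increasing observables increase with the volume, local observables are differences of increasing
  ones, and the limits define a projective family.
\<close>

section \<open>Connectivity and rank in graphs\<close>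

definition adj :: "'a set set \<Rightarrow> ('a \<times> 'a) set" where
  "adj A = {(u, v). {u, v} \<in> A}"

definition conn :: "'a set set \<Rightarrow> 'a \<Rightarrow> 'a \<Rightarrow> bool" where
  "conn A x y \<longleftrightarrow> (x, y) \<in> (adj A)\<^sup>*"

definition cluster :: "'a set set \<Rightarrow> 'a \<Rightarrow> 'a set" where
  "cluster A x = {y. conn A x y}"

lemma conn_refl [simp]: "conn A x x"
  by (simp add: conn_def)

lemma adj_sym: "sym (adj A)"
  by (auto simp: sym_def adj_def insert_commute)

lemma conn_sym: "conn A x y \<Longrightarrow> conn A y x"
  unfolding conn_def by (meson adj_sym sym_rtrancl symD)

lemma conn_trans: "conn A x y \<Longrightarrow> conn A y z \<Longrightarrow> conn A x z"
  by (auto simp: conn_def)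

lemma conn_mono: "A \<subseteq> B \<Longrightarrow> conn A x y \<Longrightarrow> conn B x y"
  unfolding conn_def by (rule subsetD[OF rtrancl_mono]) (auto simp: adj_def)

lemma conn_edge: "{x, y} \<in> A \<Longrightarrow> conn A x y"
  by (auto simp: conn_def adj_def)

lemma conn_induct [consumes 1, case_names refl step]:
  assumes "conn A x y" "P x" "\<And>u v. conn A x u \<Longrightarrow> {u, v} \<in> A \<Longrightarrow> P u \<Longrightarrow> P v"
  shows "P y"
  using assms(1) unfolding conn_def
  by (induction rule: rtrancl_induct) (use assms(2,3) in \<open>auto simp: conn_def adj_def\<close>)

lemma conn_in_vertices: "conn A x y \<Longrightarrow> x \<noteq> y \<Longrightarrow> y \<in> \<Union>A"
  by (induction rule: conn_induct) auto

lemma cluster_self [simp]: "x \<in> cluster A x"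
  by (simp add: cluster_def)

lemma cluster_mono: "A \<subseteq> B \<Longrightarrow> cluster A x \<subseteq> cluster B x"
  by (auto simp: cluster_def intro: conn_mono)

lemma cluster_subset: "cluster A x \<subseteq> insert x (\<Union>A)"
  using conn_in_vertices by (fastforce simp: cluster_def)

lemma cluster_eq: "conn A x y \<Longrightarrow> cluster A x = cluster A y"
  by (auto simp: cluster_def intro: conn_trans conn_sym)

lemma conn_insert:
  "conn (insert {x, y} A) u v \<longleftrightarrow>
     conn A u v \<or> (conn A u x \<and> conn A y v) \<or> (conn A u y \<and> conn A x v)" (is "?L \<longleftrightarrow> ?R")
proof
  assume ?L
  then show ?R
  proof (induction rule: conn_induct)
    case (step a b)
    show ?case
    proof (cases "{a, b} \<in> A")
      case True
      then show ?thesis using step.IH by (meson conn_edge conn_trans)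
    next
      case False
      then have "a = x \<and> b = y \<or> a = y \<and> b = x"
        using step.hyps(2) by (auto simp: doubleton_eq_iff)
      then show ?thesis using step.IH by (metis conn_refl conn_sym conn_trans)
    qed
  qed simp
next
  have m: "conn A a b \<Longrightarrow> conn (insert {x, y} A) a b" for a b
    by (rule conn_mono[of A]) auto
  have e: "conn (insert {x, y} A) x y" by (rule conn_edge) simp
  assume ?R
  then show ?L using m e conn_sym conn_trans by metis
qed

lemma cluster_insert:
  "cluster (insert {x, y} A) v =
     (if conn A v x \<or> conn A v y then cluster A x \<union> cluster A y else cluster A v)"
  by (auto simp: cluster_def conn_insert intro: conn_trans conn_sym)

definition ncomp :: "'a set \<Rightarrow> 'a set set \<Rightarrow> nat" where
  "ncomp V A = card (V // {(x, y). x \<in> V \<and> y \<in> V \<and> conn A x y})"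

text \<open>
  The number of edges of a spanning forest of \<open>A\<close>. Unlike the number of components it does not
  refer to an ambient vertex set, so weights written with it can be compared across volumes.
\<close>

definition edge_rank :: "'a set set \<Rightarrow> nat" where
  "edge_rank A = card (\<Union>A) - ncomp (\<Union>A) A"

lemma ncomp_image:
  assumes "\<Union>A \<subseteq> V"
  shows "ncomp V A = card (cluster A ` V)"
proof -
  have "{(x, y). x \<in> V \<and> y \<in> V \<and> conn A x y} `` {v} = cluster A v" if "v \<in> V" for v
  proof -
    have "u \<in> V" if "conn A v u" for u
      using conn_in_vertices[OF that] assms \<open>v \<in> V\<close> by (cases "v = u") auto
    then show ?thesis using that by (auto simp: cluster_def)
  qed
  then have "V // {(x, y). x \<in> V \<and> y \<in> V \<and> conn A x y} = cluster A ` V"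
    unfolding quotient_def UNION_singleton_eq_range by (intro image_cong) auto
  then show ?thesis by (simp add: ncomp_def)
qed

lemma ncomp_insert_edge:
  assumes "finite V" "\<Union>A \<subseteq> V" "x \<in> V" "y \<in> V"
  shows "ncomp V A = ncomp V (insert {x, y} A) + (if conn A x y then 0 else 1)"
proof -
  let ?B = "insert {x, y} A"
  have AB: "ncomp V A = card (cluster A ` V)" "ncomp V ?B = card (cluster ?B ` V)"
    using assms by (auto intro!: ncomp_image)
  show ?thesis
  proof (cases "conn A x y")
    case True
    have "cluster ?B v = cluster A v" for v
      using True cluster_eq[of A v x] cluster_eq[of A v y] cluster_eq[of A x y]
      by (auto simp: cluster_insert)
    then have "cluster ?B ` V = cluster A ` V" by simp
    with True AB show ?thesis by simp
  next
    case False
    let ?X = "cluster A x" and ?Y = "cluster A y"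
    have ne: "?X \<noteq> ?Y" using False by (metis cluster_def cluster_self mem_Collect_eq)
    have img: "cluster ?B ` V = insert (?X \<union> ?Y) (cluster A ` V - {?X, ?Y})"
    proof (intro set_eqI iffI)
      fix D assume "D \<in> cluster ?B ` V"
      then obtain v where v: "v \<in> V" "D = cluster ?B v" by auto
      show "D \<in> insert (?X \<union> ?Y) (cluster A ` V - {?X, ?Y})"
      proof (cases "conn A v x \<or> conn A v y")
        case True then show ?thesis using v by (simp add: cluster_insert)
      next
        case F: False
        then have "cluster A v \<noteq> ?X" "cluster A v \<noteq> ?Y"
          by (metis cluster_def cluster_self mem_Collect_eq)+
        then show ?thesis using v F by (simp add: cluster_insert)
      qed
    next
      fix D assume D: "D \<in> insert (?X \<union> ?Y) (cluster A ` V - {?X, ?Y})"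
      show "D \<in> cluster ?B ` V"
      proof (cases "D = ?X \<union> ?Y")
        case True
        then have "D = cluster ?B x" by (simp add: cluster_insert)
        then show ?thesis using assms by blast
      next
        case F: False
        then obtain v where v: "v \<in> V" "D = cluster A v" "D \<noteq> ?X" "D \<noteq> ?Y" using D by auto
        then have "D = cluster ?B v" using cluster_eq[of A v x] cluster_eq[of A v y]
          by (auto simp: cluster_insert)
        then show ?thesis using v by blast
      qed
    qed
    have new: "?X \<union> ?Y \<notin> cluster A ` V - {?X, ?Y}"
    proof
      assume "?X \<union> ?Y \<in> cluster A ` V - {?X, ?Y}"
      then obtain v where v: "cluster A v = ?X \<union> ?Y" "cluster A v \<noteq> ?X" by auto
      then have "x \<in> cluster A v" by simp
      then have "conn A v x" by (simp add: cluster_def)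
      from cluster_eq[OF this] v(2) show False by contradiction
    qed
    have fin: "finite (cluster A ` V)" using assms(1) by simp
    have sub: "{?X, ?Y} \<subseteq> cluster A ` V"
      using imageI[OF assms(3), of "cluster A"] imageI[OF assms(4), of "cluster A"]
      by (simp only: insert_subset empty_subsetI simp_thms)
    have two: "card {?X, ?Y} = 2" using ne by (rule card_2_iff[THEN iffD2, OF exI, OF exI, OF conjI, OF refl])
    have "card (cluster A ` V - {?X, ?Y}) = card (cluster A ` V) - 2"
      using card_Diff_subset[OF _ sub] two by simp
    moreover have "2 \<le> card (cluster A ` V)" using card_mono[OF fin sub] two by simp
    moreover have "card (cluster ?B ` V) = Suc (card (cluster A ` V - {?X, ?Y}))"
      unfolding img using new fin by (intro card_insert_disjoint) auto
    ultimately show ?thesis using False unfolding AB by simp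
  qed
qed

lemma ncomp_insert_vertex:
  assumes "finite V" "\<Union>A \<subseteq> V" "v \<notin> V"
  shows "ncomp (insert v V) A = Suc (ncomp V A)"
proof -
  have "u = v" if "conn A v u" for u
  proof (rule ccontr)
    assume "u \<noteq> v"
    then have "v \<in> \<Union>A" using conn_in_vertices[OF conn_sym[OF that]] by simp
    then show False using assms by blast
  qed
  then have 1: "cluster A v = {v}" by (auto simp: cluster_def)
  have "cluster A u \<noteq> {v}" if "u \<in> V" for u
    using that assms(3) cluster_self[of u A] by (auto simp del: cluster_self)
  then have new: "{v} \<notin> cluster A ` V" by blast
  have "ncomp (insert v V) A = card (insert {v} (cluster A ` V))"
    using assms(2) 1 by (subst ncomp_image) auto
  also have "\<dots> = Suc (ncomp V A)"
    using new assms(1) by (simp add: ncomp_image[OF assms(2)])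
  finally show ?thesis .
qed

lemma ncomp_le: "finite V \<Longrightarrow> \<Union>A \<subseteq> V \<Longrightarrow> ncomp V A \<le> card V"
  by (simp add: ncomp_image card_image_le)

lemma ncomp_plus_rank:
  assumes "finite V" "\<Union>A \<subseteq> V"
  shows "ncomp V A + edge_rank A = card V"
proof -
  have fin: "finite (\<Union>A)" using assms finite_subset by blast
  have "finite (V - \<Union>A)" using assms by simp
  moreover have "W \<inter> \<Union>A = {} \<Longrightarrow> ncomp (\<Union>A \<union> W) A + edge_rank A = card (\<Union>A \<union> W)" if "finite W" for W
    using that
  proof (induction W)
    case empty
    show ?case using ncomp_le[OF fin, of A] by (simp add: edge_rank_def)
  next
    case (insert w W)
    have "ncomp (insert w (\<Union>A \<union> W)) A = Suc (ncomp (\<Union>A \<union> W) A)"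
      using insert fin by (intro ncomp_insert_vertex) auto
    moreover have "w \<notin> \<Union>A \<union> W" using insert by blast
    ultimately show ?case using insert fin by simp
  qed
  ultimately have "ncomp (\<Union>A \<union> (V - \<Union>A)) A + edge_rank A = card (\<Union>A \<union> (V - \<Union>A))" by blast
  then show ?thesis using assms by (simp add: Un_absorb1)
qed

definition graph_edges :: "'a set set \<Rightarrow> bool" where
  "graph_edges E \<longleftrightarrow> finite E \<and> (\<forall>e\<in>E. card e = 2)"

lemma graph_edgesD: "graph_edges E \<Longrightarrow> finite E" "graph_edges E \<Longrightarrow> finite (\<Union>E)"
  by (auto simp: graph_edges_def intro!: finite_Union dest: bspec intro: card_ge_0_finite)

lemma graph_edges_subset: "graph_edges E \<Longrightarrow> A \<subseteq> E \<Longrightarrow> graph_edges A"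
  by (auto simp: graph_edges_def intro: finite_subset)

lemma graph_edges_Un: "graph_edges E \<Longrightarrow> graph_edges A \<Longrightarrow> graph_edges (A \<union> E)"
  by (auto simp: graph_edges_def)

lemma graph_edges_obtain:
  assumes "graph_edges E" "e \<in> E"
  obtains x y where "e = {x, y}" "x \<noteq> y"
  using assms by (auto simp: graph_edges_def card_2_iff)

lemma finite_cluster: "graph_edges A \<Longrightarrow> finite (cluster A x)"
  by (meson cluster_subset finite_insert finite_subset graph_edgesD(2))

lemma edge_rank_empty [simp]: "edge_rank {} = 0"
  by (simp add: edge_rank_def)

lemma edge_rank_insert:
  assumes "graph_edges A"
  shows "edge_rank (insert {x, y} A) = edge_rank A + (if conn A x y then 0 else 1)"
proof -
  let ?V = "insert x (insert y (\<Union>A))"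
  have fin: "finite ?V" using graph_edgesD[OF assms] by simp
  have "ncomp ?V A + edge_rank A = card ?V"
    using fin by (intro ncomp_plus_rank) auto
  moreover have "ncomp ?V (insert {x, y} A) + edge_rank (insert {x, y} A) = card ?V"
    using fin by (intro ncomp_plus_rank) auto
  moreover have "ncomp ?V A = ncomp ?V (insert {x, y} A) + (if conn A x y then 0 else 1)"
    using fin by (intro ncomp_insert_edge) auto
  ultimately show ?thesis by simp
qed

text \<open>
  The only property of component counts behind positive association: an edge that joins two
  components of the larger graph also joins two components of the smaller one.
\<close>

lemma edge_rank_diminishing:
  assumes "graph_edges A" "graph_edges Y" "X \<subseteq> Y"
  shows "edge_rank (Y \<union> A) + edge_rank X \<le> edge_rank (X \<union> A) + edge_rank Y"
proof -
  have "finite A" using assms graph_edgesD by auto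
  then show ?thesis using assms(1)
  proof (induction A)
    case (insert e A)
    have gA: "graph_edges A" using insert.prems graph_edges_subset by blast
    obtain x y where e: "e = {x, y}" using graph_edges_obtain[OF insert.prems] by blast
    have g: "graph_edges (Y \<union> A)" "graph_edges (X \<union> A)"
      using gA assms graph_edges_Un graph_edges_subset by (metis sup_commute)+
    have "edge_rank (Y \<union> insert e A) = edge_rank (Y \<union> A) + (if conn (Y \<union> A) x y then 0 else 1)"
      using edge_rank_insert[OF g(1)] by (simp add: e)
    moreover have "edge_rank (X \<union> insert e A) = edge_rank (X \<union> A) + (if conn (X \<union> A) x y then 0 else 1)"
      using edge_rank_insert[OF g(2)] by (simp add: e)
    moreover have "conn (X \<union> A) x y \<Longrightarrow> conn (Y \<union> A) x y"
      using conn_mono[of "X \<union> A" "Y \<union> A"] assms by blast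
    ultimately show ?case using insert.IH[OF gA] by auto
  qed simp
qed

lemma edge_rank_mono:
  assumes "graph_edges B" "A \<subseteq> B"
  shows "edge_rank A \<le> edge_rank B"
proof -
  have "finite (B - A)" using assms graph_edgesD by auto
  moreover have "C \<subseteq> B \<Longrightarrow> edge_rank A \<le> edge_rank (A \<union> C)" if "finite C" for C
    using that
  proof (induction C)
    case (insert e C)
    obtain x y where e: "e = {x, y}" using graph_edges_obtain[OF assms(1)] insert.prems by blast
    have "graph_edges (A \<union> C)" using assms insert.prems graph_edges_subset[of B] by auto
    from edge_rank_insert[OF this, of x y] show ?case using insert by (simp add: e)
  qed simp
  ultimately have "edge_rank A \<le> edge_rank (A \<union> (B - A))" by blast
  then show ?thesis using assms by (simp add: Un_absorb1)
qed

text \<open>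
  This and \<open>edge_rank_Un_disjoint\<close> are the spatial Markov property: once a cluster and its closed
  boundary are known, what is left is a free random-cluster model on the complement.
\<close>

lemma conn_Un_disjoint:
  assumes "\<Union>A \<inter> \<Union>B = {}" "x \<notin> \<Union>B"
  shows "conn (A \<union> B) x y \<longleftrightarrow> conn A x y"
proof
  assume "conn (A \<union> B) x y"
  then have "conn A x y \<and> y \<notin> \<Union>B"
  proof (induction rule: conn_induct)
    case (step u v)
    then have "{u, v} \<in> A" by auto
    moreover from this have "v \<notin> \<Union>B" using assms by blast
    ultimately show ?case using step by (meson conn_edge conn_trans)
  qed (use assms in auto)
  then show "conn A x y" ..
qed (auto intro: conn_mono)

lemma edge_rank_Un_disjoint:
  assumes "graph_edges A" "graph_edges B" "\<Union>A \<inter> \<Union>B = {}"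
  shows "edge_rank (A \<union> B) = edge_rank A + edge_rank B"
proof -
  have "finite A" using assms graph_edgesD by auto
  then show ?thesis using assms
  proof (induction A)
    case (insert e A)
    have gA: "graph_edges A" using insert.prems graph_edges_subset by blast
    obtain x y where e: "e = {x, y}" using graph_edges_obtain[OF insert.prems(1)] by blast
    have g: "graph_edges (A \<union> B)" using gA insert.prems graph_edges_Un by blast
    have dis: "\<Union>A \<inter> \<Union>B = {}" "x \<notin> \<Union>B" using insert.prems e by auto
    have "conn (A \<union> B) x y \<longleftrightarrow> conn A x y" using conn_Un_disjoint[OF dis] .
    then show ?case using edge_rank_insert[OF g] edge_rank_insert[OF gA] insert.IH[OF gA insert.prems(2) dis(1)]
      by (simp add: e)
  qed simp
qed

section \<open>The four functions theorem and monotonicity\<close>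

text \<open>
  Writing \<open>m = c0 * d1\<close>, the mixed terms satisfy \<open>a0 * b1 \<le> m\<close> and \<open>a1 * b0 \<le> m\<close>, so the product of
  the two differences is nonnegative; dividing by \<open>m\<close> turns this into the missing bound on their sum.
\<close>

lemma four_functions_two_points:
  fixes a0 :: real
  assumes nonneg: "0 \<le> a0" "0 \<le> a1" "0 \<le> b0" "0 \<le> b1" "0 \<le> c0" "0 \<le> c1" "0 \<le> d0" "0 \<le> d1"
    and h: "a0 * b0 \<le> c0 * d0" "a0 * b1 \<le> c0 * d1" "a1 * b0 \<le> c0 * d1" "a1 * b1 \<le> c1 * d1"
  shows "(a0 + a1) * (b0 + b1) \<le> (c0 + c1) * (d0 + d1)"
proof (cases "c0 * d1 = 0")
  case True
  then have "a0 * b1 = 0" "a1 * b0 = 0" using h nonneg by (smt (verit) mult_nonneg_nonneg)+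
  moreover have "0 \<le> c0 * d1" "0 \<le> c1 * d0" using nonneg by simp_all
  ultimately show ?thesis using h unfolding distrib_left distrib_right by linarith
next
  case False
  let ?m = "c0 * d1" and ?x = "a0 * b1" and ?y = "a1 * b0"
  have m: "0 < ?m" using False nonneg by (simp add: less_le)
  have "?x * ?y = (a0 * b0) * (a1 * b1)" by simp
  also have "\<dots> \<le> (c0 * d0) * (c1 * d1)" using h nonneg by (intro mult_mono[OF h(1) h(4)]) auto
  finally have xy: "?x * ?y \<le> ?m * (c1 * d0)" by (simp add: algebra_simps)
  have "0 \<le> (?m - ?x) * (?m - ?y)" using h by simp
  then have "?m * (?x + ?y) \<le> ?m * ?m + ?x * ?y" by (simp add: algebra_simps)
  also have "\<dots> \<le> ?m * (?m + c1 * d0)" using xy by (simp add: algebra_simps)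
  finally have "?x + ?y \<le> ?m + c1 * d0" using m by (rule mult_left_le_imp_le)
  then show ?thesis using h by (simp add: algebra_simps)
qed

lemma sum_Pow_insert:
  assumes "finite E" "e \<notin> E"
  shows "(\<Sum>A\<in>Pow (insert e E). f A) = (\<Sum>A\<in>Pow E. f A + f (insert e A))"
proof -
  have inj: "inj_on (insert e) (Pow E)" using assms(2) by (auto simp: inj_on_def)
  have "(\<Sum>A\<in>Pow (insert e E). f A) = (\<Sum>A\<in>Pow E. f A) + (\<Sum>A\<in>insert e ` Pow E. f A)"
    unfolding Pow_insert using assms by (intro sum.union_disjoint) auto
  also have "(\<Sum>A\<in>insert e ` Pow E. f A) = (\<Sum>A\<in>Pow E. f (insert e A))"
    by (simp add: sum.reindex[OF inj])
  finally show ?thesis by (simp add: sum.distrib)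
qed

text \<open>
  The Ahlswede--Daykin theorem. Summing out a single element preserves the hypothesis, which is
  exactly the two-point case, so induction on the ground set applies.
\<close>

theorem four_functions:
  fixes \<alpha> :: "'b set \<Rightarrow> real"
  assumes "finite E"
    and "\<And>A. A \<subseteq> E \<Longrightarrow> 0 \<le> \<alpha> A \<and> 0 \<le> \<beta> A \<and> 0 \<le> \<gamma> A \<and> 0 \<le> \<delta> A"
    and "\<And>A B. A \<subseteq> E \<Longrightarrow> B \<subseteq> E \<Longrightarrow> \<alpha> A * \<beta> B \<le> \<gamma> (A \<inter> B) * \<delta> (A \<union> B)"
  shows "(\<Sum>A\<in>Pow E. \<alpha> A) * (\<Sum>A\<in>Pow E. \<beta> A) \<le> (\<Sum>A\<in>Pow E. \<gamma> A) * (\<Sum>A\<in>Pow E. \<delta> A)"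
  using assms
proof (induction E arbitrary: \<alpha> \<beta> \<gamma> \<delta>)
  case empty
  show ?case using empty(2)[of "{}" "{}"] by simp
next
  case (insert e E)
  define i where "i f = (\<lambda>A. f A + f (insert e A))" for f :: "'b set \<Rightarrow> real"
  have "(\<Sum>A\<in>Pow E. i \<alpha> A) * (\<Sum>A\<in>Pow E. i \<beta> A) \<le> (\<Sum>A\<in>Pow E. i \<gamma> A) * (\<Sum>A\<in>Pow E. i \<delta> A)"
  proof (rule insert.IH)
    fix A assume "A \<subseteq> E"
    then have "A \<subseteq> insert e E" "insert e A \<subseteq> insert e E" by auto
    then show "0 \<le> i \<alpha> A \<and> 0 \<le> i \<beta> A \<and> 0 \<le> i \<gamma> A \<and> 0 \<le> i \<delta> A"
      using insert.prems(1)[of A] insert.prems(1)[of "insert e A"] by (simp add: i_def)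
  next
    fix A B assume AB: "A \<subseteq> E" "B \<subseteq> E"
    then have s: "A \<subseteq> insert e E" "insert e A \<subseteq> insert e E" "B \<subseteq> insert e E" "insert e B \<subseteq> insert e E"
      and e: "e \<notin> A" "e \<notin> B" using insert.hyps by auto
    let ?I = "A \<inter> B" and ?U = "A \<union> B"
    have s': "?I \<subseteq> insert e E" "insert e ?I \<subseteq> insert e E" "?U \<subseteq> insert e E" "insert e ?U \<subseteq> insert e E"
      using s by auto
    have "(\<alpha> A + \<alpha> (insert e A)) * (\<beta> B + \<beta> (insert e B))
        \<le> (\<gamma> ?I + \<gamma> (insert e ?I)) * (\<delta> ?U + \<delta> (insert e ?U))"
    proof (rule four_functions_two_points)
      have "A \<inter> insert e B = ?I" "insert e A \<inter> B = ?I" "insert e A \<inter> insert e B = insert e ?I"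
        "A \<union> insert e B = insert e ?U" "insert e A \<union> B = insert e ?U"
        "insert e A \<union> insert e B = insert e ?U" using e by auto
      then show "\<alpha> A * \<beta> B \<le> \<gamma> ?I * \<delta> ?U" "\<alpha> A * \<beta> (insert e B) \<le> \<gamma> ?I * \<delta> (insert e ?U)"
        "\<alpha> (insert e A) * \<beta> B \<le> \<gamma> ?I * \<delta> (insert e ?U)"
        "\<alpha> (insert e A) * \<beta> (insert e B) \<le> \<gamma> (insert e ?I) * \<delta> (insert e ?U)"
        using insert.prems(2)[OF s(1) s(3)] insert.prems(2)[OF s(1) s(4)]
          insert.prems(2)[OF s(2) s(3)] insert.prems(2)[OF s(2) s(4)] by simp_all
    qed (use insert.prems(1) s s' in blast)+
    then show "i \<alpha> A * i \<beta> B \<le> i \<gamma> ?I * i \<delta> ?U" by (simp add: i_def)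
  qed
  then show ?case using insert.hyps by (simp add: sum_Pow_insert i_def)
qed

section \<open>Random-cluster weights\<close>

text \<open>
  With \<open>c = 1 / q\<close>, the factor \<open>c ^ edge_rank\<close> equals \<open>q\<close> to the number of components up to a power of
  \<open>q\<close> that depends on the vertex set alone. The edges in \<open>O'\<close> are already known to be open, those in
  \<open>U\<close> are undecided and \<open>A\<close> is the open part of \<open>U\<close>; every other edge counts as closed. Observables
  are evaluated at the full open set \<open>O' \<union> A\<close>.
\<close>

definition wt :: "real \<Rightarrow> real \<Rightarrow> 'a set set \<Rightarrow> 'a set set \<Rightarrow> 'a set set \<Rightarrow> real" where
  "wt p c O' U A = p ^ card A * (1 - p) ^ card (U - A) * c ^ edge_rank (O' \<union> A)"

definition wsum ::
    "real \<Rightarrow> real \<Rightarrow> 'a set set \<Rightarrow> 'a set set \<Rightarrow> ('a set set \<Rightarrow> real) \<Rightarrow> real" where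
  "wsum p c O' U f = (\<Sum>A\<in>Pow U. f (O' \<union> A) * wt p c O' U A)"

definition rc_mean ::
    "real \<Rightarrow> real \<Rightarrow> 'a set set \<Rightarrow> 'a set set \<Rightarrow> ('a set set \<Rightarrow> real) \<Rightarrow> real" where
  "rc_mean p c O' U f = wsum p c O' U f / wsum p c O' U (\<lambda>_. 1)"

lemma wt_nonneg: "0 \<le> p \<Longrightarrow> p \<le> 1 \<Longrightarrow> 0 \<le> c \<Longrightarrow> 0 \<le> wt p c O' U A"
  by (simp add: wt_def)

lemma wsum_mono:
  assumes "0 \<le> p" "p \<le> 1" "0 \<le> c" "\<And>A. A \<subseteq> U \<Longrightarrow> f (O' \<union> A) \<le> g (O' \<union> A)"
  shows "wsum p c O' U f \<le> wsum p c O' U g"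
  unfolding wsum_def using assms by (intro sum_mono mult_right_mono wt_nonneg) auto

lemma wsum_cong:
  assumes "\<And>A. A \<subseteq> U \<Longrightarrow> f (O' \<union> A) = g (O' \<union> A)"
  shows "wsum p c O' U f = wsum p c O' U g"
  unfolding wsum_def using assms by (intro sum.cong) auto

lemma wsum_add: "wsum p c O' U (\<lambda>A. f A + g A) = wsum p c O' U f + wsum p c O' U g"
  by (simp add: wsum_def sum.distrib algebra_simps)

lemma wsum_diff: "wsum p c O' U (\<lambda>A. f A - g A) = wsum p c O' U f - wsum p c O' U g"
  by (simp add: wsum_def sum_subtractf algebra_simps)

lemma wsum_cmult: "wsum p c O' U (\<lambda>A. a * f A) = a * wsum p c O' U f"
  by (simp add: wsum_def sum_distrib_left mult_ac)

lemma wsum_sum: "wsum p c O' U (\<lambda>A. \<Sum>i\<in>I. f i A) = (\<Sum>i\<in>I. wsum p c O' U (f i))"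
  unfolding wsum_def by (subst sum.swap) (simp add: sum_distrib_right)

lemma wsum_pos:
  assumes "0 \<le> p" "p \<le> 1" "0 < c" "finite U" "\<And>A. A \<subseteq> U \<Longrightarrow> 0 < f (O' \<union> A)"
  shows "0 < wsum p c O' U f"
proof -
  define B where "B = (if p = 1 then U else {})"
  have "0 < f (O' \<union> B) * wt p c O' U B"
    using assms by (auto simp: B_def wt_def)
  also have "\<dots> \<le> wsum p c O' U f"
    unfolding wsum_def
  proof (rule member_le_sum)
    fix A assume "A \<in> Pow U - {B}"
    then show "0 \<le> f (O' \<union> A) * wt p c O' U A"
      using assms wt_nonneg[of p c O' U A] less_imp_le[of 0 "f (O' \<union> A)"] by simp
  qed (use assms in \<open>auto simp: B_def\<close>)
  finally show ?thesis .
qed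

locale rc_params =
  fixes p c :: real
  assumes p: "0 \<le> p" "p \<le> 1" and c: "0 < c" "c \<le> 1"
begin

lemma wsum_1_pos: "finite U \<Longrightarrow> 0 < wsum p c O' U (\<lambda>_. 1)"
  using p c by (intro wsum_pos) auto

lemma rc_mean_const [simp]: "finite U \<Longrightarrow> rc_mean p c O' U (\<lambda>_. a) = a"
  using wsum_1_pos[of U O'] wsum_cmult[of p c O' U a "\<lambda>_. 1"] by (simp add: rc_mean_def)

lemma rc_mean_mono:
  assumes "finite U" "\<And>A. A \<subseteq> U \<Longrightarrow> f (O' \<union> A) \<le> g (O' \<union> A)"
  shows "rc_mean p c O' U f \<le> rc_mean p c O' U g"
  unfolding rc_mean_def using wsum_1_pos[OF assms(1), of O'] p c assms
  by (intro divide_right_mono wsum_mono) auto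

end

lemma rc_mean_cong:
  assumes "\<And>A. A \<subseteq> U \<Longrightarrow> f (O' \<union> A) = g (O' \<union> A)"
  shows "rc_mean p c O' U f = rc_mean p c O' U g"
  unfolding rc_mean_def using wsum_cong[of U f O' g, OF assms] by simp

lemma rc_mean_add: "rc_mean p c O' U (\<lambda>A. f A + g A) = rc_mean p c O' U f + rc_mean p c O' U g"
  by (simp add: rc_mean_def wsum_add add_divide_distrib)

lemma rc_mean_diff: "rc_mean p c O' U (\<lambda>A. f A - g A) = rc_mean p c O' U f - rc_mean p c O' U g"
  by (simp add: rc_mean_def wsum_diff diff_divide_distrib)

lemma rc_mean_cmult: "rc_mean p c O' U (\<lambda>A. a * f A) = a * rc_mean p c O' U f"
  by (simp add: rc_mean_def wsum_cmult)

lemma rc_mean_sum: "rc_mean p c O' U (\<lambda>A. \<Sum>i\<in>I. f i A) = (\<Sum>i\<in>I. rc_mean p c O' U (f i))"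
  by (simp add: rc_mean_def wsum_sum sum_divide_distrib)

text \<open>
  Holley's comparison, derived from the four functions theorem. It gives monotonicity in the edge
  parameter, in the volume, in the set of edges known to be open, and in the cluster weight;
  \<open>c2 = 1\<close> is independent percolation.
\<close>

theorem rc_mean_comparison:
  assumes params: "rc_params p1 c1" "rc_params p2 c2"
    and le: "p1 \<le> p2" "c1 \<le> c2"
    and sub: "U1 \<subseteq> U2" "O1 \<subseteq> O2" and g: "graph_edges U2" "graph_edges O2"
    and f: "\<And>A B. A \<subseteq> B \<Longrightarrow> B \<subseteq> O2 \<union> U2 \<Longrightarrow> f A \<le> f B"
  shows "rc_mean p1 c1 O1 U1 f \<le> rc_mean p2 c2 O2 U2 f"
proof -
  interpret r1: rc_params p1 c1 by fact
  interpret r2: rc_params p2 c2 by fact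
  have fin: "finite U2" "finite U1"
    using graph_edgesD(1)[OF g(1)] finite_subset[OF sub(1)] by auto
  define h where "h A = f A - f {}" for A
  have h0: "0 \<le> h A" if "A \<subseteq> O2 \<union> U2" for A using f[of "{}" A] that by (simp add: h_def)
  (* Extended by zero, the first weight lives on the same power set as the second, which lets one
     lattice condition cover both a change of volume and a change of parameters. *)
  define w1 where "w1 A = (if A \<subseteq> U1 then wt p1 c1 O1 U1 A else 0)" for A
  let ?w2 = "wt p2 c2 O2 U2"
  have w0: "0 \<le> w1 A" "0 \<le> ?w2 A" for A
    using r1.p r1.c r2.p r2.c by (auto simp: w1_def intro!: wt_nonneg)
  have lattice: "w1 A * ?w2 B \<le> w1 (A \<inter> B) * ?w2 (A \<union> B)" if AB: "A \<subseteq> U2" "B \<subseteq> U2" for A B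
  proof (cases "A \<subseteq> U1")
    case True
    have fA: "finite A" "finite B" using AB fin finite_subset by auto
    let ?D = "A - B" and ?a = "card (A - B)"
    have cards: "card A = card (A \<inter> B) + ?a" "card (A \<union> B) = card B + ?a"
      "card (U1 - A \<inter> B) = card (U1 - A) + ?a" "card (U2 - B) = card (U2 - (A \<union> B)) + ?a"
    proof -
      show "card A = card (A \<inter> B) + ?a"
        using card_Un_disjoint[of "A \<inter> B" ?D] fA by (simp add: Int_Diff_Un Int_Diff_disjoint)
      show "card (A \<union> B) = card B + ?a"
        using card_Un_disjoint[of B ?D] fA by (simp add: Un_commute)
      have "U1 - A \<inter> B = (U1 - A) \<union> ?D" using True by auto
      then show "card (U1 - A \<inter> B) = card (U1 - A) + ?a"
        using card_Un_disjoint[of "U1 - A" ?D] fA fin by auto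
      have "U2 - B = (U2 - (A \<union> B)) \<union> ?D" using AB by auto
      then show "card (U2 - B) = card (U2 - (A \<union> B)) + ?a"
        using card_Un_disjoint[of "U2 - (A \<union> B)" ?D] fA fin by auto
    qed
    have "p1 * (1 - p2) \<le> (1 - p1) * p2" using le by (simp add: algebra_simps)
    then have pa: "(p1 * (1 - p2)) ^ ?a \<le> ((1 - p1) * p2) ^ ?a"
      using r1.p r2.p by (intro power_mono) auto
    have P: "(p1 ^ card A * (1 - p1) ^ card (U1 - A)) * (p2 ^ card B * (1 - p2) ^ card (U2 - B))
        \<le> (p1 ^ card (A \<inter> B) * (1 - p1) ^ card (U1 - A \<inter> B)) * (p2 ^ card (A \<union> B) * (1 - p2) ^ card (U2 - (A \<union> B)))"
      (is "?l \<le> ?r")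
    proof -
      let ?k = "p1 ^ card (A \<inter> B) * (1 - p1) ^ card (U1 - A) * (p2 ^ card B * (1 - p2) ^ card (U2 - (A \<union> B)))"
      have "?l = ?k * (p1 * (1 - p2)) ^ ?a"
        by (simp only: cards power_add power_mult_distrib mult_ac)
      also have "\<dots> \<le> ?k * ((1 - p1) * p2) ^ ?a"
        using pa r1.p r2.p by (intro mult_left_mono) auto
      also have "\<dots> = ?r" by (simp only: cards power_add power_mult_distrib mult_ac)
      finally show ?thesis .
    qed
    have gAB: "graph_edges A" "graph_edges (O2 \<union> B)" "graph_edges (O1 \<union> A)"
      "graph_edges (O2 \<union> (A \<union> B))"
      by (rule graph_edges_subset[OF graph_edges_Un[OF g]], use AB sub in blast)+
    (* Adding the edges of A raises the rank more over the smaller set; since c1 <= c2 <= 1 the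
       surplus of powers of c1 only helps. *)
    have dim: "edge_rank (O2 \<union> B \<union> A) + edge_rank (O1 \<union> (A \<inter> B))
        \<le> edge_rank (O1 \<union> (A \<inter> B) \<union> A) + edge_rank (O2 \<union> B)"
      using sub gAB by (intro edge_rank_diminishing) auto
    have eq: "O1 \<union> (A \<inter> B) \<union> A = O1 \<union> A" "O2 \<union> B \<union> A = O2 \<union> (A \<union> B)" by auto
    let ?i = "edge_rank (O1 \<union> A) - edge_rank (O1 \<union> (A \<inter> B))"
      and ?j = "edge_rank (O2 \<union> (A \<union> B)) - edge_rank (O2 \<union> B)"
    have "edge_rank (O1 \<union> (A \<inter> B)) \<le> edge_rank (O1 \<union> A)" "edge_rank (O2 \<union> B) \<le> edge_rank (O2 \<union> (A \<union> B))"
      using gAB by (auto intro!: edge_rank_mono)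
    then have ij: "edge_rank (O1 \<union> A) = edge_rank (O1 \<union> (A \<inter> B)) + ?i"
      "edge_rank (O2 \<union> (A \<union> B)) = edge_rank (O2 \<union> B) + ?j" "?j \<le> ?i"
      using dim unfolding eq by auto
    have "c1 ^ ?i \<le> c1 ^ ?j" using ij(3) r1.c by (intro power_decreasing) auto
    also have "\<dots> \<le> c2 ^ ?j" using le r1.c by (intro power_mono) auto
    finally have cc: "c1 ^ ?i \<le> c2 ^ ?j" .
    have C: "c1 ^ edge_rank (O1 \<union> A) * c2 ^ edge_rank (O2 \<union> B)
        \<le> c1 ^ edge_rank (O1 \<union> (A \<inter> B)) * c2 ^ edge_rank (O2 \<union> (A \<union> B))"
    proof -
      have "c1 ^ edge_rank (O1 \<union> A) * c2 ^ edge_rank (O2 \<union> B) =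
          c1 ^ edge_rank (O1 \<union> (A \<inter> B)) * c2 ^ edge_rank (O2 \<union> B) * c1 ^ ?i"
        by (subst ij(1)) (simp only: power_add mult_ac)
      also have "\<dots> \<le> c1 ^ edge_rank (O1 \<union> (A \<inter> B)) * c2 ^ edge_rank (O2 \<union> B) * c2 ^ ?j"
        using cc r1.c r2.c by (intro mult_left_mono) auto
      also have "\<dots> = c1 ^ edge_rank (O1 \<union> (A \<inter> B)) * c2 ^ edge_rank (O2 \<union> (A \<union> B))"
        by (subst ij(2)) (simp only: power_add mult_ac)
      finally show ?thesis .
    qed
    have "w1 A * ?w2 B = ((p1 ^ card A * (1 - p1) ^ card (U1 - A)) * (p2 ^ card B * (1 - p2) ^ card (U2 - B)))
       * (c1 ^ edge_rank (O1 \<union> A) * c2 ^ edge_rank (O2 \<union> B))"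
      using True by (simp add: w1_def wt_def)
    also have "\<dots> \<le> ((p1 ^ card (A \<inter> B) * (1 - p1) ^ card (U1 - A \<inter> B)) * (p2 ^ card (A \<union> B) * (1 - p2) ^ card (U2 - (A \<union> B))))
       * (c1 ^ edge_rank (O1 \<union> (A \<inter> B)) * c2 ^ edge_rank (O2 \<union> (A \<union> B)))"
      using r1.p r2.p r1.c r2.c by (intro mult_mono[OF P C]) auto
    also have "\<dots> = w1 (A \<inter> B) * ?w2 (A \<union> B)"
      using True by (auto simp add: w1_def wt_def)
    finally show ?thesis .
  qed (use w0 in \<open>simp add: w1_def\<close>)
  have "(\<Sum>A\<in>Pow U2. h (O1 \<union> A) * w1 A) * (\<Sum>A\<in>Pow U2. ?w2 A)
      \<le> (\<Sum>A\<in>Pow U2. w1 A) * (\<Sum>A\<in>Pow U2. h (O2 \<union> A) * ?w2 A)"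
  proof (rule four_functions[OF fin(1)])
    fix A assume "A \<subseteq> U2"
    then show "0 \<le> h (O1 \<union> A) * w1 A \<and> 0 \<le> ?w2 A \<and> 0 \<le> w1 A \<and> 0 \<le> h (O2 \<union> A) * ?w2 A"
      using w0 h0 sub by (auto intro!: mult_nonneg_nonneg h0)
  next
    fix A B assume AB: "A \<subseteq> U2" "B \<subseteq> U2"
    have le': "h (O1 \<union> A) \<le> h (O2 \<union> (A \<union> B))"
      unfolding h_def using f[of "O1 \<union> A" "O2 \<union> (A \<union> B)"] AB sub by auto
    have "h (O1 \<union> A) * w1 A * ?w2 B = h (O1 \<union> A) * (w1 A * ?w2 B)" by simp
    also have "\<dots> \<le> h (O2 \<union> (A \<union> B)) * (w1 (A \<inter> B) * ?w2 (A \<union> B))"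
      using w0 h0[of "O2 \<union> (A \<union> B)"] AB by (intro mult_mono[OF le' lattice[OF AB]]) auto
    finally show "h (O1 \<union> A) * w1 A * ?w2 B \<le> w1 (A \<inter> B) * (h (O2 \<union> (A \<union> B)) * ?w2 (A \<union> B))"
      by (simp add: mult_ac)
  qed
  moreover have "(\<Sum>A\<in>Pow U2. h (O1 \<union> A) * w1 A) = wsum p1 c1 O1 U1 h"
    "(\<Sum>A\<in>Pow U2. w1 A) = wsum p1 c1 O1 U1 (\<lambda>_. 1)"
    unfolding wsum_def using fin(1) sub(1)
    by (auto intro!: sum.mono_neutral_cong_right simp: w1_def split: if_splits)
  ultimately have "wsum p1 c1 O1 U1 h * wsum p2 c2 O2 U2 (\<lambda>_. 1) \<le> wsum p1 c1 O1 U1 (\<lambda>_. 1) * wsum p2 c2 O2 U2 h"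
    by (simp add: wsum_def)
  then have "rc_mean p1 c1 O1 U1 h \<le> rc_mean p2 c2 O2 U2 h"
    using r1.wsum_1_pos[OF fin(2), of O1] r2.wsum_1_pos[OF fin(1), of O2]
    by (simp add: rc_mean_def divide_simps mult_ac)
  moreover have "h = (\<lambda>A. f A - f {})" by (simp add: h_def fun_eq_iff)
  ultimately show ?thesis
    by (simp add: rc_mean_diff r1.rc_mean_const[OF fin(2)] r2.rc_mean_const[OF fin(1)])
qed

section \<open>Comparison of clusters at two parameters\<close>

lemma wsum_split:
  assumes "finite U" "e \<notin> U"
  shows "wsum p c O' (insert e U) f = (1 - p) * wsum p c O' U f + p * wsum p c (insert e O') U f"
proof -
  have 1: "wt p c O' (insert e U) A = (1 - p) * wt p c O' U A" if "A \<subseteq> U" for A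
  proof -
    have "insert e U - A = insert e (U - A)" "e \<notin> U - A" using that assms by auto
    then show ?thesis using assms by (simp add: wt_def)
  qed
  have 2: "wt p c O' (insert e U) (insert e A) = p * wt p c (insert e O') U A" if "A \<subseteq> U" for A
  proof -
    have "insert e U - insert e A = U - A" "e \<notin> A" "finite A"
      using that assms finite_subset by auto
    then show ?thesis by (simp add: wt_def)
  qed
  show ?thesis
    unfolding wsum_def sum_Pow_insert[OF assms] sum_distrib_left sum.distrib
    by (intro arg_cong2[where f = "(+)"] sum.cong) (auto simp: 1 2)
qed

text \<open>
  Declaring \<open>{x, y}\<close> open costs a factor \<open>c\<close> exactly when \<open>x\<close> and \<open>y\<close> were not connected. This converts
  the odds of an edge into a connection probability in the model where the edge is closed.
\<close>

lemma wsum_insert_explored: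
  assumes "graph_edges (O' \<union> U)"
  shows "wsum p c (insert {x, y} O') U f =
    wsum p c O' U (\<lambda>X. f (insert {x, y} X) * (if conn X x y then 1 else c))"
  unfolding wsum_def
proof (intro sum.cong refl)
  fix A assume "A \<in> Pow U"
  then have "graph_edges (O' \<union> A)" by (intro graph_edges_subset[OF assms]) blast
  from edge_rank_insert[OF this, of x y]
  show "f (insert {x, y} O' \<union> A) * wt p c (insert {x, y} O') U A =
      f (insert {x, y} (O' \<union> A)) * (if conn (O' \<union> A) x y then 1 else c) * wt p c O' U A"
    by (simp add: wt_def)
qed

text \<open>
  The second average has the larger values and puts more weight on the larger one.
\<close>

lemma mixture_le:
  fixes a b :: real
  assumes nonneg: "0 \<le> a" "0 \<le> b" "0 \<le> a'" "0 \<le> b'" and pos: "0 < a + b" "0 < a' + b'"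
    and odds: "a' * b \<le> b' * a" and le: "r0' \<le> r1'" "r0' \<le> r0" "r1' \<le> r1"
  shows "(b' * r0' + a' * r1') / (b' + a') \<le> (b * r0 + a * r1) / (b + a)"
proof -
  have "0 \<le> (b' * a - a' * b) * (r1' - r0')" using odds le by simp
  then have "(b' * r0' + a' * r1') * (b + a) \<le> (b * r0' + a * r1') * (b' + a')"
    by (simp add: algebra_simps)
  also have "\<dots> \<le> (b * r0 + a * r1) * (b' + a')"
    using nonneg le by (intro mult_right_mono add_mono mult_left_mono) auto
  finally show ?thesis using pos by (simp add: divide_simps add.commute)
qed

lemma cluster_const_outside:
  assumes "\<Union>O' \<subseteq> cluster O' v" "A \<subseteq> U" "\<And>e. e \<in> U \<Longrightarrow> e \<inter> cluster O' v = {}"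
  shows "cluster (O' \<union> A) v = cluster O' v"
    and "y \<notin> cluster O' v \<Longrightarrow> cluster (O' \<union> A) y = cluster A y"
    and "\<Union>O' \<inter> \<Union>A = {}"
proof -
  have A: "\<Union>A \<inter> cluster O' v = {}" using assms(2,3) by blast
  then show dis: "\<Union>O' \<inter> \<Union>A = {}" using assms(1) by blast
  have v: "v \<notin> \<Union>A" by (metis A cluster_self disjoint_iff)
  show "cluster (O' \<union> A) v = cluster O' v"
    using conn_Un_disjoint[OF dis v] by (simp add: cluster_def)
  assume "y \<notin> cluster O' v"
  then have y: "y \<notin> \<Union>O'" using assms(1) by blast
  have "\<Union>A \<inter> \<Union>O' = {}" using dis by blast
  from conn_Un_disjoint[OF this y] show "cluster (O' \<union> A) y = cluster A y"
    by (simp add: cluster_def Un_commute)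
qed

lemma explored_insert:
  assumes "\<Union>O' \<subseteq> cluster O' v" "x \<in> cluster O' v"
  shows "\<Union>(insert {x, z} O') \<subseteq> cluster (insert {x, z} O') v"
proof -
  have "cluster O' v \<subseteq> cluster (insert {x, z} O') v" by (rule cluster_mono) blast
  moreover have "z \<in> cluster (insert {x, z} O') v"
    using assms(2) by (simp add: cluster_def conn_insert)
  ultimately show ?thesis using assms by auto
qed

text \<open>
  Two parameters \<open>p' < p\<close> with a margin \<open>\<theta>\<close>. The assumption \<open>odds\<close> says that the odds of \<open>p'\<close> are at
  most \<open>1 - \<theta>\<close> times those of \<open>p\<close>, in a form that makes sense for \<open>p = 1\<close>. If every vertex is marked
  independently with probability \<open>1 - s\<close>, then \<open>1 - s ^ card C\<close> is the probability that the cluster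
  \<open>C\<close> contains a mark, and the assumption \<open>few\<close> says that this is rare at parameter \<open>p\<close>. Weighting a
  configuration by \<open>tilt v\<close> amounts to conditioning on the cluster of \<open>v\<close> being free of marks.
\<close>

locale sprinkling = hi: rc_params p c + lo: rc_params p' c
  for p p' c :: real +
  fixes s \<theta> :: real and E :: "'a set set"
  assumes s: "0 < s" "s \<le> 1" and \<theta>: "0 \<le> \<theta>" "\<theta> < 1" and E: "graph_edges E"
    and odds: "p' * (1 - p) \<le> p * (1 - p') * (1 - \<theta>)"
    and few: "\<And>U y. U \<subseteq> E \<Longrightarrow> rc_mean p c {} U (\<lambda>X. 1 - s ^ card (cluster X y)) \<le> \<theta>"
begin

abbreviation tilt :: "'a \<Rightarrow> 'a set set \<Rightarrow> real" where
  "tilt v X \<equiv> s ^ card (cluster X v)"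

lemma fin_sub: "U \<subseteq> E \<Longrightarrow> finite U"
  using E graph_edgesD(1) finite_subset by blast

lemma wsum_few:
  assumes "U \<subseteq> E"
  shows "wsum p c {} U (\<lambda>X. 1 - tilt y X) \<le> \<theta> * wsum p c {} U (\<lambda>_. 1)"
  using few[OF assms, of y] hi.wsum_1_pos[OF fin_sub[OF assms], of "{}"]
  by (simp add: rc_mean_def divide_simps)

lemma touching_edge:
  assumes "e \<in> E" "e \<inter> C \<noteq> {}"
  obtains x z where "e = {x, z}" "x \<in> C"
proof -
  obtain x z where "e = {x, z}" using graph_edges_obtain[OF E assms(1)] .
  then show thesis using that[of x z] that[of z x] assms(2) by (auto simp: insert_commute)
qed

text \<open>
  The next edge of the exploration of the cluster of \<open>v\<close>. The open edges found so far all belong to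
  that cluster, and this remains true when the new edge turns out to be open.
\<close>

lemma exploration_step:
  assumes sub: "O' \<union> U \<subseteq> E" and expl: "\<Union>O' \<subseteq> cluster O' v"
    and touch: "\<exists>e\<in>U. e \<inter> cluster O' v \<noteq> {}"
  obtains x z U' where "U = insert {x, z} U'" "{x, z} \<notin> U'" "finite U'" "card U' < card U"
    "x \<in> cluster O' v" "insert {x, z} O' \<union> U' \<subseteq> E" "O' \<union> U' \<subseteq> E"
    "\<Union>(insert {x, z} O') \<subseteq> cluster (insert {x, z} O') v"
proof -
  obtain e where e: "e \<in> U" "e \<inter> cluster O' v \<noteq> {}" using touch by blast
  moreover from this have "e \<in> E" using sub by blast
  ultimately obtain x z where xz: "e = {x, z}" "x \<in> cluster O' v" using touching_edge by blast
  have U: "U = insert e (U - {e})" "finite U" using e fin_sub[of U] sub by auto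
  show thesis
  proof (rule that[of x z "U - {e}"])
    show "\<Union>(insert {x, z} O') \<subseteq> cluster (insert {x, z} O') v"
      by (rule explored_insert[OF expl xz(2)])
    show "card (U - {e}) < card U" using e(1) U(2) by (intro card_Diff1_less)
  qed (use U xz sub e in auto)
qed

text \<open>
  Once the exploration has stopped, the cluster of \<open>v\<close> is known and the undecided edges form a free
  model on its complement, where the marks are few.
\<close>

lemma tilt_outside_explored:
  assumes sub: "O' \<union> U \<subseteq> E" and expl: "\<Union>O' \<subseteq> cluster O' v"
    and stop: "\<And>e. e \<in> U \<Longrightarrow> e \<inter> cluster O' v = {}"
  shows "wsum p c O' U (\<lambda>X. if y \<in> cluster X v then 0 else tilt v X * (1 - tilt y X))
    \<le> \<theta> * wsum p c O' U (\<lambda>X. if y \<in> cluster X v then 0 else tilt v X)" (is "?L \<le> \<theta> * ?R")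
proof -
  note const = cluster_const_outside[OF expl _ stop]
  have w: "wt p c O' U A = c ^ edge_rank O' * wt p c {} U A" if "A \<subseteq> U" for A
  proof -
    have "graph_edges O'" "graph_edges A"
      by (rule graph_edges_subset[OF E], use sub that in blast)+
    from edge_rank_Un_disjoint[OF this const(3)[OF that]] show ?thesis
      by (simp add: wt_def power_add)
  qed
  show ?thesis
  proof (cases "y \<in> cluster O' v")
    case True
    have "?L = wsum p c O' U (\<lambda>_. 0)" "?R = wsum p c O' U (\<lambda>_. 0)"
      using True const(1) by (auto intro!: wsum_cong)
    then show ?thesis by (simp add: wsum_def)
  next
    case False
    define K where "K = tilt v O' * c ^ edge_rank O'"
    have K: "0 \<le> K" using s hi.c by (simp add: K_def)
    have "?L = K * wsum p c {} U (\<lambda>X. 1 - tilt y X)"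
      unfolding wsum_def sum_distrib_left
      using False const(1) const(2)[where y = y] by (intro sum.cong) (auto simp: w K_def)
    also have "\<dots> \<le> K * (\<theta> * wsum p c {} U (\<lambda>_. 1))"
      using K wsum_few[of U y] sub by (intro mult_left_mono) auto
    also have "\<dots> = \<theta> * ?R"
      unfolding wsum_def sum_distrib_left
      using False const(1) by (intro sum.cong) (auto simp: w K_def)
    finally show ?thesis .
  qed
qed

text \<open>
  The tilt depends on the cluster of \<open>v\<close> only, so it does not disturb the law of the rest of the
  configuration given that cluster: on the event that \<open>y\<close> lies outside, the cluster of \<open>y\<close> is marked
  with probability at most \<open>\<theta>\<close>. Both sides are additive over the state of an edge, hence it suffices to
  explore the cluster of \<open>v\<close> to the end.
\<close>

lemma tilt_outside:
  assumes "O' \<union> U \<subseteq> E" "\<Union>O' \<subseteq> cluster O' v"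
  shows "wsum p c O' U (\<lambda>X. if y \<in> cluster X v then 0 else tilt v X * (1 - tilt y X))
    \<le> \<theta> * wsum p c O' U (\<lambda>X. if y \<in> cluster X v then 0 else tilt v X)"
  using assms
proof (induction "card U" arbitrary: O' U rule: less_induct)
  case less
  show ?case
  proof (cases "\<exists>e\<in>U. e \<inter> cluster O' v \<noteq> {}")
    case True
    from exploration_step[OF less.prems this] obtain x z U'
      where U: "U = insert {x, z} U'" "{x, z} \<notin> U'" "finite U'" "card U' < card U"
        and sub: "insert {x, z} O' \<union> U' \<subseteq> E" "O' \<union> U' \<subseteq> E"
        and expl: "\<Union>(insert {x, z} O') \<subseteq> cluster (insert {x, z} O') v" by metis
    note IH = less.hyps[OF U(4) sub(2) less.prems(2)] less.hyps[OF U(4) sub(1) expl]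
    show ?thesis
      unfolding U(1) wsum_split[OF U(3,2)] distrib_left
      using IH[THEN mult_left_mono, of "1 - p"] IH[THEN mult_left_mono, of p] hi.p
      by (simp add: mult.left_commute[of \<theta>])
  next
    case False
    then show ?thesis using tilt_outside_explored[OF less.prems] by blast
  qed
qed

text \<open>
  The cluster of \<open>v\<close> at the lower parameter is stochastically dominated by the cluster at the higher
  parameter, conditioned to be free of marks. In an exploration of the cluster, it suffices that every
  edge \<open>{x, z}\<close> met on the way is open with larger odds in the second model. By
  \<open>wsum_insert_explored\<close> the odds in the first model are governed by the probability that \<open>z\<close> belongs to
  the cluster although the edge is closed. The same probability for the second model is larger, by
  induction, applied to the increasing function \<open>z \<in> C\<close>. Conditioning away the marks lowers the odds in
  the second model, since opening the edge may attach a marked cluster of \<open>z\<close>; but that cluster lies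
  outside the one explored, so \<open>tilt_outside\<close> bounds the loss by a factor \<open>1 - \<theta>\<close>, which \<open>odds\<close>
  compensates.
\<close>

theorem cluster_domination:
  fixes g :: "'a set \<Rightarrow> real"
  assumes "O' \<union> U \<subseteq> E" "\<Union>O' \<subseteq> cluster O' v"
    and "\<And>A B. A \<subseteq> B \<Longrightarrow> finite B \<Longrightarrow> g A \<le> g B"
  shows "wsum p' c O' U (\<lambda>X. g (cluster X v)) / wsum p' c O' U (\<lambda>_. 1)
    \<le> wsum p c O' U (\<lambda>X. g (cluster X v) * tilt v X) / wsum p c O' U (tilt v)"
  using assms
proof (induction "card U" arbitrary: O' U g rule: less_induct)
  case less
  have finU: "finite U" using less.prems(1) fin_sub by blast
  show ?case
  proof (cases "\<exists>e\<in>U. e \<inter> cluster O' v \<noteq> {}")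
    case False
    then have const: "cluster (O' \<union> A) v = cluster O' v" if "A \<subseteq> U" for A
      using cluster_const_outside(1)[OF less.prems(2) that] by blast
    let ?t = "tilt v O'" and ?g = "g (cluster O' v)"
    have eqs: "wsum p' c O' U (\<lambda>X. g (cluster X v)) = wsum p' c O' U (\<lambda>X. ?g * 1)"
      "wsum p c O' U (\<lambda>X. g (cluster X v) * tilt v X) = wsum p c O' U (\<lambda>X. ?g * ?t * 1)"
      "wsum p c O' U (tilt v) = wsum p c O' U (\<lambda>X. ?t * 1)"
      by (auto intro!: wsum_cong simp: const)
    have "0 < ?t" using s by simp
    then show ?thesis
      unfolding eqs wsum_cmult using lo.wsum_1_pos[OF finU, of O'] hi.wsum_1_pos[OF finU, of O'] s
      by simp
  next
    case True
    from exploration_step[OF less.prems(1,2) this] obtain x z U'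
      where U: "U = insert {x, z} U'" "{x, z} \<notin> U'" "finite U'" "card U' < card U"
        and x: "x \<in> cluster O' v" and sub': "insert {x, z} O' \<union> U' \<subseteq> E" "O' \<union> U' \<subseteq> E"
        and expl': "\<Union>(insert {x, z} O') \<subseteq> cluster (insert {x, z} O') v" by metis
    define O1 where "O1 = insert {x, z} O'"
    note sub = sub'[folded O1_def] and expl = expl'[folded O1_def]
    have gE: "graph_edges (O' \<union> U')" by (rule graph_edges_subset[OF E sub(2)])
    (* Index 0: the edge is closed, index 1: it is open. Primes refer to the lower parameter p'. *)
    define Z0' where "Z0' = wsum p' c O' U' (\<lambda>_. 1)"
    define Z1' where "Z1' = wsum p' c O1 U' (\<lambda>_. 1)"
    define Z0 where "Z0 = wsum p c O' U' (tilt v)"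
    define Z1 where "Z1 = wsum p c O1 U' (tilt v)"
    define N0' where "N0' = wsum p' c O' U' (\<lambda>X. g (cluster X v))"
    define N1' where "N1' = wsum p' c O1 U' (\<lambda>X. g (cluster X v))"
    define N0 where "N0 = wsum p c O' U' (\<lambda>X. g (cluster X v) * tilt v X)"
    define N1 where "N1 = wsum p c O1 U' (\<lambda>X. g (cluster X v) * tilt v X)"
    have Zpos: "0 < Z0'" "0 < Z1'" "0 < Z0" "0 < Z1"
      unfolding Z0'_def Z1'_def Z0_def Z1_def using U(3) s hi.p hi.c
      by (auto intro!: lo.wsum_1_pos wsum_pos)
    let ?in = "\<lambda>C. of_bool (z \<in> C) :: real"
    have IH0: "N0' / Z0' \<le> N0 / Z0" and IH1: "N1' / Z1' \<le> N1 / Z1"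
      unfolding Z0'_def Z1'_def Z0_def Z1_def N0'_def N1'_def N0_def N1_def
      by (rule less.hyps[OF U(4) sub(2) less.prems(2)] less.hyps[OF U(4) sub(1) expl], erule (1) less.prems(3))+
    define P' where "P' = wsum p' c O' U' (\<lambda>X. ?in (cluster X v))"
    define P where "P = wsum p c O' U' (\<lambda>X. ?in (cluster X v) * tilt v X)"
    have IHz: "P' / Z0' \<le> P / Z0"
      unfolding P'_def P_def Z0'_def Z0_def
      by (rule less.hyps[OF U(4) sub(2) less.prems(2)]) auto
    have FKG: "N0' / Z0' \<le> N1' / Z1'"
    proof -
      have "rc_mean p' c O' U' (\<lambda>X. g (cluster X v)) \<le> rc_mean p' c O1 U' (\<lambda>X. g (cluster X v))"
      proof (rule rc_mean_comparison)
        show "graph_edges U'" "graph_edges O1" by (rule graph_edges_subset[OF E], use sub in blast)+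
        fix A B :: "'a set set" assume AB: "A \<subseteq> B" "B \<subseteq> O1 \<union> U'"
        then have "graph_edges B" by (intro graph_edges_subset[OF E]) (use sub in blast)
        then show "g (cluster A v) \<le> g (cluster B v)"
          using AB(1) by (intro less.prems(3) cluster_mono finite_cluster)
      qed (use lo.rc_params_axioms in \<open>auto simp: O1_def\<close>)
      then show ?thesis by (simp add: rc_mean_def N0'_def N1'_def Z0'_def Z1'_def)
    qed
    have in_x: "conn (O' \<union> A) v x" for A
      using x conn_mono[of O' "O' \<union> A"] by (auto simp: cluster_def)
    have conn_xz: "conn (O' \<union> A) x z \<longleftrightarrow> z \<in> cluster (O' \<union> A) v" for A
      using cluster_eq[OF in_x[of A]] by (auto simp: cluster_def)
    have Z1'_eq: "Z1' = c * Z0' + (1 - c) * P'"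
    proof -
      have "Z1' = wsum p' c O' U' (\<lambda>X. 1 * (if conn X x z then 1 else c))"
        unfolding Z1'_def O1_def by (rule wsum_insert_explored[OF gE])
      also have "\<dots> = wsum p' c O' U' (\<lambda>X. c * 1 + (1 - c) * ?in (cluster X v))"
        by (rule wsum_cong) (simp add: conn_xz)
      finally show ?thesis by (simp only: wsum_add wsum_cmult Z0'_def P'_def)
    qed
    (* If z is not in the cluster, opening the edge adds the cluster of z, and the factor c of the
       untilted model has to be multiplied by the tilt of that cluster. *)
    have Z1_ge: "c * Z0 + (1 - c) * P - c * \<theta> * Z0 \<le> Z1"
    proof -
      let ?far = "\<lambda>X. if z \<in> cluster X v then 0 else tilt v X * (1 - tilt z X)"
      have far: "wsum p c O' U' ?far \<le> \<theta> * Z0"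
      proof -
        have "wsum p c O' U' ?far \<le> \<theta> * wsum p c O' U' (\<lambda>X. if z \<in> cluster X v then 0 else tilt v X)"
          by (rule tilt_outside[OF sub(2) less.prems(2)])
        also have "\<dots> \<le> \<theta> * Z0" unfolding Z0_def
          using \<theta> s hi.p hi.c by (intro mult_left_mono wsum_mono) auto
        finally show ?thesis .
      qed
      have "c * Z0 + (1 - c) * P - c * \<theta> * Z0 \<le> c * Z0 + (1 - c) * P - c * wsum p c O' U' ?far"
        using far hi.c by simp
      also have "\<dots> = wsum p c O' U' (\<lambda>X. c * tilt v X + (1 - c) * (?in (cluster X v) * tilt v X) - c * ?far X)"
        by (simp only: wsum_add wsum_diff wsum_cmult Z0_def P_def)
      also have "\<dots> \<le> wsum p c O' U' (\<lambda>X. tilt v (insert {x, z} X) * (if conn X x z then 1 else c))"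
      proof (rule wsum_mono)
        fix A assume A: "A \<subseteq> U'"
        let ?X = "O' \<union> A"
        have cl: "cluster (insert {x, z} ?X) v = cluster ?X v \<union> cluster ?X z"
          using cluster_eq[OF in_x[of A]] in_x[of A] by (simp add: cluster_insert)
        show "c * tilt v ?X + (1 - c) * (?in (cluster ?X v) * tilt v ?X) - c * ?far ?X
          \<le> tilt v (insert {x, z} ?X) * (if conn ?X x z then 1 else c)"
        proof (cases "z \<in> cluster ?X v")
          case True
          then have "cluster ?X v = cluster ?X z" by (intro cluster_eq) (simp add: cluster_def)
          with True show ?thesis by (simp add: conn_xz cl algebra_simps)
        next
          case False
          have "s ^ (card (cluster ?X v) + card (cluster ?X z)) \<le> tilt v (insert {x, z} ?X)"
            unfolding cl using s by (intro power_decreasing card_Un_le) auto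
          then have "c * (tilt v ?X * tilt z ?X) \<le> c * tilt v (insert {x, z} ?X)"
            using hi.c by (intro mult_left_mono) (simp_all add: power_add)
          with False show ?thesis by (simp add: conn_xz algebra_simps)
        qed
      qed (use hi.p hi.c in auto)
      also have "\<dots> = Z1"
        unfolding Z1_def O1_def by (rule wsum_insert_explored[OF gE, symmetric])
      finally show ?thesis .
    qed
    have odds': "p' * Z1' * ((1 - p) * Z0) \<le> (1 - p') * Z0' * (p * Z1)"
    proof -
      define \<pi>' where "\<pi>' = P' / Z0'"
      have P'_eq: "P' = \<pi>' * Z0'" using Zpos by (simp add: \<pi>'_def)
      have "0 \<le> P'" using wsum_mono[of p' c U' "\<lambda>_. 0" O' "\<lambda>X. ?in (cluster X v)"] lo.p lo.c
        by (simp add: P'_def wsum_def)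
      then have \<pi>': "0 \<le> \<pi>'" using Zpos by (simp add: \<pi>'_def)
      have "\<pi>' * Z0 \<le> P" using IHz Zpos by (simp add: \<pi>'_def field_simps)
      then have "(1 - c) * (\<pi>' * Z0) \<le> (1 - c) * P" using hi.c by (intro mult_left_mono) auto
      moreover have "0 \<le> \<theta> * ((1 - c) * (\<pi>' * Z0))" using \<theta> hi.c \<pi>' Zpos by simp
      ultimately have "(1 - \<theta>) * ((c + (1 - c) * \<pi>') * Z0) \<le> Z1"
        using Z1_ge by (simp add: algebra_simps)
      then have "(1 - p') * Z0' * (p * ((1 - \<theta>) * ((c + (1 - c) * \<pi>') * Z0))) \<le> (1 - p') * Z0' * (p * Z1)"
        using lo.p hi.p Zpos by (intro mult_left_mono) auto
      moreover have "p' * (1 - p) * (Z0' * (c + (1 - c) * \<pi>') * Z0)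
          \<le> p * (1 - p') * (1 - \<theta>) * (Z0' * (c + (1 - c) * \<pi>') * Z0)"
        using odds Zpos \<pi>' hi.c by (intro mult_right_mono) auto
      moreover have "Z1' = Z0' * (c + (1 - c) * \<pi>')" by (simp add: Z1'_eq P'_eq algebra_simps)
      ultimately show ?thesis by (simp add: mult_ac)
    qed
    have "((1 - p') * Z0' * (N0' / Z0') + p' * Z1' * (N1' / Z1')) / ((1 - p') * Z0' + p' * Z1')
      \<le> ((1 - p) * Z0 * (N0 / Z0) + p * Z1 * (N1 / Z1)) / ((1 - p) * Z0 + p * Z1)"
    proof (rule mixture_le)
      show "0 < p * Z1 + (1 - p) * Z0" "0 < p' * Z1' + (1 - p') * Z0'"
        using Zpos hi.p lo.p by (smt (verit) mult_nonneg_nonneg mult_pos_pos)+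
    qed (use Zpos hi.p lo.p odds' FKG IH0 IH1 in auto)
    then show ?thesis
      unfolding U(1) wsum_split[OF U(3,2)] using Zpos
      by (simp add: O1_def[symmetric] Z0'_def[symmetric] Z1'_def[symmetric] Z0_def[symmetric] Z1_def[symmetric]
          N0'_def[symmetric] N1'_def[symmetric] N0_def[symmetric] N1_def[symmetric])
  qed
qed

text \<open>
  A cluster of size at least \<open>k\<close> is free of marks with probability at most \<open>s ^ k\<close>, while the
  conditioning event has probability at least \<open>1 - \<theta>\<close>.
\<close>

theorem cluster_tail:
  "rc_mean p' c {} E (\<lambda>X. of_bool (k \<le> card (cluster X v))) \<le> s ^ k / (1 - \<theta>)"
proof -
  let ?g = "\<lambda>C. of_bool (k \<le> card C) :: real"
  let ?Z = "wsum p c {} E (\<lambda>_. 1)"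
  have Z: "0 < ?Z" using fin_sub hi.wsum_1_pos by blast
  have "wsum p c {} E (\<lambda>X. 1 - tilt v X) \<le> \<theta> * ?Z" by (rule wsum_few) simp
  then have low: "(1 - \<theta>) * ?Z \<le> wsum p c {} E (tilt v)"
    by (simp add: wsum_diff algebra_simps)
  have "rc_mean p' c {} E (\<lambda>X. ?g (cluster X v))
      \<le> wsum p c {} E (\<lambda>X. ?g (cluster X v) * tilt v X) / wsum p c {} E (tilt v)"
    unfolding rc_mean_def
    by (rule cluster_domination) (auto intro: card_mono order_trans)
  also have "\<dots> \<le> (s ^ k * ?Z) / ((1 - \<theta>) * ?Z)"
  proof (rule frac_le)
    have "wsum p c {} E (\<lambda>X. ?g (cluster X v) * tilt v X) \<le> wsum p c {} E (\<lambda>X. s ^ k * 1)"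
      using s hi.p hi.c by (intro wsum_mono) (auto intro: power_decreasing)
    then show "wsum p c {} E (\<lambda>X. ?g (cluster X v) * tilt v X) \<le> s ^ k * ?Z"
      unfolding wsum_cmult .
  qed (use low Z s \<theta> in auto)
  also have "\<dots> = s ^ k / (1 - \<theta>)" using Z by simp
  finally show ?thesis .
qed

end

section \<open>Ising spins\<close>

definition spins :: "'a set \<Rightarrow> ('a \<Rightarrow> real) set" where
  "spins V = V \<rightarrow>\<^sub>E {-1, 1}"

definition edge_spin :: "('a \<Rightarrow> real) \<Rightarrow> 'a set \<Rightarrow> real" where
  "edge_spin \<sigma> e = (\<Prod>v\<in>e. \<sigma> v)"

lemma spins_cases: "\<sigma> \<in> spins V \<Longrightarrow> v \<in> V \<Longrightarrow> \<sigma> v = 1 \<or> \<sigma> v = -1"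
  by (auto simp: spins_def PiE_def Pi_def)

lemma spins_square: "\<sigma> \<in> spins V \<Longrightarrow> v \<in> V \<Longrightarrow> \<sigma> v * \<sigma> v = 1"
  using spins_cases[of \<sigma> V v] by auto

lemma edge_spin_pair: "x \<noteq> y \<Longrightarrow> edge_spin \<sigma> {x, y} = \<sigma> x * \<sigma> y"
  by (simp add: edge_spin_def)

lemma edge_spin_square:
  assumes "\<sigma> \<in> spins V" "e \<subseteq> V"
  shows "edge_spin \<sigma> e * edge_spin \<sigma> e = 1"
  unfolding edge_spin_def prod.distrib[symmetric]
  using spins_square[OF assms(1)] assms(2) by (intro prod.neutral) auto

text \<open>
  The cone of nonnegative combinations of products of spins.
\<close>

inductive ferro :: "'a set \<Rightarrow> (('a \<Rightarrow> real) \<Rightarrow> real) \<Rightarrow> bool" for V where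
  const: "0 \<le> a \<Longrightarrow> ferro V (\<lambda>_. a)"
| add: "ferro V f \<Longrightarrow> ferro V g \<Longrightarrow> ferro V (\<lambda>\<sigma>. f \<sigma> + g \<sigma>)"
| spin_mult: "v \<in> V \<Longrightarrow> ferro V f \<Longrightarrow> ferro V (\<lambda>\<sigma>. \<sigma> v * f \<sigma>)"

lemma ferro_scale: "ferro V f \<Longrightarrow> 0 \<le> a \<Longrightarrow> ferro V (\<lambda>\<sigma>. a * f \<sigma>)"
proof (induction rule: ferro.induct)
  case (const b) then show ?case by (intro ferro.const) simp
next
  case (add f g) then show ?case unfolding distrib_left by (intro ferro.add) auto
next
  case (spin_mult v f) then show ?case unfolding mult.left_commute[of a] by (intro ferro.spin_mult) auto
qed

lemma ferro_mult: "ferro V f \<Longrightarrow> ferro V g \<Longrightarrow> ferro V (\<lambda>\<sigma>. f \<sigma> * g \<sigma>)"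
proof (induction rule: ferro.induct)
  case (const b) then show ?case by (intro ferro_scale)
next
  case (add f g) then show ?case unfolding distrib_right by (intro ferro.add) auto
next
  case (spin_mult v f) then show ?case unfolding mult.assoc by (intro ferro.spin_mult) auto
qed

lemma ferro_spin: "v \<in> V \<Longrightarrow> ferro V (\<lambda>\<sigma>. \<sigma> v)"
  using ferro.spin_mult[OF _ ferro.const[of 1], of v V] by simp

lemma ferro_prod: "(\<And>i. i \<in> I \<Longrightarrow> ferro V (f i)) \<Longrightarrow> ferro V (\<lambda>\<sigma>. \<Prod>i\<in>I. f i \<sigma>)"
  by (induction I rule: infinite_finite_induct) (auto intro: ferro.const ferro_mult)

lemma ferro_edge_spin: "e \<subseteq> V \<Longrightarrow> ferro V (\<lambda>\<sigma>. edge_spin \<sigma> e)"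
  unfolding edge_spin_def by (intro ferro_prod ferro_spin) auto

lemma ferro_edge_factor: "e \<subseteq> V \<Longrightarrow> 0 \<le> a \<Longrightarrow> 0 \<le> b \<Longrightarrow> ferro V (\<lambda>\<sigma>. a + b * edge_spin \<sigma> e)"
  by (intro ferro.add ferro.const ferro_scale ferro_edge_spin)

text \<open>
  A monomial in the spins factorises over the vertices, with factors \<open>1 + (-1) ^ m\<close>. The extra monomial
  in the proof makes the statement stable under multiplication by a spin.
\<close>

theorem griffiths:
  assumes "finite V" "ferro V f"
  shows "0 \<le> (\<Sum>\<sigma>\<in>spins V. f \<sigma>)"
proof -
  have "0 \<le> (\<Sum>\<sigma>\<in>spins V. f \<sigma> * (\<Prod>v\<in>V. \<sigma> v ^ m v))" for m :: "'a \<Rightarrow> nat"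
    using assms(2)
  proof (induction arbitrary: m rule: ferro.induct)
    case (const a)
    have "(\<Sum>\<sigma>\<in>spins V. \<Prod>v\<in>V. \<sigma> v ^ m v) = (\<Prod>v\<in>V. \<Sum>s\<in>{-1, 1::real}. s ^ m v)"
      unfolding spins_def using assms(1) by (subst prod_sum_PiE) auto
    also have "\<dots> \<ge> 0"
    proof (intro prod_nonneg)
      fix v show "0 \<le> (\<Sum>s\<in>{-1, 1::real}. s ^ m v)" by (cases "even (m v)") auto
    qed
    finally show ?case using const by (simp add: sum_distrib_left[symmetric])
  next
    case (add f g)
    then show ?case by (simp add: distrib_right sum.distrib)
  next
    case (spin_mult v f)
    have "\<sigma> v * f \<sigma> * (\<Prod>u\<in>V. \<sigma> u ^ m u) = f \<sigma> * (\<Prod>u\<in>V. \<sigma> u ^ (m(v := Suc (m v))) u)" for \<sigma> :: "'a \<Rightarrow> real"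
    proof -
      have "(\<Prod>u\<in>V. \<sigma> u ^ (m(v := Suc (m v))) u) = \<sigma> v * (\<Prod>u\<in>V. \<sigma> u ^ m u)"
      proof -
        have "(\<Prod>u\<in>V - {v}. \<sigma> u ^ (m(v := Suc (m v))) u) = (\<Prod>u\<in>V - {v}. \<sigma> u ^ m u)"
          by (intro prod.cong) auto
        then show ?thesis
          unfolding prod.remove[OF assms(1) spin_mult(1)] by simp
      qed
      then show ?thesis by simp
    qed
    then show ?case using spin_mult.IH[of "m(v := Suc (m v))"] by (simp only:)
  qed
  from this[of "\<lambda>_. 0"] show ?thesis by simp
qed

definition flip :: "'a set \<Rightarrow> ('a \<Rightarrow> real) \<Rightarrow> 'a \<Rightarrow> real" where
  "flip K \<sigma> v = (if v \<in> K then - \<sigma> v else \<sigma> v)"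

lemma flip_spins: "K \<subseteq> V \<Longrightarrow> \<sigma> \<in> spins V \<Longrightarrow> flip K \<sigma> \<in> spins V"
  by (auto simp: spins_def PiE_def Pi_def extensional_def flip_def)

lemma flip_flip [simp]: "flip K (flip K \<sigma>) = \<sigma>"
  by (simp add: flip_def fun_eq_iff)

lemma sum_odd_under_flip:
  fixes f :: "('a \<Rightarrow> real) \<Rightarrow> real"
  assumes "K \<subseteq> V" "\<And>\<sigma>. \<sigma> \<in> spins V \<Longrightarrow> f (flip K \<sigma>) = - f \<sigma>"
  shows "(\<Sum>\<sigma>\<in>spins V. f \<sigma>) = 0"
proof -
  have "(\<Sum>\<sigma>\<in>spins V. f \<sigma>) = (\<Sum>\<sigma>\<in>spins V. f (flip K \<sigma>))"
    by (rule sum.reindex_bij_witness[of _ "flip K" "flip K"])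
      (auto simp: flip_spins[OF assms(1)])
  also have "\<dots> = (\<Sum>\<sigma>\<in>spins V. - f \<sigma>)" using assms(2) by (intro sum.cong refl)
  also have "\<dots> = - (\<Sum>\<sigma>\<in>spins V. f \<sigma>)" by (rule sum_negf)
  finally show ?thesis by simp
qed

lemma edge_spin_flip:
  assumes "card e = 2" "e \<subseteq> K \<or> e \<inter> K = {}"
  shows "edge_spin (flip K \<sigma>) e = edge_spin \<sigma> e"
proof -
  obtain x y where "e = {x, y}" "x \<noteq> y" using assms(1) by (auto simp: card_2_iff)
  then show ?thesis using assms(2) by (auto simp: edge_spin_pair flip_def)
qed

text \<open>
  This vanishes unless the spins are constant on the clusters of \<open>A\<close>, and then equals \<open>2 ^ card A\<close>.
\<close>

definition agree :: "'a set set \<Rightarrow> ('a \<Rightarrow> real) \<Rightarrow> real" where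
  "agree A \<sigma> = (\<Prod>e\<in>A. 1 + edge_spin \<sigma> e)"

lemma edge_in_cluster:
  assumes "graph_edges A" "e \<in> A"
  shows "e \<subseteq> cluster A x \<or> e \<inter> cluster A x = {}"
proof -
  obtain u v where e: "e = {u, v}" using graph_edges_obtain[OF assms] .
  have "conn A u v" "conn A v u" using assms(2) e by (auto intro: conn_edge conn_sym)
  then have "conn A x u \<longleftrightarrow> conn A x v" using conn_trans[of A x] by blast
  then show ?thesis by (auto simp: e cluster_def)
qed

lemma agree_spin_eq:
  assumes "graph_edges A" "\<Union>A \<subseteq> V" "\<sigma> \<in> spins V" "conn A x y"
  shows "\<sigma> x * agree A \<sigma> = \<sigma> y * agree A \<sigma>"
  using assms(4)
proof (induction rule: conn_induct)
  case (step u v)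
  have uv: "u \<noteq> v" using assms(1) step(2) by (auto simp: graph_edges_def card_2_iff doubleton_eq_iff)
  have V: "u \<in> V" "v \<in> V" using assms(2) step(2) by auto
  have "\<sigma> u * (1 + edge_spin \<sigma> {u, v}) = \<sigma> v * (1 + edge_spin \<sigma> {u, v})"
    using spins_square[OF assms(3) V(1)] spins_square[OF assms(3) V(2)]
    by (simp add: edge_spin_pair[OF uv] algebra_simps)
  moreover have "agree A \<sigma> = (1 + edge_spin \<sigma> {u, v}) * (\<Prod>e\<in>A - {{u, v}}. 1 + edge_spin \<sigma> e)"
    unfolding agree_def using step(2) graph_edgesD(1)[OF assms(1)] by (simp add: prod.remove)
  ultimately have "\<sigma> u * agree A \<sigma> = \<sigma> v * agree A \<sigma>" by (metis mult.assoc)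
  with step.IH show ?case by simp
qed simp

text \<open>
  If \<open>x\<close> and \<open>y\<close> are not connected, flipping all spins in the cluster of \<open>x\<close> reverses the sign of the
  summand.
\<close>

lemma sum_spins_agree:
  assumes "finite V" "graph_edges A" "\<Union>A \<subseteq> V" "x \<in> V" "y \<in> V"
  shows "(\<Sum>\<sigma>\<in>spins V. \<sigma> x * \<sigma> y * agree A \<sigma>) =
    (if conn A x y then (\<Sum>\<sigma>\<in>spins V. agree A \<sigma>) else 0)"
proof (cases "conn A x y")
  case True
  have "\<sigma> x * \<sigma> y * agree A \<sigma> = agree A \<sigma>" if "\<sigma> \<in> spins V" for \<sigma>
    using agree_spin_eq[OF assms(2,3) that True] spins_square[OF that assms(4)]
    by (metis mult.assoc mult.left_commute mult_1)
  then have "(\<Sum>\<sigma>\<in>spins V. \<sigma> x * \<sigma> y * agree A \<sigma>) = (\<Sum>\<sigma>\<in>spins V. agree A \<sigma>)"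
    by (intro sum.cong refl)
  then show ?thesis using True by simp
next
  case False
  let ?K = "cluster A x"
  have K: "?K \<subseteq> V" using cluster_subset[of A x] assms by auto
  have "agree A (flip ?K \<sigma>) = agree A \<sigma>" for \<sigma>
    unfolding agree_def using assms(2) edge_in_cluster[OF assms(2)]
    by (intro prod.cong) (auto simp: edge_spin_flip graph_edges_def)
  moreover have "flip ?K \<sigma> x = - \<sigma> x" "flip ?K \<sigma> y = \<sigma> y" for \<sigma> :: "'a \<Rightarrow> real"
    using False by (auto simp: flip_def cluster_def)
  ultimately show ?thesis using False
    by (simp add: sum_odd_under_flip[OF K])
qed

lemma sum_agree:
  assumes "finite V" "graph_edges A" "\<Union>A \<subseteq> V"
  shows "(\<Sum>\<sigma>\<in>spins V. agree A \<sigma>) = 2 ^ card V * 2 ^ card A * (1/2) ^ edge_rank A"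
proof -
  have "finite A" using assms graph_edgesD by auto
  then show ?thesis using assms(2,3)
  proof (induction A)
    case empty
    show ?case using assms(1) by (simp add: agree_def spins_def card_PiE numeral_2_eq_2)
  next
    case (insert e A)
    have gA: "graph_edges A" using insert.prems(1) graph_edges_subset by blast
    obtain x y where e: "e = {x, y}" "x \<noteq> y" using graph_edges_obtain[OF insert.prems(1)] by blast
    have xy: "x \<in> V" "y \<in> V" using insert.prems(2) e by auto
    have "(\<Sum>\<sigma>\<in>spins V. agree (insert e A) \<sigma>)
        = (\<Sum>\<sigma>\<in>spins V. agree A \<sigma>) + (\<Sum>\<sigma>\<in>spins V. \<sigma> x * \<sigma> y * agree A \<sigma>)"
      unfolding agree_def prod.insert[OF insert.hyps(1,2)]
      by (simp add: e edge_spin_pair distrib_right sum.distrib)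
    also have "\<dots> = 2 ^ card V * 2 ^ card (insert e A) * (1/2) ^ edge_rank (insert e A)"
      using insert.IH[OF gA] insert.prems(2) insert.hyps sum_spins_agree[OF assms(1) gA _ xy]
        edge_rank_insert[OF gA, of x y] by (simp add: e)
    finally show ?case .
  qed
qed

definition ising :: "'a set \<Rightarrow> real \<Rightarrow> real \<Rightarrow> 'a set set \<Rightarrow> 'a \<Rightarrow> 'a \<Rightarrow> real" where
  "ising V a b E x y = (\<Sum>\<sigma>\<in>spins V. \<sigma> x * \<sigma> y * (\<Prod>e\<in>E. a + b * edge_spin \<sigma> e))"

text \<open>
  For \<open>q = 2\<close>, the factor two for each component counts the spin configurations that are constant on
  components. Expanding the Ising weight of every edge into its open and closed part therefore
  expresses connection probabilities as spin correlations.
\<close>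

theorem edwards_sokal:
  assumes "finite V" "graph_edges E" "\<Union>E \<subseteq> V" "x \<in> V" "y \<in> V"
  shows "ising V (1 - p/2) (p/2) E x y = 2 ^ card V * wsum p (1/2) {} E (\<lambda>X. of_bool (conn X x y))"
proof -
  have finE: "finite E" using assms graph_edgesD by auto
  have "(\<Prod>e\<in>E. 1 - p/2 + p/2 * edge_spin \<sigma> e)
      = (\<Sum>A\<in>Pow E. (p/2) ^ card A * (1 - p) ^ card (E - A) * agree A \<sigma>)" for \<sigma>
  proof -
    have "(\<Prod>e\<in>E. 1 - p/2 + p/2 * edge_spin \<sigma> e) = (\<Prod>e\<in>E. p/2 * (1 + edge_spin \<sigma> e) + (1 - p))"
      by (intro prod.cong refl) (simp add: field_simps)
    also have "\<dots> = (\<Sum>A\<in>Pow E. (\<Prod>e\<in>A. p/2 * (1 + edge_spin \<sigma> e)) * (\<Prod>e\<in>E - A. 1 - p))"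
      by (rule prod_add[OF finE])
    finally show ?thesis unfolding prod.distrib prod_constant agree_def by (simp only: mult_ac)
  qed
  then have "ising V (1 - p/2) (p/2) E x y = (\<Sum>\<sigma>\<in>spins V. \<Sum>A\<in>Pow E.
      (p/2) ^ card A * (1 - p) ^ card (E - A) * (\<sigma> x * \<sigma> y * agree A \<sigma>))"
    unfolding ising_def by (simp add: sum_distrib_left mult_ac)
  also have "\<dots> = (\<Sum>A\<in>Pow E. (p/2) ^ card A * (1 - p) ^ card (E - A) *
      (\<Sum>\<sigma>\<in>spins V. \<sigma> x * \<sigma> y * agree A \<sigma>))"
    by (subst sum.swap) (simp add: sum_distrib_left)
  also have "\<dots> = (\<Sum>A\<in>Pow E. 2 ^ card V * (of_bool (conn A x y) * wt p (1/2) {} E A))"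
  proof (intro sum.cong refl)
    fix A assume "A \<in> Pow E"
    then have A: "graph_edges A" "\<Union>A \<subseteq> V" using assms graph_edges_subset[of E A] by auto
    show "(p/2) ^ card A * (1 - p) ^ card (E - A) * (\<Sum>\<sigma>\<in>spins V. \<sigma> x * \<sigma> y * agree A \<sigma>) =
      2 ^ card V * (of_bool (conn A x y) * wt p (1/2) {} E A)"
      using sum_agree[OF assms(1) A]
      by (simp add: sum_spins_agree[OF assms(1) A assms(4,5)] wt_def power_divide)
  qed
  finally show ?thesis by (simp add: wsum_def sum_distrib_left)
qed

section \<open>The Simon--Lieb inequality\<close>

text \<open>
  Expand the product over \<open>D\<close> into monomials. The constant term does not contribute, every other
  monomial contains some \<open>edge_spin \<sigma> d\<close>, and by Griffiths' inequality all contributions are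
  nonnegative; so extracting such a factor and restoring the full product only increases the sum.
\<close>

lemma odd_boundary_expansion:
  assumes "finite V" "finite D" "\<And>e. e \<in> D \<Longrightarrow> e \<subseteq> V" "ferro V X" "0 < a" "0 \<le> b"
    and "(\<Sum>\<sigma>\<in>spins V. X \<sigma>) = 0"
  shows "(\<Sum>\<sigma>\<in>spins V. X \<sigma> * (\<Prod>e\<in>D. a + b * edge_spin \<sigma> e))
    \<le> (\<Sum>d\<in>D. b / a * (\<Sum>\<sigma>\<in>spins V. X \<sigma> * edge_spin \<sigma> d * (\<Prod>e\<in>D. a + b * edge_spin \<sigma> e)))"
  using assms(2,3)
proof (induction D)
  case empty
  then show ?case using assms(7) by simp
next
  case (insert d D)
  let ?P = "\<lambda>D \<sigma>. \<Prod>e\<in>D. a + b * edge_spin \<sigma> e"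
  let ?S = "\<lambda>f. \<Sum>\<sigma>\<in>spins V. f \<sigma>"
  have fP: "ferro V (?P D)"
    using insert.prems assms(5,6) by (intro ferro_prod ferro_edge_factor) auto
  have pos: "0 \<le> ?S (\<lambda>\<sigma>. X \<sigma> * ?P D \<sigma>)"
    by (intro griffiths[OF assms(1)] ferro_mult assms(4) fP)
  have pos2: "0 \<le> ?S (\<lambda>\<sigma>. X \<sigma> * edge_spin \<sigma> d * edge_spin \<sigma> e * ?P D \<sigma>)" if "e \<in> D" for e
    using insert.prems that by (intro griffiths[OF assms(1)] ferro_mult assms(4) fP ferro_edge_spin) auto
  have step: "a * ?S (\<lambda>\<sigma>. X \<sigma> * edge_spin \<sigma> e * ?P D \<sigma>) \<le> ?S (\<lambda>\<sigma>. X \<sigma> * edge_spin \<sigma> e * ?P (insert d D) \<sigma>)"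
    if "e \<in> insert d D" for e
  proof -
    have "?S (\<lambda>\<sigma>. X \<sigma> * edge_spin \<sigma> e * ?P (insert d D) \<sigma>) = a * ?S (\<lambda>\<sigma>. X \<sigma> * edge_spin \<sigma> e * ?P D \<sigma>)
       + b * ?S (\<lambda>\<sigma>. X \<sigma> * (edge_spin \<sigma> d * edge_spin \<sigma> e) * ?P D \<sigma>)"
      using insert.hyps by (simp add: sum_distrib_left sum.distrib[symmetric] algebra_simps)
    moreover have "0 \<le> ?S (\<lambda>\<sigma>. X \<sigma> * (edge_spin \<sigma> d * edge_spin \<sigma> e) * ?P D \<sigma>)"
    proof (cases "e = d")
      case True
      have "?S (\<lambda>\<sigma>. X \<sigma> * (edge_spin \<sigma> d * edge_spin \<sigma> e) * ?P D \<sigma>) = ?S (\<lambda>\<sigma>. X \<sigma> * ?P D \<sigma>)"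
        using True insert.prems by (intro sum.cong) (auto simp: edge_spin_square)
      then show ?thesis using pos by simp
    next
      case False
      then show ?thesis using pos2[of e] that by (simp add: mult.assoc)
    qed
    ultimately show ?thesis using assms(6) by simp
  qed
  have "?S (\<lambda>\<sigma>. X \<sigma> * ?P (insert d D) \<sigma>)
      = a * ?S (\<lambda>\<sigma>. X \<sigma> * ?P D \<sigma>) + b / a * (a * ?S (\<lambda>\<sigma>. X \<sigma> * edge_spin \<sigma> d * ?P D \<sigma>))"
    using insert.hyps assms(5) by (simp add: sum_distrib_left sum.distrib[symmetric] algebra_simps)
  also have "\<dots> \<le> a * (\<Sum>e\<in>D. b / a * ?S (\<lambda>\<sigma>. X \<sigma> * edge_spin \<sigma> e * ?P D \<sigma>))
      + b / a * (a * ?S (\<lambda>\<sigma>. X \<sigma> * edge_spin \<sigma> d * ?P D \<sigma>))"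
    using insert.IH insert.prems assms(5) by (intro add_right_mono mult_left_mono) auto
  also have "\<dots> = (\<Sum>e\<in>insert d D. b / a * (a * ?S (\<lambda>\<sigma>. X \<sigma> * edge_spin \<sigma> e * ?P D \<sigma>)))"
    using insert.hyps by (simp add: sum_distrib_left mult_ac)
  also have "\<dots> \<le> (\<Sum>e\<in>insert d D. b / a * ?S (\<lambda>\<sigma>. X \<sigma> * edge_spin \<sigma> e * ?P (insert d D) \<sigma>))"
    using step assms(5,6) by (intro sum_mono mult_left_mono) auto
  finally show ?case .
qed

lemma sum_spins_shift:
  assumes "\<sigma> \<in> spins V"
  shows "(\<Sum>\<tau>\<in>spins V. f \<tau>) = (\<Sum>\<rho>\<in>spins V. f (\<lambda>v\<in>V. \<sigma> v * \<rho> v))"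
proof -
  have 1: "(\<lambda>v\<in>V. \<sigma> v * \<rho> v) \<in> spins V" if "\<rho> \<in> spins V" for \<rho>
    using spins_cases[OF assms] spins_cases[OF that] by (fastforce simp: spins_def)
  have 2: "(\<lambda>v\<in>V. \<sigma> v * (\<lambda>v\<in>V. \<sigma> v * \<rho> v) v) = \<rho>" if "\<rho> \<in> spins V" for \<rho>
  proof
    fix v
    show "(\<lambda>v\<in>V. \<sigma> v * (\<lambda>v\<in>V. \<sigma> v * \<rho> v) v) v = \<rho> v"
      using spins_square[OF assms, of v] that
      by (cases "v \<in> V") (auto simp: mult.assoc[symmetric] spins_def PiE_def extensional_def)
  qed
  show ?thesis
    by (rule sum.reindex_bij_witness[of _ "\<lambda>\<rho>. \<lambda>v\<in>V. \<sigma> v * \<rho> v" "\<lambda>\<rho>. \<lambda>v\<in>V. \<sigma> v * \<rho> v"])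
      (simp_all only: 1 2)
qed

text \<open>
  A finite form of the switching lemma for random currents. Substituting \<open>\<tau> = \<sigma> \<rho>\<close> in the second factor,
  the two weights of a common edge multiply to
  \<open>(a + b \<sigma>) (a + b \<sigma> \<rho>) = (a\<^sup>2 - b\<^sup>2) + (1 + \<rho>) (b\<^sup>2 + a b \<sigma>)\<close>. In the expansion over the set \<open>M\<close> of
  edges that take the second term, the sources of the second factor enter only through the sum over
  \<open>\<rho>\<close>, that is, through connectivity in \<open>M\<close>.
\<close>

lemma ising_product:
  assumes fin: "finite V" and E: "graph_edges E" "\<Union>E \<subseteq> V" and F: "F \<subseteq> E"
    and xw: "x \<in> V" "w \<in> V"
  shows "ising V a b E y z * ising V a b F x w =
    (\<Sum>M\<in>Pow F. (a\<^sup>2 - b\<^sup>2) ^ card (F - M) * (\<Sum>\<rho>\<in>spins V. \<rho> x * \<rho> w * agree M \<rho>) *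
      (\<Sum>\<sigma>\<in>spins V. \<sigma> y * \<sigma> z * (\<sigma> x * \<sigma> w) * (\<Prod>e\<in>E - F. a + b * edge_spin \<sigma> e) *
        (\<Prod>e\<in>M. b\<^sup>2 + a * b * edge_spin \<sigma> e)))"
proof -
  have finE: "finite E" "finite F"
    using graph_edgesD(1)[OF E(1)] finite_subset[OF F] by auto
  let ?r = "\<lambda>\<sigma>. \<Prod>e\<in>E - F. a + b * edge_spin \<sigma> e"
  let ?m = "\<lambda>M \<sigma>. \<Prod>e\<in>M. b\<^sup>2 + a * b * edge_spin \<sigma> e"
  have EF: "(\<Prod>e\<in>E. a + b * edge_spin \<sigma> e) = ?r \<sigma> * (\<Prod>e\<in>F. a + b * edge_spin \<sigma> e)" for \<sigma>
    by (rule prod.subset_diff[OF F finE(1)])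
  have key: "(\<Prod>e\<in>F. a + b * edge_spin \<sigma> e) * (\<Prod>e\<in>F. a + b * edge_spin (\<lambda>v\<in>V. \<sigma> v * \<rho> v) e)
      = (\<Sum>M\<in>Pow F. (a\<^sup>2 - b\<^sup>2) ^ card (F - M) * agree M \<rho> * ?m M \<sigma>)" if \<sigma>: "\<sigma> \<in> spins V" for \<sigma> \<rho>
  proof -
    have "(a + b * edge_spin \<sigma> e) * (a + b * edge_spin (\<lambda>v\<in>V. \<sigma> v * \<rho> v) e)
        = (1 + edge_spin \<rho> e) * (b\<^sup>2 + a * b * edge_spin \<sigma> e) + (a\<^sup>2 - b\<^sup>2)" if "e \<in> F" for e
    proof -
      have eV: "e \<subseteq> V" using that F E(2) by auto
      have "edge_spin (\<lambda>v\<in>V. \<sigma> v * \<rho> v) e = (\<Prod>v\<in>e. \<sigma> v * \<rho> v)"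
        unfolding edge_spin_def using eV by (intro prod.cong) auto
      then have es: "edge_spin (\<lambda>v\<in>V. \<sigma> v * \<rho> v) e = edge_spin \<sigma> e * edge_spin \<rho> e"
        by (simp add: edge_spin_def prod.distrib)
      show ?thesis unfolding es using edge_spin_square[OF \<sigma> eV]
        by (simp add: algebra_simps power2_eq_square)
    qed
    then have "(\<Prod>e\<in>F. a + b * edge_spin \<sigma> e) * (\<Prod>e\<in>F. a + b * edge_spin (\<lambda>v\<in>V. \<sigma> v * \<rho> v) e)
      = (\<Prod>e\<in>F. (1 + edge_spin \<rho> e) * (b\<^sup>2 + a * b * edge_spin \<sigma> e) + (a\<^sup>2 - b\<^sup>2))"
      by (simp add: prod.distrib[symmetric])
    also have "\<dots> = (\<Sum>M\<in>Pow F. (\<Prod>e\<in>M. (1 + edge_spin \<rho> e) * (b\<^sup>2 + a * b * edge_spin \<sigma> e)) * (\<Prod>e\<in>F - M. a\<^sup>2 - b\<^sup>2))"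
      by (rule prod_add[OF finE(2)])
    finally show ?thesis unfolding prod.distrib prod_constant agree_def by (simp only: mult_ac)
  qed
  have "ising V a b E y z * ising V a b F x w =
    (\<Sum>\<sigma>\<in>spins V. \<sigma> y * \<sigma> z * (\<Prod>e\<in>E. a + b * edge_spin \<sigma> e) * ising V a b F x w)"
    by (simp add: ising_def[of V a b E] sum_distrib_right)
  also have "\<dots> = (\<Sum>\<sigma>\<in>spins V. \<Sum>\<rho>\<in>spins V. \<Sum>M\<in>Pow F. (a\<^sup>2 - b\<^sup>2) ^ card (F - M) * (\<rho> x * \<rho> w * agree M \<rho>) *
      (\<sigma> y * \<sigma> z * (\<sigma> x * \<sigma> w) * ?r \<sigma> * ?m M \<sigma>))"
  proof (intro sum.cong refl)
    fix \<sigma> assume \<sigma>: "\<sigma> \<in> spins V"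
    have "ising V a b F x w = (\<Sum>\<rho>\<in>spins V. \<sigma> x * \<rho> x * (\<sigma> w * \<rho> w) *
        (\<Prod>e\<in>F. a + b * edge_spin (\<lambda>v\<in>V. \<sigma> v * \<rho> v) e))"
      unfolding ising_def by (subst sum_spins_shift[OF \<sigma>]) (use xw in simp)
    then have "\<sigma> y * \<sigma> z * (\<Prod>e\<in>E. a + b * edge_spin \<sigma> e) * ising V a b F x w =
      (\<Sum>\<rho>\<in>spins V. \<sigma> y * \<sigma> z * (\<sigma> x * \<sigma> w) * ?r \<sigma> * (\<rho> x * \<rho> w) *
        ((\<Prod>e\<in>F. a + b * edge_spin \<sigma> e) * (\<Prod>e\<in>F. a + b * edge_spin (\<lambda>v\<in>V. \<sigma> v * \<rho> v) e)))"
      by (simp only: EF sum_distrib_left mult_ac)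
    also have "\<dots> = (\<Sum>\<rho>\<in>spins V. \<Sum>M\<in>Pow F. (a\<^sup>2 - b\<^sup>2) ^ card (F - M) * (\<rho> x * \<rho> w * agree M \<rho>) *
      (\<sigma> y * \<sigma> z * (\<sigma> x * \<sigma> w) * ?r \<sigma> * ?m M \<sigma>))"
      unfolding key[OF \<sigma>] sum_distrib_left by (intro sum.cong refl) (simp only: mult_ac)
    finally show "\<sigma> y * \<sigma> z * (\<Prod>e\<in>E. a + b * edge_spin \<sigma> e) * ising V a b F x w = \<dots>" .
  qed
  also have "\<dots> = (\<Sum>M\<in>Pow F. \<Sum>\<sigma>\<in>spins V. \<Sum>\<rho>\<in>spins V. (a\<^sup>2 - b\<^sup>2) ^ card (F - M) * (\<rho> x * \<rho> w * agree M \<rho>) *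
      (\<sigma> y * \<sigma> z * (\<sigma> x * \<sigma> w) * ?r \<sigma> * ?m M \<sigma>))"
    by (subst (2) sum.swap, subst sum.swap) simp
  also have "\<dots> = (\<Sum>M\<in>Pow F. (a\<^sup>2 - b\<^sup>2) ^ card (F - M) * (\<Sum>\<rho>\<in>spins V. \<rho> x * \<rho> w * agree M \<rho>) *
      (\<Sum>\<sigma>\<in>spins V. \<sigma> y * \<sigma> z * (\<sigma> x * \<sigma> w) * ?r \<sigma> * ?m M \<sigma>))"
    by (simp only: sum_distrib_left[symmetric] sum_distrib_right[symmetric])
  finally show ?thesis .
qed

definition out_edges :: "'a set set \<Rightarrow> 'a set \<Rightarrow> ('a \<times> 'a) set" where
  "out_edges E S = {(x, y). {x, y} \<in> E \<and> x \<in> S \<and> y \<notin> S}"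

lemma finite_out_edges: "graph_edges E \<Longrightarrow> finite (out_edges E S)"
  by (rule finite_subset[of _ "\<Union>E \<times> \<Union>E"]) (auto simp: out_edges_def dest: graph_edgesD)

text \<open>
  Let \<open>K\<close> be the cluster of \<open>u\<close> in \<open>M\<close>. It lies in \<open>S\<close>, so it misses \<open>z\<close>, and the only edges of weight
  \<open>a + b \<sigma>\<close> touching it lead out of \<open>S\<close>. Apart from these edges the summand changes sign when the
  spins in \<open>K\<close> are flipped, so \<open>odd_boundary_expansion\<close> extracts one of them.
\<close>

lemma ising_cluster_exit:
  assumes fin: "finite V" and E: "graph_edges E" "\<Union>E \<subseteq> V" and S: "S \<subseteq> V" "u \<in> S"
    and z: "z \<in> V" "z \<notin> S" and ab: "0 < a" "0 \<le> b" and F: "F = {e \<in> E. e \<subseteq> S}" and M: "M \<subseteq> F"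
  defines "r \<equiv> \<lambda>\<sigma>. \<Prod>e\<in>E - F. a + b * edge_spin \<sigma> e"
    and "m \<equiv> \<lambda>\<sigma>. \<Prod>e\<in>M. b\<^sup>2 + a * b * edge_spin \<sigma> e"
  shows "(\<Sum>\<sigma>\<in>spins V. \<sigma> u * \<sigma> z * (\<sigma> u * \<sigma> u) * r \<sigma> * m \<sigma>)
    \<le> (\<Sum>(x, y)\<in>out_edges E S. of_bool (conn M u x) *
        (b / a * (\<Sum>\<sigma>\<in>spins V. \<sigma> y * \<sigma> z * (\<sigma> u * \<sigma> x) * r \<sigma> * m \<sigma>)))"
proof -
  have gM: "graph_edges M" using M F E(1) graph_edges_subset[of E M] by auto
  have finE: "finite (E - F)" using graph_edgesD(1)[OF E(1)] by simp
  have MS: "\<Union>M \<subseteq> S" using M F by auto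
  define K where "K = cluster M u"
  have K: "K \<subseteq> S" "u \<in> K" using cluster_subset[of M u] MS S by (auto simp: K_def)
  define D where "D = {e \<in> E - F. e \<inter> K \<noteq> {}}"
  have D: "D \<subseteq> E - F" by (auto simp: D_def)
  have finD: "finite D" by (rule finite_subset[OF D finE])
  define X where "X \<sigma> = \<sigma> u * \<sigma> z * (\<Prod>e\<in>E - F - D. a + b * edge_spin \<sigma> e) * m \<sigma>" for \<sigma>
  let ?P = "\<lambda>\<sigma>. \<Prod>e\<in>D. a + b * edge_spin \<sigma> e"
  have r: "r \<sigma> = (\<Prod>e\<in>E - F - D. a + b * edge_spin \<sigma> e) * ?P \<sigma>" for \<sigma>
    unfolding r_def by (rule prod.subset_diff[OF D finE])
  have VD: "e \<subseteq> V" if "e \<in> E" for e using that E(2) by blast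
  have MV: "e \<subseteq> V" if "e \<in> M" for e using that M F VD by blast
  have ferroX: "ferro V X"
    unfolding X_def m_def using S z ab VD MV
    by (intro ferro_mult ferro_spin ferro_prod ferro_edge_factor) auto
  have "X (flip K \<sigma>) = - X \<sigma>" for \<sigma>
  proof -
    have "(\<Prod>e\<in>E - F - D. a + b * edge_spin (flip K \<sigma>) e) = (\<Prod>e\<in>E - F - D. a + b * edge_spin \<sigma> e)"
      using E(1) by (intro prod.cong refl) (auto simp: D_def edge_spin_flip graph_edges_def)
    moreover have "m (flip K \<sigma>) = m \<sigma>"
      unfolding m_def K_def using gM edge_in_cluster[OF gM]
      by (intro prod.cong) (auto simp: edge_spin_flip graph_edges_def)
    moreover have "flip K \<sigma> u = - \<sigma> u" "flip K \<sigma> z = \<sigma> z" using K z by (auto simp: flip_def)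
    ultimately show ?thesis by (simp add: X_def)
  qed
  then have zero: "(\<Sum>\<sigma>\<in>spins V. X \<sigma>) = 0" using K S by (intro sum_odd_under_flip[of K]) auto
  define H where "H x y = b / a * (\<Sum>\<sigma>\<in>spins V. \<sigma> y * \<sigma> z * (\<sigma> u * \<sigma> x) * r \<sigma> * m \<sigma>)" for x y
  let ?B = "{(x, y) \<in> out_edges E S. x \<in> K}"
  have D_img: "D = (\<lambda>(x, y). {x, y}) ` ?B"
  proof (intro set_eqI iffI)
    fix e assume "e \<in> D"
    then have e: "e \<in> E" "\<not> e \<subseteq> S" "e \<inter> K \<noteq> {}" by (auto simp: D_def F)
    obtain x y where xy: "e = {x, y}" using graph_edges_obtain[OF E(1) e(1)] .
    then have "(x, y) \<in> ?B \<or> (y, x) \<in> ?B"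
      using e K by (auto simp: out_edges_def insert_commute)
    then show "e \<in> (\<lambda>(x, y). {x, y}) ` ?B"
    proof
      assume "(x, y) \<in> ?B"
      then show ?thesis by (rule rev_image_eqI) (simp add: xy)
    next
      assume "(y, x) \<in> ?B"
      then show ?thesis by (rule rev_image_eqI) (simp add: xy insert_commute)
    qed
  qed (auto simp: D_def F out_edges_def)
  have inj: "inj_on (\<lambda>(x, y). {x, y}) ?B"
  proof (rule inj_onI)
    fix e e' assume "e \<in> ?B" "e' \<in> ?B" "(case e of (x, y) \<Rightarrow> {x, y}) = (case e' of (x, y) \<Rightarrow> {x, y})"
    then show "e = e'"
      by (cases e; cases e') (auto simp: out_edges_def doubleton_eq_iff)
  qed
  have "(\<Sum>\<sigma>\<in>spins V. \<sigma> u * \<sigma> z * (\<sigma> u * \<sigma> u) * r \<sigma> * m \<sigma>) = (\<Sum>\<sigma>\<in>spins V. X \<sigma> * ?P \<sigma>)"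
  proof (intro sum.cong refl)
    fix \<sigma> assume "\<sigma> \<in> spins V"
    then have "\<sigma> u * \<sigma> u = 1" using spins_square[of \<sigma> V u] S by auto
    then show "\<sigma> u * \<sigma> z * (\<sigma> u * \<sigma> u) * r \<sigma> * m \<sigma> = X \<sigma> * ?P \<sigma>"
      unfolding r X_def by (simp only: mult_1_right mult_ac)
  qed
  also have "\<dots> \<le> (\<Sum>d\<in>D. b / a * (\<Sum>\<sigma>\<in>spins V. X \<sigma> * edge_spin \<sigma> d * ?P \<sigma>))"
    by (rule odd_boundary_expansion[OF fin finD _ ferroX ab zero]) (use D VD in auto)
  also have "\<dots> = (\<Sum>(x, y)\<in>?B. H x y)"
    unfolding D_img sum.reindex[OF inj]
  proof (intro sum.cong refl)
    fix xy assume "xy \<in> ?B"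
    then obtain x y where xy: "xy = (x, y)" "x \<noteq> y" by (auto simp: out_edges_def)
    have "X \<sigma> * edge_spin \<sigma> {x, y} * ?P \<sigma> = \<sigma> y * \<sigma> z * (\<sigma> u * \<sigma> x) * r \<sigma> * m \<sigma>" for \<sigma>
      unfolding r X_def edge_spin_pair[OF xy(2)] by (simp only: mult_ac)
    then show "((\<lambda>d. b / a * (\<Sum>\<sigma>\<in>spins V. X \<sigma> * edge_spin \<sigma> d * (\<Prod>e\<in>(\<lambda>(x, y). {x, y}) ` ?B. a + b * edge_spin \<sigma> e))) \<circ>
        (\<lambda>(x, y). {x, y})) xy = (case xy of (x, y) \<Rightarrow> H x y)"
      unfolding D_img[symmetric] by (simp add: xy H_def)
  qed
  also have "\<dots> = (\<Sum>(x, y)\<in>out_edges E S. of_bool (conn M u x) * H x y)"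
    using finite_out_edges[OF E(1), of S]
    by (intro sum.mono_neutral_cong_left) (auto simp: K_def cluster_def)
  finally show ?thesis by (simp add: H_def)
qed

text \<open>
  Lieb's improvement of Simon's inequality, in which the first correlation is that of the region \<open>S\<close>
  alone. By \<open>ising_cluster_exit\<close>, in each term of \<open>ising_product\<close> the cluster of the source \<open>u\<close> is left
  through an edge \<open>(x, y)\<close> whose inner end \<open>x\<close> is connected to \<open>u\<close> in \<open>M\<close>; inserting the sources \<open>u\<close> and \<open>x\<close>
  into the sum over \<open>\<rho>\<close> is then free.
\<close>

lemma simon_lieb_ising:
  assumes fin: "finite V" and E: "graph_edges E" "\<Union>E \<subseteq> V" and S: "S \<subseteq> V" "u \<in> S"
    and z: "z \<in> V" "z \<notin> S" and ab: "0 < a" "0 \<le> b" "b \<le> a"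
  defines "F \<equiv> {e \<in> E. e \<subseteq> S}"
  shows "ising V a b E u z * ising V a b F u u
    \<le> (\<Sum>(x, y)\<in>out_edges E S. b / a * (ising V a b E y z * ising V a b F u x))"
proof -
  have FE: "F \<subseteq> E" by (auto simp: F_def)
  have oV: "u \<in> V" using S by auto
  define w where "w M = (a\<^sup>2 - b\<^sup>2) ^ card (F - M)" for M
  define R where "R M x = (\<Sum>\<rho>\<in>spins V. \<rho> u * \<rho> x * agree M \<rho>)" for M x
  define G where "G M y x = (\<Sum>\<sigma>\<in>spins V. \<sigma> y * \<sigma> z * (\<sigma> u * \<sigma> x) * (\<Prod>e\<in>E - F. a + b * edge_spin \<sigma> e) *
        (\<Prod>e\<in>M. b\<^sup>2 + a * b * edge_spin \<sigma> e))" for M x y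
  have w: "0 \<le> w M" for M
    using ab by (auto simp: w_def intro!: zero_le_power power_mono)
  have MF: "graph_edges M" "\<Union>M \<subseteq> V" if "M \<subseteq> F" for M
    using that FE E graph_edges_subset[of E M] by auto
  have R: "R M x = (if conn M u x then R M u else 0)" if "M \<subseteq> F" "x \<in> V" for M x
    using sum_spins_agree[OF fin MF[OF that(1)] oV that(2)] sum_spins_agree[OF fin MF[OF that(1)] oV oV]
    by (simp add: R_def)
  have R0: "0 \<le> R M u" if "M \<subseteq> F" for M
    using sum_spins_agree[OF fin MF[OF that] oV oV] sum_agree[OF fin MF[OF that]] by (simp add: R_def)
  have "ising V a b E u z * ising V a b F u u = (\<Sum>M\<in>Pow F. w M * R M u * G M u u)"
    unfolding ising_product[OF fin E FE oV oV] by (simp add: w_def R_def G_def)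
  also have "\<dots> \<le> (\<Sum>M\<in>Pow F. w M * R M u *
      (\<Sum>(x, y)\<in>out_edges E S. of_bool (conn M u x) * (b / a * G M y x)))"
  proof (intro sum_mono mult_left_mono)
    fix M assume "M \<in> Pow F"
    then have M: "M \<subseteq> F" by simp
    show "G M u u \<le> (\<Sum>(x, y)\<in>out_edges E S. of_bool (conn M u x) * (b / a * G M y x))"
      unfolding G_def using ising_cluster_exit[OF fin E S z ab(1,2) F_def[THEN meta_eq_to_obj_eq] M] by simp
    show "0 \<le> w M * R M u" using w R0[OF M] by simp
  qed
  also have "\<dots> = (\<Sum>M\<in>Pow F. \<Sum>(x, y)\<in>out_edges E S. b / a * (w M * R M x * G M y x))"
    unfolding sum_distrib_left
  proof (intro sum.cong refl)
    fix M xy assume M: "M \<in> Pow F" and xy: "xy \<in> out_edges E S"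
    have "R M (fst xy) = of_bool (conn M u (fst xy)) * R M u"
      using R[of M "fst xy"] M xy S by (auto simp: out_edges_def)
    then show "w M * R M u * (case xy of (x, y) \<Rightarrow> of_bool (conn M u x) * (b / a * G M y x))
      = (case xy of (x, y) \<Rightarrow> b / a * (w M * R M x * G M y x))"
      by (simp add: case_prod_beta)
  qed
  also have "\<dots> = (\<Sum>(x, y)\<in>out_edges E S. b / a * (\<Sum>M\<in>Pow F. w M * R M x * G M y x))"
    by (subst sum.swap) (simp add: sum_distrib_left case_prod_beta)
  also have "\<dots> = (\<Sum>(x, y)\<in>out_edges E S. b / a * (ising V a b E y z * ising V a b F u x))"
  proof (intro sum.cong refl)
    fix xy assume "xy \<in> out_edges E S"
    then obtain x y where xy: "xy = (x, y)" "x \<in> V" using S by (auto simp: out_edges_def)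
    show "(case xy of (x, y) \<Rightarrow> b / a * (\<Sum>M\<in>Pow F. w M * R M x * G M y x)) =
      (case xy of (x, y) \<Rightarrow> b / a * (ising V a b E y z * ising V a b F u x))"
      unfolding xy(1) prod.case ising_product[OF fin E FE oV xy(2)] by (simp add: w_def R_def G_def)
  qed
  finally show ?thesis .
qed

abbreviation conn_mean :: "real \<Rightarrow> 'a set set \<Rightarrow> 'a \<Rightarrow> 'a \<Rightarrow> real" where
  "conn_mean p E x y \<equiv> rc_mean p (1/2) {} E (\<lambda>X. of_bool (conn X x y))"

text \<open>
  Transported through \<open>edwards_sokal\<close>. The natural constant is \<open>p / (2 - p)\<close>, which is at most \<open>p\<close>.
\<close>

theorem simon_lieb:
  assumes E: "graph_edges E" and p: "0 \<le> p" "p \<le> 1" and S: "finite S" "u \<in> S" and z: "z \<notin> S"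
  shows "conn_mean p E u z \<le>
    (\<Sum>(x, y)\<in>out_edges E S. p * conn_mean p {e \<in> E. e \<subseteq> S} u x * conn_mean p E y z)"
proof -
  interpret rc_params p "1/2" using p by unfold_locales auto
  define V where "V = insert z (\<Union>E \<union> S)"
  have V: "finite V" "\<Union>E \<subseteq> V" "S \<subseteq> V" "z \<in> V" "u \<in> V"
    using graph_edgesD[OF E] S by (auto simp: V_def)
  define F where "F = {e \<in> E. e \<subseteq> S}"
  have F: "graph_edges F" "\<Union>F \<subseteq> V" using E graph_edges_subset[of E F] V(2) by (auto simp: F_def)
  let ?a = "1 - p/2" and ?b = "p/2"
  define ZE where "ZE = wsum p (1/2) {} E (\<lambda>_. 1)"
  define ZF where "ZF = wsum p (1/2) {} F (\<lambda>_. 1)"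
  have Z: "0 < ZE" "0 < ZF"
    unfolding ZE_def ZF_def using E F graph_edgesD(1) wsum_1_pos by blast+
  have iE: "ising V ?a ?b E x y = 2 ^ card V * ZE * conn_mean p E x y" if "x \<in> V" "y \<in> V" for x y
    using edwards_sokal[OF V(1) E V(2) that, of p] Z by (simp add: rc_mean_def ZE_def)
  have iF: "ising V ?a ?b F x y = 2 ^ card V * ZF * conn_mean p F x y" if "x \<in> V" "y \<in> V" for x y
    using edwards_sokal[OF V(1) F that, of p] Z by (simp add: rc_mean_def ZF_def)
  define C where "C = 2 ^ card V * ZE * (2 ^ card V * ZF)"
  have C: "0 < C" using Z by (simp add: C_def)
  have nonneg: "0 \<le> conn_mean p G x y" if "graph_edges G" for G x y
    using rc_mean_mono[of G "\<lambda>_. 0" "{}" "\<lambda>X. of_bool (conn X x y)"] graph_edgesD(1)[OF that]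
    by simp
  have FF: "conn_mean p F u u = 1" using graph_edgesD(1)[OF F(1)] by simp
  have t: "?b / ?a \<le> p"
  proof -
    have "p * p \<le> p * 1" using p by (intro mult_left_mono)
    then have "?b \<le> p * ?a" by (simp add: field_simps)
    then show ?thesis using p by (subst pos_divide_le_eq) linarith+
  qed
  have "C * conn_mean p E u z = ising V ?a ?b E u z * ising V ?a ?b F u u"
    using V FF by (simp add: iE iF C_def)
  also have "\<dots> \<le> (\<Sum>(x, y)\<in>out_edges E S. ?b / ?a * (ising V ?a ?b E y z * ising V ?a ?b F u x))"
    unfolding F_def using p by (intro simon_lieb_ising V E S z) auto
  also have "\<dots> = (\<Sum>(x, y)\<in>out_edges E S. ?b / ?a * (C * (conn_mean p E y z * conn_mean p F u x)))"
  proof (intro sum.cong refl)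
    fix xy assume "xy \<in> out_edges E S"
    then obtain x y where xy: "xy = (x, y)" "x \<in> V" "y \<in> V" using V by (auto simp: out_edges_def)
    show "(case xy of (x, y) \<Rightarrow> ?b / ?a * (ising V ?a ?b E y z * ising V ?a ?b F u x)) =
      (case xy of (x, y) \<Rightarrow> ?b / ?a * (C * (conn_mean p E y z * conn_mean p F u x)))"
      unfolding xy(1) prod.case iE[OF xy(3) V(4)] iF[OF V(5) xy(2)] C_def by (simp only: mult_ac)
  qed
  also have "\<dots> \<le> (\<Sum>(x, y)\<in>out_edges E S. p * (C * (conn_mean p E y z * conn_mean p F u x)))"
  proof (intro sum_mono, unfold case_prod_beta, intro mult_right_mono t)
    fix xy show "0 \<le> C * (conn_mean p E (snd xy) z * conn_mean p F u (fst xy))"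
      using C nonneg[OF E, of "snd xy" z] nonneg[OF F(1), of u "fst xy"] by simp
  qed
  also have "\<dots> = C * (\<Sum>(x, y)\<in>out_edges E S. p * conn_mean p F u x * conn_mean p E y z)"
    unfolding sum_distrib_left by (intro sum.cong refl) (auto simp: mult_ac)
  finally show ?thesis using C by (simp add: F_def)
qed

text \<open>
  Sum \<open>simon_lieb\<close> over \<open>z\<close>, starting from the vertex with the largest expected cluster size \<open>m\<close>: this
  gives \<open>m \<le> n + \<phi> * m\<close>.
\<close>

theorem susceptibility_bound:
  assumes E: "graph_edges E" "\<Union>E \<subseteq> V" "finite V" and p: "0 \<le> p" "p \<le> 1"
    and S: "\<And>u. u \<in> V \<Longrightarrow> u \<in> S u \<and> S u \<subseteq> V \<and> card (S u) \<le> n"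
    and small: "\<And>u. u \<in> V \<Longrightarrow> (\<Sum>(x, y)\<in>out_edges E (S u). p * conn_mean p {e \<in> E. e \<subseteq> S u} u x) \<le> \<phi>"
    and \<phi>: "\<phi> < 1" and u: "u \<in> V"
  shows "(\<Sum>z\<in>V. conn_mean p E u z) \<le> real n / (1 - \<phi>)"
proof -
  interpret rc_params p "1/2" using p by unfold_locales auto
  have finE: "finite E" using graph_edgesD(1)[OF E(1)] .
  have nonneg: "0 \<le> conn_mean p G x y" if "G \<subseteq> E" for G x y
    using rc_mean_mono[of G "\<lambda>_. 0" "{}" "\<lambda>X. of_bool (conn X x y)"] finite_subset[OF that finE]
    by simp
  have le1: "conn_mean p E x y \<le> 1" for x y
    using rc_mean_mono[of E "\<lambda>X. of_bool (conn X x y)" "{}" "\<lambda>_. 1"] finE by simp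
  define susc where "susc u = (\<Sum>z\<in>V. conn_mean p E u z)" for u
  define m where "m = Max (susc ` V)"
  have m_ge: "susc v \<le> m" if "v \<in> V" for v using that E(3) by (simp add: m_def)
  have "m \<in> susc ` V" unfolding m_def using E(3) u by (intro Max_in) auto
  then obtain v where v: "v \<in> V" "susc v = m" by blast
  have "0 \<le> m" using nonneg[of E] v by (auto simp: susc_def intro!: sum_nonneg)
  define step where "step x = p * conn_mean p {e \<in> E. e \<subseteq> S v} v x" for x
  have c: "0 \<le> step x" for x using nonneg[of "{e \<in> E. e \<subseteq> S v}"] p by (auto simp: step_def)
  have Sv: "v \<in> S v" "S v \<subseteq> V" "card (S v) \<le> n" "finite (S v)"
    using S[OF v(1)] E(3) finite_subset by auto
  have "susc v = (\<Sum>z\<in>S v. conn_mean p E v z) + (\<Sum>z\<in>V - S v. conn_mean p E v z)"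
    unfolding susc_def using sum.subset_diff[OF Sv(2) E(3)] by (simp add: add.commute)
  also have "\<dots> \<le> real n + (\<Sum>z\<in>V - S v. \<Sum>(x, y)\<in>out_edges E (S v). step x * conn_mean p E y z)"
  proof (intro add_mono sum_mono)
    have "(\<Sum>z\<in>S v. conn_mean p E v z) \<le> (\<Sum>z\<in>S v. 1)" by (intro sum_mono le1)
    then show "(\<Sum>z\<in>S v. conn_mean p E v z) \<le> real n" using Sv(3) by simp
    fix z assume "z \<in> V - S v"
    then show "conn_mean p E v z \<le> (\<Sum>(x, y)\<in>out_edges E (S v). step x * conn_mean p E y z)"
      using simon_lieb[OF E(1) p Sv(4,1), of z] by (simp add: step_def)
  qed
  also have "(\<Sum>z\<in>V - S v. \<Sum>(x, y)\<in>out_edges E (S v). step x * conn_mean p E y z)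
      = (\<Sum>(x, y)\<in>out_edges E (S v). step x * (\<Sum>z\<in>V - S v. conn_mean p E y z))"
    by (subst sum.swap) (simp add: sum_distrib_left case_prod_beta)
  also have "\<dots> \<le> (\<Sum>(x, y)\<in>out_edges E (S v). step x * m)"
  proof (intro sum_mono)
    fix xy assume "xy \<in> out_edges E (S v)"
    then obtain x y where xy: "xy = (x, y)" "y \<in> V" using E(2) by (auto simp: out_edges_def)
    have "(\<Sum>z\<in>V - S v. conn_mean p E y z) \<le> susc y"
      unfolding susc_def using E(3) nonneg[of E] by (intro sum_mono2) auto
    then show "(case xy of (x, y) \<Rightarrow> step x * (\<Sum>z\<in>V - S v. conn_mean p E y z)) \<le> (case xy of (x, y) \<Rightarrow> step x * m)"
      using m_ge[OF xy(2)] c[of x] by (simp add: xy(1) mult_left_mono del: mult_le_cancel_left)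
  qed
  also have "\<dots> = (\<Sum>(x, y)\<in>out_edges E (S v). step x) * m"
    by (simp add: sum_distrib_right case_prod_beta)
  also have "\<dots> \<le> \<phi> * m" using small[OF v(1)] \<open>0 \<le> m\<close> unfolding step_def by (rule mult_right_mono)
  finally have "m \<le> real n + \<phi> * m" using v by simp
  then have "m \<le> real n / (1 - \<phi>)" using \<phi> by (simp add: field_simps)
  then show ?thesis using m_ge[OF u] by (simp add: susc_def)
qed

section \<open>The lattice measures in finite volume\<close>

lemma lattice_edge_obtain:
  assumes "e \<in> lattice_edges"
  obtains x y where "e = {x, y}" "x \<noteq> y"
proof -
  obtain x y :: "int ^ 'a" where e: "e = {x, y}" "(\<Sum>i\<in>UNIV. \<bar>x $ i - y $ i\<bar>) = 1"
    using assms by (auto simp: lattice_edges_def)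
  then have "x \<noteq> y" by auto
  with e that show thesis by blast
qed

lemma card_lattice_edge: "e \<in> lattice_edges \<Longrightarrow> card e = 2"
  by (metis card_2_iff lattice_edge_obtain)

lemma graph_edges_lattice: "finite J \<Longrightarrow> J \<subseteq> lattice_edges \<Longrightarrow> graph_edges J"
  by (auto simp: graph_edges_def card_lattice_edge)

lemma edges_in_subset: "edges_in S \<subseteq> lattice_edges" "\<Union>(edges_in S) \<subseteq> S"
  by (auto simp: edges_in_def)

lemma edges_in_mono: "S \<subseteq> T \<Longrightarrow> edges_in S \<subseteq> edges_in T"
  by (auto simp: edges_in_def)

lemma finite_edges_in: "finite S \<Longrightarrow> finite (edges_in S)"
  by (rule finite_subset[of _ "Pow S"]) (auto simp: edges_in_def)

lemma graph_edges_in: "finite S \<Longrightarrow> graph_edges (edges_in S)"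
  by (intro graph_edges_lattice finite_edges_in edges_in_subset)

lemma joined_conn: "joined E \<omega> x y \<longleftrightarrow> conn (open_edges E \<omega>) x y"
  by (simp add: joined_def conn_def adj_def)

definition configuration :: "'d edge set \<Rightarrow> 'd edge set \<Rightarrow> 'd config" where
  "configuration E A = (\<lambda>e\<in>E. e \<in> A)"

lemma open_edges_configuration [simp]: "open_edges E (configuration E A) = A \<inter> E"
  by (auto simp: open_edges_def configuration_def)

lemma configuration_open_edges: "\<omega> \<in> E \<rightarrow>\<^sub>E UNIV \<Longrightarrow> configuration E (open_edges E \<omega>) = \<omega>"
  by (auto simp: open_edges_def configuration_def PiE_def extensional_def fun_eq_iff)

lemma rc_weight_wt:
  assumes "finite V" "\<Union>E \<subseteq> V" "0 < q"
  shows "rc_weight V E p q \<omega> = q ^ card V * wt p (1/q) {} E (open_edges E \<omega>)"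
proof -
  let ?A = "open_edges E \<omega>"
  have "\<Union>?A \<subseteq> V" using assms(2) by (auto simp: open_edges_def)
  from ncomp_plus_rank[OF assms(1) this]
  have "q ^ card V = q ^ ncomp V ?A * q ^ edge_rank ?A" by (metis power_add)
  then have "q ^ ncomp V ?A = q ^ card V * (1/q) ^ edge_rank ?A"
    using assms(3) by (simp add: power_one_over field_simps)
  moreover have "card (components V E \<omega>) = ncomp V ?A"
    by (simp add: components_def ncomp_def joined_conn)
  moreover have "closed_edges E \<omega> = E - ?A" by (auto simp: closed_edges_def open_edges_def)
  ultimately show ?thesis by (simp add: rc_weight_def wt_def)
qed

lemma sum_configurations:
  "(\<Sum>\<omega>\<in>E \<rightarrow>\<^sub>E UNIV. f \<omega>) = (\<Sum>A\<in>Pow E. f (configuration E A))"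
  by (rule sum.reindex_bij_witness[of _ "configuration E" "open_edges E"])
    (auto simp: configuration_open_edges Int_absorb2, auto simp: open_edges_def configuration_def)

lemma integral_rc_measure:
  assumes "finite V" "graph_edges E" "\<Union>E \<subseteq> V" "0 \<le> p" "p \<le> 1" "1 \<le> q"
  shows "(\<integral>\<omega>. f \<omega> \<partial>rc_measure V E p q) = rc_mean p (1/q) {} E (\<lambda>A. f (configuration E A))"
proof -
  interpret rc_params p "1/q" using assms by unfold_locales auto
  have finE: "finite E" using graph_edgesD(1)[OF assms(2)] .
  have wt: "rc_weight V E p q (configuration E A) = q ^ card V * wt p (1/q) {} E A" if "A \<subseteq> E" for A
    using rc_weight_wt[OF assms(1,3), of q p "configuration E A"] assms(6) that
    by (simp add: Int_absorb2)
  have Z: "rc_partition V E p q = q ^ card V * wsum p (1/q) {} E (\<lambda>_. 1)"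
    unfolding rc_partition_def sum_configurations wsum_def sum_distrib_left
    by (intro sum.cong) (auto simp: wt)
  have Zpos: "0 < wsum p (1/q) {} E (\<lambda>_. 1)" using wsum_1_pos[OF finE] .
  have fin: "finite (E \<rightarrow>\<^sub>E (UNIV :: bool set))" using finE by (intro finite_PiE) auto
  have nonneg: "0 \<le> rc_weight V E p q \<omega> / rc_partition V E p q" for \<omega>
    using Zpos assms(4-6) unfolding Z rc_weight_def by auto
  have "(\<integral>\<omega>. f \<omega> \<partial>rc_measure V E p q)
      = (\<Sum>\<omega>\<in>E \<rightarrow>\<^sub>E UNIV. rc_weight V E p q \<omega> / rc_partition V E p q * f \<omega>)"
    unfolding rc_measure_def using fin nonneg
    by (subst lebesgue_integral_point_measure_finite) auto
  also have "\<dots> = (\<Sum>A\<in>Pow E. f (configuration E A) * wt p (1/q) {} E A / wsum p (1/q) {} E (\<lambda>_. 1))"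
    unfolding sum_configurations Z using assms(6) by (intro sum.cong) (auto simp: wt)
  finally show ?thesis by (simp add: rc_mean_def wsum_def sum_divide_distrib)
qed

lemma measure_rc_vol:
  assumes "finite S" "0 \<le> p" "p \<le> 1" "1 \<le> q"
  shows "measure (rc_vol S p q) {\<omega> \<in> space (rc_vol S p q). joined (edges_in S) \<omega> x y}
    = rc_mean p (1/q) {} (edges_in S) (\<lambda>A. of_bool (conn A x y))"
proof -
  let ?M = "rc_vol S p q" and ?B = "{\<omega> \<in> space (rc_vol S p q). joined (edges_in S) \<omega> x y}"
  have "?B \<inter> space ?M = ?B" by auto
  then have "measure ?M ?B = (\<integral>\<omega>. indicator ?B \<omega> \<partial>?M)" by (simp only: Bochner_Integration.integral_indicator)
  also have "\<dots> = rc_mean p (1/q) {} (edges_in S) (\<lambda>A. indicator ?B (configuration (edges_in S) A))"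
    by (intro integral_rc_measure assms graph_edges_in edges_in_subset)
  also have "\<dots> = rc_mean p (1/q) {} (edges_in S) (\<lambda>A. of_bool (conn A x y))"
  proof (rule rc_mean_cong)
    fix A assume "A \<subseteq> edges_in S"
    then show "indicator ?B (configuration (edges_in S) ({} \<union> A)) = (of_bool (conn ({} \<union> A) x y) :: real)"
      by (simp add: indicator_def joined_conn Int_absorb2 rc_measure_def space_point_measure)
        (simp add: configuration_def)
  qed
  finally show ?thesis .
qed

section \<open>The infinite-volume limit\<close>

text \<open>
  Observables in infinite volume are functions of the set of open edges; a local one depends on the
  edges in \<open>J\<close> only.
\<close>

definition local_on :: "'b set \<Rightarrow> ('b set \<Rightarrow> real) \<Rightarrow> bool" where
  "local_on J f \<longleftrightarrow> (\<forall>X. f X = f (X \<inter> J))"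

abbreviation volumes :: "('d::finite) itself \<Rightarrow> (int ^ 'd) set filter" where
  "volumes _ \<equiv> finite_subsets_at_top UNIV"

context rc_params
begin

definition box_mean :: "(('d::finite) edge set \<Rightarrow> real) \<Rightarrow> (int ^ 'd) set \<Rightarrow> real" where
  "box_mean f S = rc_mean p c {} (edges_in S) f"

definition limit_mean :: "(('d::finite) edge set \<Rightarrow> real) \<Rightarrow> real" where
  "limit_mean f = Lim (finite_subsets_at_top UNIV) (box_mean f)"

lemma box_mean_mono_volume:
  assumes "finite T" "S \<subseteq> T" "\<And>A B. A \<subseteq> B \<Longrightarrow> f A \<le> f B"
  shows "box_mean f S \<le> box_mean f T"
  unfolding box_mean_def
  by (rule rc_mean_comparison)
    (use assms in \<open>auto intro!: rc_params_axioms edges_in_mono graph_edges_in simp: graph_edges_lattice\<close>)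

lemma box_mean_mono:
  assumes "finite S" "\<And>A. A \<subseteq> lattice_edges \<Longrightarrow> f A \<le> g A"
  shows "box_mean f S \<le> box_mean g S"
  unfolding box_mean_def using assms edges_in_subset(1)[of S]
  by (intro rc_mean_mono) (auto simp: finite_edges_in)

lemma box_mean_const: "finite S \<Longrightarrow> box_mean (\<lambda>_. a) S = a"
  by (simp add: box_mean_def finite_edges_in)

lemma local_bound:
  assumes "local_on J f" "finite J"
  obtains C where "\<And>X. \<bar>f X\<bar> \<le> C"
proof -
  have "finite ((\<lambda>X. \<bar>f X\<bar>) ` Pow J)" using assms(2) by simp
  then have "\<bar>f (X \<inter> J)\<bar> \<le> Max ((\<lambda>X. \<bar>f X\<bar>) ` Pow J)" for X by (intro Max_ge) auto
  then show thesis using that assms(1) by (metis local_on_def)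
qed

lemma increasing_limit:
  assumes mono: "\<And>A B. A \<subseteq> B \<Longrightarrow> f A \<le> f B" and C: "\<And>X. \<bar>f X\<bar> \<le> C"
  obtains L where "(box_mean f \<longlongrightarrow> L) (volumes TYPE('d::finite))"
    and "\<And>S :: (int ^ 'd) set. finite S \<Longrightarrow> box_mean f S \<le> L"
proof -
  let ?F = "{S :: (int ^ 'd) set. finite S}"
  define L where "L = (SUP S\<in>?F. box_mean f S)"
  have "box_mean f S \<le> C" if "finite S" for S :: "(int ^ 'd) set"
  proof -
    have "box_mean f S \<le> box_mean (\<lambda>_. C) S"
      using C by (intro box_mean_mono that) (meson abs_le_D1)
    then show ?thesis by (simp add: box_mean_const that)
  qed
  then have bdd: "bdd_above (box_mean f ` ?F)" by (auto intro!: bdd_aboveI[of _ C])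
  have up: "box_mean f S \<le> L" if "finite S" for S :: "(int ^ 'd) set"
    unfolding L_def using that by (intro cSUP_upper bdd) simp
  have "(box_mean f \<longlongrightarrow> L) (volumes TYPE('d))"
  proof (rule order_tendstoI)
    fix a assume "a < L"
    then obtain S0 :: "(int ^ 'd) set" where S0: "finite S0" "a < box_mean f S0"
      unfolding L_def by (subst (asm) less_cSUP_iff[OF _ bdd]) auto
    show "eventually (\<lambda>S. a < box_mean f S) (volumes TYPE('d))"
      unfolding eventually_finite_subsets_at_top
    proof (intro exI conjI allI impI)
      fix T :: "(int ^ 'd) set" assume "finite T \<and> S0 \<subseteq> T \<and> T \<subseteq> UNIV"
      then have "box_mean f S0 \<le> box_mean f T" using mono by (intro box_mean_mono_volume) auto
      then show "a < box_mean f T" using S0(2) by simp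
    qed (use S0 in auto)
  next
    fix a assume "L < a"
    then show "eventually (\<lambda>S. box_mean f S < a) (volumes TYPE('d))"
      by (intro eventually_finite_subsets_at_top_weakI le_less_trans[OF up])
  qed
  from that[OF this up] show thesis .
qed

lemma limit_mean_eq: "(box_mean f \<longlongrightarrow> L) (volumes TYPE('d::finite)) \<Longrightarrow> limit_mean f = L"
  unfolding limit_mean_def by (intro tendsto_Lim) auto

lemma increasing_tendsto:
  assumes "\<And>A B. A \<subseteq> B \<Longrightarrow> f A \<le> f B" "\<And>X. \<bar>f X\<bar> \<le> C"
  shows "(box_mean f \<longlongrightarrow> limit_mean f) (volumes TYPE('d::finite))"
    and "\<And>S :: (int ^ 'd) set. finite S \<Longrightarrow> box_mean f S \<le> limit_mean f"
proof -
  obtain L where L: "(box_mean f \<longlongrightarrow> L) (volumes TYPE('d))" "\<And>S :: (int ^ 'd) set. finite S \<Longrightarrow> box_mean f S \<le> L"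
    using increasing_limit[of f C, OF assms] by metis
  then show "(box_mean f \<longlongrightarrow> limit_mean f) (volumes TYPE('d))"
    "\<And>S :: (int ^ 'd) set. finite S \<Longrightarrow> box_mean f S \<le> limit_mean f"
    using limit_mean_eq[OF L(1)] by auto
qed

text \<open>
  Free measures increase with the volume, so increasing observables converge. A local observable
  becomes increasing after adding a large multiple of the number of open edges in \<open>J\<close>, which is itself
  increasing.
\<close>

lemma local_tendsto:
  assumes loc: "local_on J f" and J: "finite J"
  shows "(box_mean f \<longlongrightarrow> limit_mean f) (volumes TYPE('d::finite))"
proof -
  obtain C where C: "\<And>X. \<bar>f X\<bar> \<le> C" using local_bound[OF assms] by metis
  have C0: "0 \<le> C" using C[of "{}"] by simp
  define n where "n X = 2 * C * real (card (X \<inter> J))" for X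
  have n_le: "\<bar>n X\<bar> \<le> 2 * C * real (card J)" for X
    using C0 J by (auto simp: n_def abs_mult intro!: mult_left_mono card_mono)
  have n_mono: "n A \<le> n B" if "A \<subseteq> B" for A B
    unfolding n_def using that C0 J by (intro mult_left_mono of_nat_mono card_mono) auto
  have "f A + n A \<le> f B + n B" if "A \<subseteq> B" for A B
  proof (cases "A \<inter> J = B \<inter> J")
    case True
    then show ?thesis using loc by (metis local_on_def n_def order_refl)
  next
    case False
    then have "card (A \<inter> J) < card (B \<inter> J)" using that J by (intro psubset_card_mono) auto
    then have "2 * C * (real (card (A \<inter> J)) + 1) \<le> n B"
      unfolding n_def using C0 by (intro mult_left_mono) auto
    then have "n A + 2 * C \<le> n B" by (simp add: n_def algebra_simps)
    then show ?thesis using C[of A] C[of B] by (auto simp: abs_le_iff)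
  qed
  moreover have "\<bar>f X + n X\<bar> \<le> C + 2 * C * real (card J)" for X
    using C[of X] n_le[of X] by linarith
  ultimately have 1: "(box_mean (\<lambda>X. f X + n X) \<longlongrightarrow> limit_mean (\<lambda>X. f X + n X)) (volumes TYPE('d))"
    by (intro increasing_tendsto(1)) auto
  have 2: "(box_mean n \<longlongrightarrow> limit_mean n) (volumes TYPE('d))"
    using n_mono n_le by (intro increasing_tendsto(1)) auto
  have "box_mean (\<lambda>X. f X + n X) S - box_mean n S = box_mean f S" for S :: "(int ^ 'd) set"
    by (simp add: box_mean_def rc_mean_add)
  then have "(box_mean f \<longlongrightarrow> limit_mean (\<lambda>X. f X + n X) - limit_mean n) (volumes TYPE('d))"
    using tendsto_diff[OF 1 2] by simp
  then show ?thesis using limit_mean_eq by metis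
qed

end

lemma cylinder_measurable:
  assumes "finite J" "J \<subseteq> lattice_edges"
  shows "{\<omega> \<in> space config_algebra. \<forall>e\<in>J. \<omega> e \<longleftrightarrow> e \<in> B} \<in> sets config_algebra"
proof (rule sets.sets_Collect_finite_All[OF _ assms(1)])
  fix e assume "e \<in> J"
  then have [measurable]: "(\<lambda>\<omega>. \<omega> e) \<in> measurable config_algebra (count_space UNIV)"
    unfolding config_algebra_def using assms(2) by (intro measurable_component_singleton) auto
  show "{\<omega> \<in> space config_algebra. \<omega> e \<longleftrightarrow> e \<in> B} \<in> sets config_algebra" by measurable
qed

context rc_params
begin

lemma limit_mean_cong: "(\<And>X. f X = g X) \<Longrightarrow> limit_mean f = limit_mean g"
  by (metis ext)

lemma local_on_mono: "local_on J f \<Longrightarrow> J \<subseteq> K \<Longrightarrow> local_on K f"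
  unfolding local_on_def by (metis Int_assoc inf.absorb_iff2)

lemma limit_mean_sum:
  fixes f :: "'i \<Rightarrow> ('d::finite) edge set \<Rightarrow> real"
  assumes "finite J" "\<And>i. i \<in> I \<Longrightarrow> local_on J (f i)"
  shows "limit_mean (\<lambda>X. \<Sum>i\<in>I. f i X) = (\<Sum>i\<in>I. limit_mean (f i))"
proof (rule limit_mean_eq)
  have "((\<lambda>S. \<Sum>i\<in>I. box_mean (f i) S) \<longlongrightarrow> (\<Sum>i\<in>I. limit_mean (f i))) (volumes TYPE('d))"
    using assms by (intro tendsto_sum local_tendsto)
  then show "(box_mean (\<lambda>X. \<Sum>i\<in>I. f i X) \<longlongrightarrow> (\<Sum>i\<in>I. limit_mean (f i))) (volumes TYPE('d))"
    by (simp add: box_mean_def[abs_def] rc_mean_sum)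
qed

lemma limit_mean_cmult:
  assumes "finite J" "local_on J f"
  shows "limit_mean (\<lambda>X. a * f X) = a * limit_mean f"
proof (rule limit_mean_eq)
  show "(box_mean (\<lambda>X. a * f X) \<longlongrightarrow> a * limit_mean f) (finite_subsets_at_top UNIV)"
    using tendsto_mult_left[OF local_tendsto[OF assms(2,1)], of a]
    by (simp add: box_mean_def[abs_def] rc_mean_cmult)
qed

lemma limit_mean_nonneg:
  fixes f :: "('d::finite) edge set \<Rightarrow> real"
  assumes "finite J" "local_on J f" "\<And>X. 0 \<le> f X"
  shows "0 \<le> limit_mean f"
proof (rule tendsto_lowerbound[OF local_tendsto[OF assms(2,1)]])
  have "box_mean (\<lambda>_. 0) S \<le> box_mean f S" if "finite S" for S :: "(int ^ 'd) set"
    using assms(3) that by (intro box_mean_mono) auto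
  then show "eventually (\<lambda>S. 0 \<le> box_mean f S) (volumes TYPE('d))"
    by (intro eventually_finite_subsets_at_top_weakI) (simp add: box_mean_const)
qed simp

lemma limit_mean_const: "limit_mean (\<lambda>_ :: ('d::finite) edge set. a) = a"
proof (rule limit_mean_eq)
  have "eventually (\<lambda>S. box_mean (\<lambda>_. a) S = a) (volumes TYPE('d))"
    by (intro eventually_finite_subsets_at_top_weakI) (simp add: box_mean_const)
  then show "(box_mean (\<lambda>_. a) \<longlongrightarrow> a) (volumes TYPE('d))"
    by (rule tendsto_eventually)
qed

abbreviation pattern :: "'b set \<Rightarrow> 'b set \<Rightarrow> 'b set \<Rightarrow> real" where
  "pattern J B X \<equiv> of_bool (X \<inter> J = B)"

lemma local_pattern: "local_on J (pattern J B)"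
  by (simp add: local_on_def)

lemma local_expand:
  assumes "finite J" "local_on J f"
  shows "f X = (\<Sum>B\<in>Pow J. f B * pattern J B X)"
proof -
  have "(\<Sum>B\<in>Pow J. f B * pattern J B X) = (\<Sum>B\<in>Pow J. if X \<inter> J = B then f B else 0)"
    by (intro sum.cong) auto
  also have "\<dots> = f (X \<inter> J)" using assms(1) by (subst sum.delta') auto
  finally show ?thesis using assms(2) by (simp add: local_on_def)
qed

lemma limit_mean_expand:
  assumes "finite J" "local_on J f"
  shows "limit_mean f = (\<Sum>B\<in>Pow J. f B * limit_mean (pattern J B))"
proof -
  have "limit_mean f = limit_mean (\<lambda>X. \<Sum>B\<in>Pow J. f B * pattern J B X)"
    by (intro limit_mean_cong local_expand assms)
  also have "\<dots> = (\<Sum>B\<in>Pow J. limit_mean (\<lambda>X. f B * pattern J B X))"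
    using assms(1) by (intro limit_mean_sum) (auto simp: local_on_def)
  also have "\<dots> = (\<Sum>B\<in>Pow J. f B * limit_mean (pattern J B))"
    by (intro sum.cong refl limit_mean_cmult[OF assms(1) local_pattern])
  finally show ?thesis .
qed

text \<open>
  The finite-dimensional distributions of the limit, as laws of the random set of open edges in \<open>J\<close>.
\<close>

definition local_pmf :: "('d::finite) edge set \<Rightarrow> 'd edge set pmf" where
  "local_pmf J = embed_pmf (\<lambda>B. if B \<subseteq> J then limit_mean (pattern J B) else 0)"

lemma pmf_local_pmf:
  assumes "finite J"
  shows "pmf (local_pmf J) B = (if B \<subseteq> J then limit_mean (pattern J B) else 0)"
  unfolding local_pmf_def
proof (rule pmf_embed_pmf)
  let ?f = "\<lambda>B. if B \<subseteq> J then limit_mean (pattern J B) else 0"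
  show nonneg: "0 \<le> ?f B" for B
    using limit_mean_nonneg[OF assms local_pattern, of B] by simp
  have "(\<integral>\<^sup>+B. ennreal (?f B) \<partial>count_space UNIV) = (\<Sum>B\<in>Pow J. ennreal (?f B))"
    using assms by (intro nn_integral_count_space') auto
  also have "\<dots> = ennreal (\<Sum>B\<in>Pow J. ?f B)" by (intro sum_ennreal nonneg)
  also have "(\<Sum>B\<in>Pow J. ?f B) = (\<Sum>B\<in>Pow J. 1 * limit_mean (pattern J B))"
    by (intro sum.cong) auto
  also have "\<dots> = 1"
    using limit_mean_expand[of J "\<lambda>_. 1"] assms by (simp add: local_on_def limit_mean_const)
  finally show "(\<integral>\<^sup>+B. ennreal (?f B) \<partial>count_space UNIV) = 1" by simp
qed

lemma set_local_pmf: "finite J \<Longrightarrow> set_pmf (local_pmf J) \<subseteq> Pow J"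
  by (auto simp: set_pmf_iff pmf_local_pmf split: if_splits)

lemma measure_local_pmf:
  assumes "finite J"
  shows "measure (local_pmf J) Q = (\<Sum>B\<in>Pow J. of_bool (B \<in> Q) * limit_mean (pattern J B))"
proof -
  have "measure (local_pmf J) Q = measure (local_pmf J) (Q \<inter> Pow J)"
    using set_local_pmf[OF assms] by (intro measure_prob_cong_0) (auto simp: set_pmf_iff)
  also have "\<dots> = (\<Sum>B\<in>Q \<inter> Pow J. pmf (local_pmf J) B)"
    using assms by (intro measure_measure_pmf_finite) auto
  also have "\<dots> = (\<Sum>B\<in>Pow J. of_bool (B \<in> Q) * limit_mean (pattern J B))"
    using assms by (intro sum.mono_neutral_cong_left) (auto simp: pmf_local_pmf)
  finally show ?thesis .
qed

lemma map_local_pmf: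
  assumes "finite J" "K \<subseteq> J"
  shows "map_pmf (\<lambda>A. A \<inter> K) (local_pmf J) = local_pmf K"
proof (rule pmf_eqI)
  fix B
  have K: "finite K" using assms finite_subset by blast
  have "pmf (map_pmf (\<lambda>A. A \<inter> K) (local_pmf J)) B = measure (local_pmf J) {A. A \<inter> K = B}"
    by (simp add: pmf_map vimage_def)
  also have "\<dots> = (\<Sum>A\<in>Pow J. pattern K B A * limit_mean (pattern J A))"
    by (simp add: measure_local_pmf[OF assms(1)])
  also have "\<dots> = limit_mean (pattern K B)"
    by (rule limit_mean_expand[symmetric, OF assms(1) local_on_mono[OF local_pattern assms(2)]])
  also have "\<dots> = pmf (local_pmf K) B"
  proof (cases "B \<subseteq> K")
    case False
    then have "pattern K B = (\<lambda>_. 0)" by auto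
    then show ?thesis using False by (simp only: pmf_local_pmf[OF K] limit_mean_const if_False)
  qed (simp add: pmf_local_pmf K)
  finally show "pmf (map_pmf (\<lambda>A. A \<inter> K) (local_pmf J)) B = pmf (local_pmf K) B" .
qed

text \<open>
  A measure with the limiting finite-dimensional distributions; this determines it uniquely, and it
  turns out to be the same as being the weak limit.
\<close>

definition is_limit_measure :: "('d::finite) config measure \<Rightarrow> bool" where
  "is_limit_measure M \<longleftrightarrow> prob_space M \<and> sets M = sets config_algebra \<and>
    (\<forall>J B. finite J \<longrightarrow> J \<subseteq> lattice_edges \<longrightarrow> B \<subseteq> J \<longrightarrow>
      measure M {\<omega> \<in> space M. \<forall>e\<in>J. \<omega> e \<longleftrightarrow> e \<in> B} = limit_mean (pattern J B))"

text \<open>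
  The Daniell--Kolmogorov theorem needs coordinates in a Polish space, so states of edges are first
  encoded as the reals 0 and 1 and then decoded.
\<close>

lemma limit_measure_exists: "\<exists>M :: ('d::finite) config measure. is_limit_measure M"
proof -
  let ?I = "lattice_edges :: 'd edge set"
  define ind where "ind J A = (\<lambda>e\<in>J. if e \<in> A then 1 else 0 :: real)" for J A :: "'d edge set"
  define P where "P J = distr (measure_pmf (local_pmf J)) (PiM J (\<lambda>_. borel)) (ind J)" for J
  have ind: "ind J \<in> measurable (measure_pmf \<mu>) (PiM J (\<lambda>_. borel))" for J \<mu>
    by (auto simp: ind_def space_PiM)
  interpret polish_projective ?I P
  proof (intro polish_projective.intro projective_family.intro)
    fix J H :: "'d edge set" assume JH: "J \<subseteq> H" "finite H" "H \<subseteq> ?I"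
    have "distr (P H) (PiM J (\<lambda>_. borel)) (\<lambda>f. restrict f J)
        = distr (measure_pmf (local_pmf H)) (PiM J (\<lambda>_. borel)) ((\<lambda>f. restrict f J) \<circ> ind H)"
      unfolding P_def using JH by (intro distr_distr ind measurable_restrict_subset)
    also have "(\<lambda>f. restrict f J) \<circ> ind H = ind J \<circ> (\<lambda>A. A \<inter> J)"
      using JH by (auto simp: ind_def fun_eq_iff)
    also have "distr (measure_pmf (local_pmf H)) (PiM J (\<lambda>_. borel)) (ind J \<circ> (\<lambda>A. A \<inter> J))
        = distr (distr (measure_pmf (local_pmf H)) (count_space UNIV) (\<lambda>A. A \<inter> J)) (PiM J (\<lambda>_. borel)) (ind J)"
      by (intro distr_distr[symmetric]) (auto simp: ind_def space_PiM)
    also have "\<dots> = P J"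
      unfolding P_def map_pmf_rep_eq[symmetric] map_local_pmf[OF JH(2,1)] ..
    finally show "P J = distr (P H) (PiM J (\<lambda>_. borel)) (\<lambda>f. restrict f J)" ..
  next
    fix J :: "'d edge set"
    show "prob_space (P J)" unfolding P_def by (intro measure_pmf.prob_space_distr ind)
  qed
  define g where "g x = (\<lambda>e\<in>?I. x e = (1::real))" for x
  define M where "M = distr lim config_algebra g"
  have g: "g \<in> measurable lim config_algebra"
    unfolding g_def config_algebra_def
    by (intro measurable_restrict) (simp add: measurable_cong_sets[OF sets_lim refl])
  have "is_limit_measure M"
    unfolding is_limit_measure_def
  proof (intro conjI allI impI)
    show "prob_space M" unfolding M_def by (intro P.prob_space_distr g)
    show "sets M = sets config_algebra" by (simp add: M_def)
    fix J B :: "'d edge set" assume J: "finite J" "J \<subseteq> ?I" "B \<subseteq> J"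
    let ?Q = "{\<omega> \<in> space M. \<forall>e\<in>J. \<omega> e \<longleftrightarrow> e \<in> B}"
    define X where "X = {y \<in> space (PiM J (\<lambda>_. borel)). \<forall>e\<in>J. y e = (1::real) \<longleftrightarrow> e \<in> B}"
    have Xs: "X \<in> sets (PiM J (\<lambda>_. borel))"
      unfolding X_def using J(1) by measurable
    have Q: "?Q \<in> sets config_algebra"
      using cylinder_measurable[OF J(1,2), of B] by (simp add: M_def)
    have "measure M ?Q = measure lim (g -` ?Q \<inter> space lim)"
      unfolding M_def by (rule measure_distr[OF g]) (use Q in \<open>simp add: M_def\<close>)
    also have "g -` ?Q \<inter> space lim = prod_emb ?I (\<lambda>_. borel) J X"
      using J(2) measurable_space[OF g]
      by (auto simp: prod_emb_def X_def g_def M_def space_lim space_PiM subset_eq)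
    also have "measure lim \<dots> = measure (P J) X" by (rule measure_lim_emb[OF J(2,1) Xs])
    also have "\<dots> = measure (local_pmf J) {A. \<forall>e\<in>J. e \<in> A \<longleftrightarrow> e \<in> B}"
      unfolding P_def measure_distr[OF ind Xs]
      by (intro arg_cong2[where f = measure]) (auto simp: X_def ind_def space_PiM)
    also have "\<dots> = (\<Sum>A\<in>Pow J. pattern J B A * limit_mean (pattern J A))"
      unfolding measure_local_pmf[OF J(1)] using J(3) by (intro sum.cong) auto
    also have "\<dots> = limit_mean (pattern J B)"
      by (rule limit_mean_expand[symmetric, OF J(1) local_pattern])
    finally show "measure M ?Q = limit_mean (pattern J B)" .
  qed
  then show ?thesis ..
qed

end

section \<open>Existence and uniqueness of the weak limit\<close>

abbreviation opened :: "('d::finite) config \<Rightarrow> 'd edge set" where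
  "opened \<equiv> open_edges lattice_edges"

lemma topspace_config: "topspace config_topology = lattice_edges \<rightarrow>\<^sub>E UNIV"
  by (simp add: config_topology_def)

lemma space_config: "space config_algebra = lattice_edges \<rightarrow>\<^sub>E UNIV"
  by (simp add: config_algebra_def space_PiM)

lemma openin_cylinder:
  assumes "finite J" "J \<subseteq> lattice_edges"
  shows "openin config_topology {\<omega> \<in> topspace config_topology. opened \<omega> \<inter> J = B}"
  unfolding config_topology_def openin_product_topology_alt
proof (intro ballI)
  fix \<omega> assume "\<omega> \<in> {\<omega> \<in> topspace (product_topology (\<lambda>_. discrete_topology UNIV) lattice_edges). opened \<omega> \<inter> J = B}"
  then have \<omega>: "\<omega> \<in> lattice_edges \<rightarrow>\<^sub>E UNIV" "opened \<omega> \<inter> J = B" by auto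
  define U where "U e = (if e \<in> J then {\<omega> e} else UNIV)" for e
  have "finite {e \<in> lattice_edges. U e \<noteq> topspace (discrete_topology UNIV)}"
    using assms(1) by (rule rev_finite_subset) (auto simp: U_def)
  moreover have "\<omega> \<in> Pi\<^sub>E lattice_edges U" using \<omega>(1) by (auto simp: U_def PiE_def Pi_def)
  moreover have "opened \<omega>' \<inter> J = B" if "\<omega>' \<in> Pi\<^sub>E lattice_edges U" for \<omega>'
  proof -
    have "\<omega>' e = \<omega> e" if "e \<in> J" for e
      using \<open>\<omega>' \<in> _\<close> that assms(2) PiE_mem[of \<omega>' lattice_edges U e] by (auto simp: U_def)
    then show ?thesis using \<omega>(2) by (auto simp: open_edges_def)
  qed
  ultimately show "\<exists>U. finite {i \<in> lattice_edges. U i \<noteq> topspace (discrete_topology UNIV)} \<and>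
      (\<forall>i\<in>lattice_edges. openin (discrete_topology UNIV) (U i)) \<and> \<omega> \<in> Pi\<^sub>E lattice_edges U \<and>
      Pi\<^sub>E lattice_edges U \<subseteq> {\<omega> \<in> topspace (product_topology (\<lambda>_. discrete_topology UNIV) lattice_edges). opened \<omega> \<inter> J = B}"
    by (intro exI[of _ U]) (auto simp: U_def PiE_def extensional_def)
qed

lemma continuous_local:
  assumes "finite J" "J \<subseteq> lattice_edges" "local_on J f"
  shows "continuous_map config_topology euclideanreal (\<lambda>\<omega>. f (opened \<omega>))"
  unfolding continuous_map
proof (intro conjI allI impI)
  fix U :: "real set"
  have "{\<omega> \<in> topspace config_topology. f (opened \<omega>) \<in> U} =
      (\<Union>B\<in>{B. B \<subseteq> J \<and> f B \<in> U}. {\<omega> \<in> topspace config_topology. opened \<omega> \<inter> J = B})"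
    using assms(3) by (auto simp: local_on_def)
  also have "openin config_topology \<dots>" using openin_cylinder[OF assms(1,2)] by blast
  finally show "openin config_topology {\<omega> \<in> topspace config_topology. f (opened \<omega>) \<in> U}" .
qed auto

lemma compact_config: "compact_space config_topology"
  unfolding config_topology_def compact_space_product_topology by (simp add: compact_space_discrete_topology)

text \<open>
  Every configuration has a cylinder neighbourhood on which \<open>f\<close> varies little, and by compactness
  finitely many of these suffice; \<open>J\<close> collects their edges.
\<close>

lemma continuous_almost_local:
  assumes f: "continuous_map (config_topology :: ('d::finite) config topology) euclideanreal f" and "0 < \<epsilon>"
  obtains J where "finite J" "J \<subseteq> lattice_edges"
    "\<And>\<omega> \<omega>'. \<omega> \<in> topspace config_topology \<Longrightarrow> \<omega>' \<in> topspace config_topology \<Longrightarrow>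
      opened \<omega> \<inter> J = opened \<omega>' \<inter> J \<Longrightarrow> \<bar>f \<omega> - f \<omega>'\<bar> < \<epsilon>"
proof -
  let ?T = "topspace config_topology :: 'd config set"
  define cyl where "cyl \<omega> J = {\<omega>' \<in> ?T. opened \<omega>' \<inter> J = opened \<omega> \<inter> J}" for \<omega> J
  have "\<exists>J. finite J \<and> J \<subseteq> lattice_edges \<and> (\<forall>\<omega>'\<in>cyl \<omega> J. \<bar>f \<omega>' - f \<omega>\<bar> < \<epsilon> / 2)" if \<omega>: "\<omega> \<in> ?T" for \<omega>
  proof -
    define W where "W = {\<omega>' \<in> ?T. f \<omega>' \<in> ball (f \<omega>) (\<epsilon> / 2)}"
    have "openin config_topology W"
      unfolding W_def using f by (intro openin_continuous_map_preimage[of _ euclideanreal]) auto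
    moreover have \<omega>W: "\<omega> \<in> W" using \<omega> assms(2) by (simp add: W_def)
    ultimately have "\<exists>U. finite {e \<in> lattice_edges. U e \<noteq> topspace (discrete_topology UNIV)} \<and>
        (\<forall>e\<in>lattice_edges. openin (discrete_topology UNIV) (U e)) \<and> \<omega> \<in> Pi\<^sub>E lattice_edges U \<and>
        Pi\<^sub>E lattice_edges U \<subseteq> W"
      unfolding config_topology_def openin_product_topology_alt by (rule bspec)
    then obtain U where U: "finite {e \<in> lattice_edges. U e \<noteq> UNIV}"
      "\<omega> \<in> Pi\<^sub>E lattice_edges U" "Pi\<^sub>E lattice_edges U \<subseteq> {\<omega>' \<in> ?T. f \<omega>' \<in> ball (f \<omega>) (\<epsilon> / 2)}"
      by (auto simp: W_def)
    let ?J = "{e \<in> lattice_edges. U e \<noteq> UNIV}"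
    have "\<bar>f \<omega>' - f \<omega>\<bar> < \<epsilon> / 2" if \<omega>': "\<omega>' \<in> cyl \<omega> ?J" for \<omega>'
    proof -
      have "\<omega>' e \<in> U e" if "e \<in> lattice_edges" for e
      proof (cases "U e = UNIV")
        case False
        then have "e \<in> opened \<omega>' \<longleftrightarrow> e \<in> opened \<omega>" using \<omega>' that unfolding cyl_def by blast
        then have "\<omega>' e = \<omega> e" using that by (simp add: open_edges_def)
        then show ?thesis using PiE_mem[OF U(2) that] by simp
      qed simp
      moreover have "\<omega>' \<in> lattice_edges \<rightarrow>\<^sub>E UNIV" using \<omega>' by (simp add: cyl_def topspace_config)
      ultimately have "\<omega>' \<in> Pi\<^sub>E lattice_edges U" by (simp add: PiE_iff)
      then have "f \<omega>' \<in> ball (f \<omega>) (\<epsilon> / 2)" using U(3) by blast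
      then show ?thesis by (simp add: dist_real_def abs_minus_commute)
    qed
    then show ?thesis using U(1) by (intro exI[of _ ?J]) auto
  qed
  then obtain J where J: "\<And>\<omega>. \<omega> \<in> ?T \<Longrightarrow> finite (J \<omega>) \<and> J \<omega> \<subseteq> lattice_edges \<and>
      (\<forall>\<omega>'\<in>cyl \<omega> (J \<omega>). \<bar>f \<omega>' - f \<omega>\<bar> < \<epsilon> / 2)" by metis
  have "openin config_topology U" if "U \<in> (\<lambda>\<omega>. cyl \<omega> (J \<omega>)) ` ?T" for U
  proof -
    from that obtain \<omega> where \<omega>: "\<omega> \<in> ?T" "U = cyl \<omega> (J \<omega>)" by blast
    show ?thesis unfolding \<omega>(2) cyl_def using J[OF \<omega>(1)] by (intro openin_cylinder) auto
  qed
  moreover have "?T \<subseteq> \<Union>((\<lambda>\<omega>. cyl \<omega> (J \<omega>)) ` ?T)" by (auto simp: cyl_def)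
  ultimately obtain \<F> where \<F>: "finite \<F>" "\<F> \<subseteq> (\<lambda>\<omega>. cyl \<omega> (J \<omega>)) ` ?T" "?T \<subseteq> \<Union>\<F>"
    using compact_config[where 'a = 'd] unfolding compact_space_alt by meson
  obtain W where W: "W \<subseteq> ?T" "finite W" "\<F> = (\<lambda>\<omega>. cyl \<omega> (J \<omega>)) ` W"
    using finite_subset_image[OF \<F>(1,2)] by blast
  show thesis
  proof
    show "finite (\<Union>(J ` W))" "\<Union>(J ` W) \<subseteq> lattice_edges" using W J by blast+
    fix \<omega> \<omega>' assume \<omega>: "\<omega> \<in> ?T" "\<omega>' \<in> ?T" "opened \<omega> \<inter> \<Union>(J ` W) = opened \<omega>' \<inter> \<Union>(J ` W)"
    obtain \<omega>0 where \<omega>0: "\<omega>0 \<in> W" "\<omega> \<in> cyl \<omega>0 (J \<omega>0)" using \<omega>(1) \<F>(3) W(3) by blast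
    have "opened \<omega> \<inter> J \<omega>0 = opened \<omega>' \<inter> J \<omega>0" using \<omega>(3) \<omega>0(1) by blast
    then have "\<omega>' \<in> cyl \<omega>0 (J \<omega>0)" using \<omega>0(2) \<omega>(2) by (simp add: cyl_def)
    then have "\<bar>f \<omega>' - f \<omega>0\<bar> < \<epsilon> / 2" "\<bar>f \<omega> - f \<omega>0\<bar> < \<epsilon> / 2" using J \<omega>0 W(1) by blast+
    then show "\<bar>f \<omega> - f \<omega>'\<bar> < \<epsilon>" by linarith
  qed
qed

lemma configuration_lattice: "configuration lattice_edges A \<in> topspace config_topology"
  by (simp add: topspace_config configuration_def)

lemma extend_closed_configuration:
  assumes "A \<subseteq> edges_in S"
  shows "extend_closed S (configuration (edges_in S) A) = configuration lattice_edges A"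
  using assms by (auto simp: extend_closed_def configuration_def fun_eq_iff)

context rc_params
begin

lemma integral_rc_vol:
  assumes "finite S" "c = 1 / q" "1 \<le> q"
  shows "(\<integral>\<omega>. f (extend_closed S \<omega>) \<partial>rc_vol S p q) = box_mean (\<lambda>A. f (configuration lattice_edges A)) S"
proof -
  have "(\<integral>\<omega>. f (extend_closed S \<omega>) \<partial>rc_vol S p q)
      = rc_mean p (1/q) {} (edges_in S) (\<lambda>A. f (extend_closed S (configuration (edges_in S) A)))"
    using assms p by (intro integral_rc_measure graph_edges_in edges_in_subset) auto
  also have "\<dots> = box_mean (\<lambda>A. f (configuration lattice_edges A)) S"
    unfolding box_mean_def assms(2)[symmetric]
    by (rule rc_mean_cong) (simp add: extend_closed_configuration)
  finally show ?thesis .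
qed

lemma limit_measure_local:
  assumes M: "is_limit_measure M" and J: "finite J" "J \<subseteq> lattice_edges" and f: "local_on J f"
  shows "integrable M (\<lambda>\<omega>. f (opened \<omega>))" "(\<integral>\<omega>. f (opened \<omega>) \<partial>M) = limit_mean f"
proof -
  interpret M: prob_space M using M by (simp add: is_limit_measure_def)
  have spM: "space M = lattice_edges \<rightarrow>\<^sub>E UNIV"
    using M sets_eq_imp_space_eq[of M config_algebra] by (simp add: is_limit_measure_def space_config)
  define Q where "Q B = {\<omega> \<in> space M. \<forall>e\<in>J. \<omega> e \<longleftrightarrow> e \<in> B}" for B
  have Qs: "Q B \<in> sets M" for B
    using cylinder_measurable[OF J, of B] M by (simp add: Q_def is_limit_measure_def spM space_config)
  have eq: "f (opened \<omega>) = (\<Sum>B\<in>Pow J. f B * indicator (Q B) \<omega>)" if "\<omega> \<in> space M" for \<omega>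
  proof -
    have "pattern J B (opened \<omega>) = indicator (Q B) \<omega>" if "B \<subseteq> J" for B
      using \<open>\<omega> \<in> space M\<close> that J(2) by (auto simp: Q_def indicator_def open_edges_def)
    then show ?thesis
      by (subst local_expand[OF J(1) f]) (intro sum.cong, auto)
  qed
  have int: "integrable M (\<lambda>\<omega>. \<Sum>B\<in>Pow J. f B * indicator (Q B) \<omega>)"
    using Qs by (intro Bochner_Integration.integrable_sum integrable_mult_right integrable_real_indicator)
      (auto simp: M.emeasure_eq_measure)
  then show "integrable M (\<lambda>\<omega>. f (opened \<omega>))"
    by (subst Bochner_Integration.integrable_cong[OF refl eq])
  have "(\<integral>\<omega>. f (opened \<omega>) \<partial>M) = (\<integral>\<omega>. (\<Sum>B\<in>Pow J. f B * indicator (Q B) \<omega>) \<partial>M)"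
    by (intro Bochner_Integration.integral_cong refl eq)
  also have "\<dots> = (\<Sum>B\<in>Pow J. f B * measure M (Q B))"
    using Qs sets.Int_space_eq2[OF Qs]
    by (subst Bochner_Integration.integral_sum) (auto intro!: integrable_mult_right integrable_real_indicator simp: M.emeasure_eq_measure)
  also have "\<dots> = (\<Sum>B\<in>Pow J. f B * limit_mean (pattern J B))"
    using M J by (intro sum.cong) (auto simp: is_limit_measure_def Q_def)
  also have "\<dots> = limit_mean f" by (rule limit_mean_expand[OF J(1) f, symmetric])
  finally show "(\<integral>\<omega>. f (opened \<omega>) \<partial>M) = limit_mean f" .
qed

lemma limit_measure_event:
  assumes M: "is_limit_measure M" and J: "finite J" "J \<subseteq> lattice_edges" and Q: "local_on J (\<lambda>X. of_bool (Q X))"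
  shows "{\<omega> \<in> space M. Q (opened \<omega>)} \<in> sets M"
    and "measure M {\<omega> \<in> space M. Q (opened \<omega>)} = limit_mean (\<lambda>X. of_bool (Q X))"
proof -
  let ?Q = "{\<omega> \<in> space M. Q (opened \<omega>)}"
  have "(\<lambda>\<omega>. of_bool (Q (opened \<omega>)) :: real) \<in> borel_measurable M"
    using limit_measure_local(1)[OF M J Q] by (rule borel_measurable_integrable)
  then have "(\<lambda>\<omega>. of_bool (Q (opened \<omega>)) :: real) -` {1} \<inter> space M \<in> sets M"
    by (rule measurable_sets) simp
  also have "(\<lambda>\<omega>. of_bool (Q (opened \<omega>)) :: real) -` {1} \<inter> space M = ?Q" by auto
  finally show "?Q \<in> sets M" .
  have "limit_mean (\<lambda>X. of_bool (Q X)) = (\<integral>\<omega>. indicator ?Q \<omega> \<partial>M)"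
    unfolding limit_measure_local(2)[OF M J Q, symmetric]
    by (intro Bochner_Integration.integral_cong) auto
  also have "\<dots> = measure M (?Q \<inter> space M)" by (rule Bochner_Integration.integral_indicator)
  also have "?Q \<inter> space M = ?Q" by auto
  finally show "measure M ?Q = limit_mean (\<lambda>X. of_bool (Q X))" ..
qed

lemma limit_measure_unique:
  assumes "is_limit_measure M" "is_limit_measure M'"
  shows "M = M'"
proof (rule measure_eqI_PiM_infinite)
  show sets: "sets M = PiM lattice_edges (\<lambda>_. count_space UNIV)" "sets M' = PiM lattice_edges (\<lambda>_. count_space UNIV)"
    using assms by (simp_all add: is_limit_measure_def config_algebra_def)
  interpret M: prob_space M using assms(1) by (simp add: is_limit_measure_def)
  interpret M': prob_space M' using assms(2) by (simp add: is_limit_measure_def)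
  show "finite_measure M" by (rule M.finite_measure_axioms)
  fix A :: "'a edge \<Rightarrow> bool set" and J :: "'a edge set"
  assume J: "finite J" "J \<subseteq> lattice_edges"
  let ?Q = "\<lambda>X. \<forall>e\<in>J. (e \<in> X) \<in> A e"
  have loc: "local_on J (\<lambda>X. of_bool (?Q X))"
    unfolding local_on_def by (intro allI arg_cong[where f = of_bool] ball_cong refl) simp
  have emb: "prod_emb lattice_edges (\<lambda>_. count_space UNIV) J (Pi\<^sub>E J A) = {\<omega> \<in> space K. ?Q (opened \<omega>)}"
    if "sets K = PiM lattice_edges (\<lambda>_. count_space UNIV)" for K :: "'a config measure"
  proof (intro set_eqI)
    fix \<omega>
    have "\<omega> e \<in> A e \<longleftrightarrow> (e \<in> opened \<omega>) \<in> A e" if "e \<in> J" for e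
      using subsetD[OF J(2) that] by (simp add: open_edges_def)
    then have "restrict \<omega> J \<in> Pi\<^sub>E J A \<longleftrightarrow> ?Q (opened \<omega>)" by (simp add: PiE_iff)
    then show "\<omega> \<in> prod_emb lattice_edges (\<lambda>_. count_space UNIV) J (Pi\<^sub>E J A) \<longleftrightarrow>
        \<omega> \<in> {\<omega> \<in> space K. ?Q (opened \<omega>)}"
      by (simp add: prod_emb_iff sets_eq_imp_space_eq[OF that] space_PiM PiE_iff conj_commute)
  qed
  show "emeasure M (prod_emb lattice_edges (\<lambda>_. count_space UNIV) J (Pi\<^sub>E J A)) =
      emeasure M' (prod_emb lattice_edges (\<lambda>_. count_space UNIV) J (Pi\<^sub>E J A))"
    unfolding M.emeasure_eq_measure M'.emeasure_eq_measure
    using limit_measure_event(2)[OF assms(1) J loc] limit_measure_event(2)[OF assms(2) J loc]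
    by (simp add: emb[OF sets(1), symmetric] emb[OF sets(2), symmetric])
qed

lemma weak_limit_imp_limit_measure:
  assumes q: "c = 1 / q" "1 \<le> q" and M: "is_weak_limit p q (M :: ('d::finite) config measure)"
  shows "is_limit_measure M"
  unfolding is_limit_measure_def
proof (intro conjI allI impI)
  show "prob_space M" "sets M = sets config_algebra" using M by (auto simp: is_weak_limit_def)
  have spM: "space M = lattice_edges \<rightarrow>\<^sub>E UNIV"
    using sets_eq_imp_space_eq[OF \<open>sets M = _\<close>] by (simp add: space_config)
  fix J B :: "'d edge set" assume J: "finite J" "J \<subseteq> lattice_edges" "B \<subseteq> J"
  let ?f = "\<lambda>\<omega>. pattern J B (opened \<omega>)"
  have cont: "continuous_map config_topology euclideanreal ?f"
    using continuous_local[OF J(1,2) local_pattern] .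
  have bd: "bounded (?f ` topspace config_topology)"
    by (rule bounded_subset[of "{0, 1}"]) auto
  have lim: "((\<lambda>S. \<integral>\<omega>. ?f (extend_closed S \<omega>) \<partial>rc_vol S p q) \<longlongrightarrow> (\<integral>\<omega>. ?f \<omega> \<partial>M)) (volumes TYPE('d))"
    using M[unfolded is_weak_limit_def] cont bd by blast
  have eq: "(\<integral>\<omega>. ?f (extend_closed S \<omega>) \<partial>rc_vol S p q) = box_mean (pattern J B) S"
    if "finite S" for S :: "(int ^ 'd) set"
    unfolding integral_rc_vol[OF that q, where f = ?f] box_mean_def
    by (rule rc_mean_cong) (use edges_in_subset(1)[of S] in \<open>auto simp: Int_absorb2\<close>)
  have "(box_mean (pattern J B) \<longlongrightarrow> (\<integral>\<omega>. ?f \<omega> \<partial>M)) (volumes TYPE('d))"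
    by (rule Lim_transform_eventually[OF lim eventually_finite_subsets_at_top_weakI]) (simp add: eq)
  then have "limit_mean (pattern J B) = (\<integral>\<omega>. ?f \<omega> \<partial>M)" by (rule limit_mean_eq)
  also have "\<dots> = (\<integral>\<omega>. indicator {\<omega> \<in> space M. \<forall>e\<in>J. \<omega> e \<longleftrightarrow> e \<in> B} \<omega> \<partial>M)"
    using J(2,3) by (intro Bochner_Integration.integral_cong) (auto simp: indicator_def open_edges_def)
  also have "\<dots> = measure M ({\<omega> \<in> space M. \<forall>e\<in>J. \<omega> e \<longleftrightarrow> e \<in> B} \<inter> space M)"
    by (rule Bochner_Integration.integral_indicator)
  also have "{\<omega> \<in> space M. \<forall>e\<in>J. \<omega> e \<longleftrightarrow> e \<in> B} \<inter> space M = {\<omega> \<in> space M. \<forall>e\<in>J. \<omega> e \<longleftrightarrow> e \<in> B}" by auto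
  finally show "measure M {\<omega> \<in> space M. \<forall>e\<in>J. \<omega> e \<longleftrightarrow> e \<in> B} = limit_mean (pattern J B)" ..
qed

text \<open>
  Approximate \<open>f\<close> uniformly by local functions, uniformly also in the volume. Measurability of \<open>f\<close> for
  the product sigma-algebra comes from the same approximation.
\<close>

lemma limit_measure_imp_weak_limit:
  assumes q: "c = 1 / q" "1 \<le> q" and M: "is_limit_measure (M :: ('d::finite) config measure)"
  shows "is_weak_limit p q M"
  unfolding is_weak_limit_def
proof (intro conjI allI impI)
  show pM: "prob_space M" and sM: "sets M = sets config_algebra" using M by (auto simp: is_limit_measure_def)
  interpret M: prob_space M by fact
  have spM: "space M = topspace config_topology"
    using sets_eq_imp_space_eq[OF sM] by (simp add: space_config topspace_config)
  fix f :: "'d config \<Rightarrow> real"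
  assume f: "continuous_map config_topology euclideanreal f \<and> bounded (f ` topspace config_topology)"
  then obtain C where C: "\<And>\<omega>. \<omega> \<in> topspace config_topology \<Longrightarrow> \<bar>f \<omega>\<bar> \<le> C"
    by (auto simp: bounded_iff)
  let ?cfg = "configuration lattice_edges :: 'd edge set \<Rightarrow> 'd config"
  have approx: "\<exists>J. finite J \<and> J \<subseteq> lattice_edges \<and>
      (\<forall>\<omega>\<in>topspace config_topology. \<bar>f \<omega> - f (?cfg (opened \<omega> \<inter> J))\<bar> \<le> \<epsilon>)" if "0 < \<epsilon>" for \<epsilon>
  proof -
    obtain J where J: "finite J" "J \<subseteq> lattice_edges" "\<And>\<omega> \<omega>'. \<omega> \<in> topspace config_topology \<Longrightarrow>
        \<omega>' \<in> topspace config_topology \<Longrightarrow> opened \<omega> \<inter> J = opened \<omega>' \<inter> J \<Longrightarrow> \<bar>f \<omega> - f \<omega>'\<bar> < \<epsilon>"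
      using continuous_almost_local[of f \<epsilon>] f \<open>0 < \<epsilon>\<close> by metis
    have "\<bar>f \<omega> - f (?cfg (opened \<omega> \<inter> J))\<bar> \<le> \<epsilon>" if "\<omega> \<in> topspace config_topology" for \<omega>
    proof -
      have "opened \<omega> \<inter> J = opened (?cfg (opened \<omega> \<inter> J)) \<inter> J" using J(2) by auto
      from J(3)[OF that configuration_lattice this] show ?thesis by simp
    qed
    then show ?thesis using J(1,2) by blast
  qed
  have loc: "local_on J (\<lambda>X. f (?cfg (X \<inter> J)))" for J by (simp add: local_on_def)
  have "f \<in> borel_measurable M"
  proof -
    have "\<exists>J. finite J \<and> J \<subseteq> lattice_edges \<and>
      (\<forall>\<omega>\<in>topspace config_topology. \<bar>f \<omega> - f (?cfg (opened \<omega> \<inter> J))\<bar> \<le> inverse (real (Suc n)))" for n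
      by (rule approx) simp
    then obtain J where J: "\<And>n. finite (J n) \<and> J n \<subseteq> lattice_edges \<and>
      (\<forall>\<omega>\<in>topspace config_topology. \<bar>f \<omega> - f (?cfg (opened \<omega> \<inter> J n))\<bar> \<le> inverse (real (Suc n)))" by metis
    show ?thesis
    proof (rule borel_measurable_LIMSEQ_real)
      show "(\<lambda>\<omega>. f (?cfg (opened \<omega> \<inter> J n))) \<in> borel_measurable M" for n
        using limit_measure_local(1)[OF M _ _ loc, of "J n"] J[of n] by (intro borel_measurable_integrable) auto
      fix \<omega> assume "\<omega> \<in> space M"
      then have "\<bar>f (?cfg (opened \<omega> \<inter> J n)) - f \<omega>\<bar> \<le> inverse (real (Suc n))" for n
        using J[of n] by (simp add: spM abs_minus_commute)
      then have "(\<lambda>n. f (?cfg (opened \<omega> \<inter> J n)) - f \<omega>) \<longlonglongrightarrow> 0"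
        by (intro Lim_null_comparison[OF _ LIMSEQ_inverse_real_of_nat]) auto
      then show "(\<lambda>n. f (?cfg (opened \<omega> \<inter> J n))) \<longlonglongrightarrow> f \<omega>" by (rule LIM_zero_cancel)
    qed
  qed
  then have intf: "integrable M f"
    using C by (intro M.integrable_const_bound[of _ C]) (auto simp: spM)
  have "((\<lambda>S. box_mean (\<lambda>A. f (?cfg A)) S) \<longlongrightarrow> (\<integral>\<omega>. f \<omega> \<partial>M)) (volumes TYPE('d))"
  proof (rule tendstoI)
    fix \<epsilon> :: real assume "0 < \<epsilon>"
    then obtain J where J: "finite J" "J \<subseteq> lattice_edges"
      "\<And>\<omega>. \<omega> \<in> topspace config_topology \<Longrightarrow> \<bar>f \<omega> - f (?cfg (opened \<omega> \<inter> J))\<bar> \<le> \<epsilon> / 4"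
      using approx[of "\<epsilon> / 4"] by auto
    let ?g = "\<lambda>X. f (?cfg (X \<inter> J))"
    have "\<bar>(\<integral>\<omega>. f \<omega> \<partial>M) - limit_mean ?g\<bar> \<le> \<epsilon> / 4"
    proof -
      note g = limit_measure_local[OF M J(1,2) loc]
      have "\<bar>(\<integral>\<omega>. f \<omega> \<partial>M) - (\<integral>\<omega>. ?g (opened \<omega>) \<partial>M)\<bar> = \<bar>\<integral>\<omega>. f \<omega> - ?g (opened \<omega>) \<partial>M\<bar>"
        using intf g(1) by simp
      also have "\<dots> \<le> (\<integral>\<omega>. \<bar>f \<omega> - ?g (opened \<omega>)\<bar> \<partial>M)" by (rule integral_abs_bound)
      also have "\<dots> \<le> (\<integral>\<omega>. \<epsilon> / 4 \<partial>M)"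
        using intf g(1) J(3) by (intro integral_mono) (auto simp: spM)
      also have "\<dots> = \<epsilon> / 4" by (simp add: M.prob_space)
      finally show ?thesis using g(2) by simp
    qed
    moreover have "\<bar>box_mean (\<lambda>A. f (?cfg A)) S - box_mean ?g S\<bar> \<le> \<epsilon> / 4" if S: "finite S" for S :: "(int ^ 'd) set"
    proof -
      have d: "\<bar>f (?cfg A) - ?g A\<bar> \<le> \<epsilon> / 4" if "A \<subseteq> lattice_edges" for A
        using J(3)[OF configuration_lattice, of A] that by (simp add: Int_absorb2)
      have d': "f (?cfg A) - ?g A \<le> \<epsilon> / 4" "- (\<epsilon> / 4) \<le> f (?cfg A) - ?g A" if "A \<subseteq> lattice_edges" for A
        using d[OF that] by linarith+
      have "box_mean (\<lambda>A. f (?cfg A) - ?g A) S \<le> box_mean (\<lambda>_. \<epsilon> / 4) S"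
        "box_mean (\<lambda>_. - (\<epsilon> / 4)) S \<le> box_mean (\<lambda>A. f (?cfg A) - ?g A) S"
        by (intro box_mean_mono S d'; assumption)+
      moreover have "box_mean (\<lambda>A. f (?cfg A) - ?g A) S = box_mean (\<lambda>A. f (?cfg A)) S - box_mean ?g S"
        by (simp add: box_mean_def rc_mean_diff)
      ultimately show ?thesis unfolding box_mean_const[OF S] by linarith
    qed
    moreover have "eventually (\<lambda>S. dist (box_mean ?g S) (limit_mean ?g) < \<epsilon> / 4) (volumes TYPE('d))"
      using \<open>0 < \<epsilon>\<close> by (intro tendstoD[OF local_tendsto[OF loc J(1)]]) simp
    ultimately show "eventually (\<lambda>S. dist (box_mean (\<lambda>A. f (?cfg A)) S) (\<integral>\<omega>. f \<omega> \<partial>M) < \<epsilon>) (volumes TYPE('d))"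
    proof -
      assume a: "\<bar>(\<integral>\<omega>. f \<omega> \<partial>M) - limit_mean ?g\<bar> \<le> \<epsilon> / 4"
        and b: "\<And>S :: (int ^ 'd) set. finite S \<Longrightarrow> \<bar>box_mean (\<lambda>A. f (?cfg A)) S - box_mean ?g S\<bar> \<le> \<epsilon> / 4"
        and e: "eventually (\<lambda>S. dist (box_mean ?g S) (limit_mean ?g) < \<epsilon> / 4) (volumes TYPE('d))"
      have "eventually (\<lambda>S :: (int ^ 'd) set. finite S) (volumes TYPE('d))"
        by (intro eventually_finite_subsets_at_top_weakI)
      with e show ?thesis
      proof eventually_elim
        case (elim S)
        from b[OF elim(2)] elim(1) a \<open>0 < \<epsilon>\<close> show ?case unfolding dist_real_def by linarith
      qed
    qed
  qed
  then show "((\<lambda>S. \<integral>\<omega>. f (extend_closed S \<omega>) \<partial>rc_vol S p q) \<longlongrightarrow> (\<integral>\<omega>. f \<omega> \<partial>M)) (volumes TYPE('d))"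
    by (rule Lim_transform_eventually[OF _ eventually_finite_subsets_at_top_weakI])
      (simp add: integral_rc_vol[OF _ q, where f = f])
qed

theorem rc_inf_limit_measure:
  assumes q: "c = 1 / q" "1 \<le> q"
  shows "is_limit_measure (rc_inf p q :: ('d::finite) config measure)"
proof -
  obtain M :: "'d config measure" where M: "is_limit_measure M" using limit_measure_exists by blast
  have "rc_inf p q = M" unfolding rc_inf_def
  proof (rule the_equality)
    show "is_weak_limit p q M" using limit_measure_imp_weak_limit[OF q M] .
    show "M' = M" if "is_weak_limit p q M'" for M'
      using limit_measure_unique[OF weak_limit_imp_limit_measure[OF q that] M] .
  qed
  then show ?thesis using M by simp
qed

end

section \<open>Translations\<close>

lemma conn_image:
  assumes "inj f"
  shows "conn ((`) f ` A) (f x) y \<longleftrightarrow> (\<exists>z. y = f z \<and> conn A x z)"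
proof
  assume "conn ((`) f ` A) (f x) y"
  then show "\<exists>z. y = f z \<and> conn A x z"
  proof (induction rule: conn_induct)
    case (step u v)
    then obtain z where z: "u = f z" "conn A x z" by blast
    obtain e where e: "e \<in> A" "{u, v} = f ` e" using step(2) by auto
    have "v \<in> f ` e" unfolding e(2)[symmetric] by simp
    then obtain w where w: "v = f w" by (rule imageE)
    have "f ` {z, w} = f ` e" unfolding e(2)[symmetric] z(1) w by simp
    from inj_image_eq_iff[OF assms, THEN iffD1, OF this] have "conn A z w"
      using e(1) by (intro conn_edge) simp
    from conn_trans[OF z(2) this] show ?case using w by blast
  qed (intro exI[of _ x], simp)
next
  assume "\<exists>z. y = f z \<and> conn A x z"
  then obtain z where z: "y = f z" "conn A x z" by blast
  from z(2) have "conn ((`) f ` A) (f x) (f z)"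
  proof (induction rule: conn_induct)
    case (step u v)
    have "f ` {u, v} \<in> (`) f ` A" using step(2) by (rule imageI)
    then have "conn ((`) f ` A) (f u) (f v)" by (intro conn_edge) simp
    with step.IH show ?case by (rule conn_trans)
  qed simp
  then show "conn ((`) f ` A) (f x) y" using z(1) by simp
qed

lemma cluster_image: "inj f \<Longrightarrow> cluster ((`) f ` A) (f x) = f ` cluster A x"
  by (auto simp: cluster_def conn_image)

lemma edge_rank_image:
  assumes "inj f"
  shows "edge_rank ((`) f ` A) = edge_rank A"
proof -
  have U: "\<Union>((`) f ` A) = f ` \<Union>A" by blast
  have "ncomp (\<Union>((`) f ` A)) ((`) f ` A) = card (cluster ((`) f ` A) ` f ` \<Union>A)"
    unfolding U[symmetric] by (rule ncomp_image) simp
  also have "cluster ((`) f ` A) ` f ` \<Union>A = (`) f ` cluster A ` \<Union>A"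
    by (simp add: image_image cluster_image[OF assms])
  also have "card \<dots> = card (cluster A ` \<Union>A)"
    by (rule card_image) (rule inj_on_subset[OF inj_on_image_Pow[OF assms]], simp)
  also have "\<dots> = ncomp (\<Union>A) A" by (rule ncomp_image[symmetric]) simp
  finally show ?thesis
    unfolding edge_rank_def U using card_image[OF inj_on_subset[OF assms subset_UNIV], of "\<Union>A"] by simp
qed

lemma rc_mean_image:
  assumes "inj f"
  shows "rc_mean p c {} ((`) f ` U) g = rc_mean p c {} U (\<lambda>X. g ((`) f ` X))"
proof -
  have inj: "inj ((`) f)" by (rule inj_image_eq_iff[OF assms, THEN iffD1, THEN injI])
  have inj2: "inj ((`) ((`) f))" by (rule inj_image_eq_iff[OF inj, THEN iffD1, THEN injI])
  have w: "wt p c {} ((`) f ` U) ((`) f ` A) = wt p c {} U A" if "A \<subseteq> U" for A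
  proof -
    have "(`) f ` U - (`) f ` A = (`) f ` (U - A)" using inj by (simp add: image_set_diff)
    then show ?thesis
      using card_image[OF inj_on_subset[OF inj subset_UNIV], of A]
        card_image[OF inj_on_subset[OF inj subset_UNIV], of "U - A"]
      by (simp add: wt_def edge_rank_image[OF assms])
  qed
  have "wsum p c {} ((`) f ` U) g = wsum p c {} U (\<lambda>X. g ((`) f ` X))" for g
  proof -
    have "Pow ((`) f ` U) = (`) ((`) f) ` Pow U" by (rule image_Pow_surj[symmetric]) simp
    then have "wsum p c {} ((`) f ` U) g = (\<Sum>A\<in>(`) ((`) f) ` Pow U. g A * wt p c {} ((`) f ` U) A)"
      by (simp add: wsum_def)
    also have "\<dots> = (\<Sum>A\<in>Pow U. g ((`) f ` A) * wt p c {} ((`) f ` U) ((`) f ` A))"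
      by (subst sum.reindex[OF inj_on_subset[OF inj2 subset_UNIV]]) simp
    also have "\<dots> = wsum p c {} U (\<lambda>X. g ((`) f ` X))"
      unfolding wsum_def by (intro sum.cong) (auto simp: w)
    finally show ?thesis .
  qed
  then show ?thesis by (simp add: rc_mean_def)
qed

lemma lattice_edges_translate:
  "{x, y} \<in> lattice_edges \<longleftrightarrow> {x + u, y + u} \<in> lattice_edges"
proof -
  have "{x + u, y + u} \<in> lattice_edges" if "{x, y} \<in> lattice_edges" for x y u :: "int ^ 'd"
  proof -
    obtain a b where ab: "{x, y} = {a, b}" "(\<Sum>i\<in>UNIV. \<bar>a $ i - b $ i\<bar>) = 1"
      using \<open>{x, y} \<in> lattice_edges\<close> by (auto simp: lattice_edges_def)
    have "{x + u, y + u} = (\<lambda>v. v + u) ` {x, y}" by simp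
    also have "\<dots> = {a + u, b + u}" unfolding ab(1) by simp
    finally show ?thesis using ab(2) unfolding lattice_edges_def by (intro CollectI exI[of _ "a + u"] exI[of _ "b + u"]) simp
  qed
  from this[of x y u] this[of "x + u" "y + u" "- u"] show ?thesis by auto
qed

lemma edges_in_translate: "(`) (\<lambda>v. v + u) ` edges_in S = edges_in ((\<lambda>v. v + u) ` S)"
proof (intro set_eqI iffI)
  fix e assume "e \<in> (`) (\<lambda>v. v + u) ` edges_in S"
  then obtain e' where e': "e = (\<lambda>v. v + u) ` e'" "e' \<in> lattice_edges" "e' \<subseteq> S" by (auto simp: edges_in_def)
  obtain x y where xy: "e' = {x, y}" using lattice_edge_obtain[OF e'(2)] .
  show "e \<in> edges_in ((\<lambda>v. v + u) ` S)"
    using e' lattice_edges_translate[of x y u] by (auto simp: edges_in_def xy)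
next
  fix e assume "e \<in> edges_in ((\<lambda>v. v + u) ` S)"
  then have e: "e \<in> lattice_edges" "e \<subseteq> (\<lambda>v. v + u) ` S" by (auto simp: edges_in_def)
  obtain x y where xy: "e = {x, y}" using lattice_edge_obtain[OF e(1)] .
  then obtain a b where ab: "x = a + u" "y = b + u" "a \<in> S" "b \<in> S" using e(2) by auto
  have "{a, b} \<in> edges_in S" using e(1) lattice_edges_translate[of a b u] ab by (simp add: xy edges_in_def)
  moreover have "e = (\<lambda>v. v + u) ` {a, b}" by (simp add: xy ab)
  ultimately show "e \<in> (`) (\<lambda>v. v + u) ` edges_in S" by blast
qed

lemma rc_mean_translate:
  "rc_mean p c {} (edges_in ((\<lambda>v. v + u) ` S)) g = rc_mean p c {} (edges_in S) (\<lambda>X. g ((`) (\<lambda>v. v + u) ` X))"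
  unfolding edges_in_translate[symmetric] by (rule rc_mean_image) simp

section \<open>Cubes and increasing events\<close>

definition cube :: "nat \<Rightarrow> (int ^ 'd::finite) set" where
  "cube n = {x. \<forall>i. \<bar>x $ i\<bar> \<le> int n}"

lemma cube_image: "cube n = vec_lambda ` (UNIV \<rightarrow>\<^sub>E {- int n..int n})"
proof (intro set_eqI iffI)
  fix x :: "int ^ 'd" assume "x \<in> cube n"
  then have "vec_nth x \<in> UNIV \<rightarrow>\<^sub>E {- int n..int n}" by (auto simp: cube_def abs_le_iff minus_le_iff)
  moreover have "x = vec_lambda (vec_nth x)" by simp
  ultimately show "x \<in> vec_lambda ` (UNIV \<rightarrow>\<^sub>E {- int n..int n})" by blast
qed (auto simp: cube_def abs_le_iff PiE_def Pi_def minus_le_iff)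

lemma finite_cube: "finite (cube n)"
  unfolding cube_image by (intro finite_imageI finite_PiE) auto

lemma card_cube: "card (cube n :: (int ^ 'd::finite) set) \<le> (2 * n + 1) ^ CARD('d)"
proof -
  have "card (cube n :: (int ^ 'd) set) \<le> card ((UNIV :: 'd set) \<rightarrow>\<^sub>E {- int n..int n})"
    unfolding cube_image by (intro card_image_le finite_PiE) auto
  also have "\<dots> = (2 * n + 1) ^ CARD('d)"
  proof -
    have "nat (2 * int n + 1) = Suc (2 * n)" by linarith
    then show ?thesis by (simp add: card_PiE)
  qed
  finally show ?thesis .
qed

lemma zero_in_cube: "0 \<in> cube n"
  by (simp add: cube_def)

lemma cube_mono: "m \<le> n \<Longrightarrow> cube m \<subseteq> cube n"
  unfolding cube_def by (auto intro: order_trans)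

lemma in_some_cube:
  fixes x :: "int ^ 'd::finite"
  shows "\<exists>n. x \<in> cube n"
proof -
  have "\<bar>x $ i\<bar> \<le> int (\<Sum>i\<in>UNIV. nat \<bar>x $ i\<bar>)" for i
    using member_le_sum[of i UNIV "\<lambda>i. \<bar>x $ i\<bar>"] by (simp add: of_nat_sum)
  then show ?thesis unfolding cube_def by blast
qed

lemma finite_in_cube:
  assumes "finite S"
  shows "\<exists>n. S \<subseteq> cube n"
  using assms
proof (induction S)
  case (insert x S)
  then obtain m n where "S \<subseteq> cube m" "x \<in> cube n" using in_some_cube by blast
  then have "insert x S \<subseteq> cube (max m n)"
    using cube_mono[of m "max m n"] cube_mono[of n "max m n"] by auto
  then show ?case ..
qed simp

text \<open>
  Increasing events which, when they occur, are already witnessed in a finite cube.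
\<close>

definition growing :: "(('d::finite) edge set \<Rightarrow> bool) \<Rightarrow> bool" where
  "growing Q \<longleftrightarrow> (\<forall>A B. A \<subseteq> B \<longrightarrow> Q A \<longrightarrow> Q B) \<and>
    (\<forall>X\<subseteq>lattice_edges. Q X \<longrightarrow> (\<exists>n. Q (X \<inter> edges_in (cube n))))"

lemma growing_conn: "growing (\<lambda>X. conn X x y)"
  unfolding growing_def
proof (intro conjI allI impI)
  fix X :: "'a edge set" assume X: "X \<subseteq> lattice_edges" and "conn X x y"
  from this(2) show "\<exists>n. conn (X \<inter> edges_in (cube n)) x y"
  proof (induction rule: conn_induct)
    case (step u v)
    then obtain n where n: "conn (X \<inter> edges_in (cube n)) x u" by blast
    obtain m where m: "{u, v} \<subseteq> cube m" using finite_in_cube[of "{u, v}"] by auto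
    let ?k = "max m n"
    have "conn (X \<inter> edges_in (cube ?k)) x u"
      using edges_in_mono[OF cube_mono[of n ?k]] by (intro conn_mono[OF _ n]) auto
    moreover have "{u, v} \<in> X \<inter> edges_in (cube ?k)"
      using step(2) X m cube_mono[of m ?k] by (auto simp: edges_in_def)
    ultimately have "conn (X \<inter> edges_in (cube ?k)) x v" by (rule conn_trans[OF _ conn_edge])
    then show ?case ..
  qed simp
qed (rule conn_mono)

lemma growing_Ex: "(\<And>i. growing (Q i)) \<Longrightarrow> growing (\<lambda>X. \<exists>i. P i \<and> Q i X)"
  unfolding growing_def by (intro conjI allI impI; blast)

context rc_params
begin

text \<open>
  The infinite-volume probability of such an event is the supremum of its finite-volume probabilities;
  the two bounds are stated separately because this is how they are used.
\<close>

lemma growing_event: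
  assumes M: "is_limit_measure (M :: ('d::finite) config measure)" and Q: "growing Q"
  shows "{\<omega> \<in> space M. Q (opened \<omega>)} \<in> sets M"
    and "finite S \<Longrightarrow> box_mean (\<lambda>X. of_bool (Q X)) S \<le> measure M {\<omega> \<in> space M. Q (opened \<omega>)}"
    and "(\<And>S. finite S \<Longrightarrow> box_mean (\<lambda>X. of_bool (Q X)) S \<le> b) \<Longrightarrow>
      measure M {\<omega> \<in> space M. Q (opened \<omega>)} \<le> b"
proof -
  interpret M: prob_space M using M by (simp add: is_limit_measure_def)
  have mono: "Q A \<Longrightarrow> A \<subseteq> B \<Longrightarrow> Q B" for A B using Q by (auto simp: growing_def)
  define Qn where "Qn n X = Q (X \<inter> edges_in (cube n))" for n X
  have loc: "local_on (edges_in (cube n)) (\<lambda>X. of_bool (Qn n X))" for n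
    by (simp add: local_on_def Qn_def Int_assoc)
  note fin = finite_edges_in[OF finite_cube] and sub = edges_in_subset(1)
  define B where "B n = {\<omega> \<in> space M. Qn n (opened \<omega>)}" for n
  have B: "B n \<in> sets M" "measure M (B n) = limit_mean (\<lambda>X. of_bool (Qn n X))" for n
    unfolding B_def using limit_measure_event[OF M fin sub loc[of n]] by auto
  have opened_sub: "opened \<omega> \<subseteq> lattice_edges" for \<omega> :: "'d config" by (auto simp: open_edges_def)
  have "Q (opened \<omega>) \<longleftrightarrow> (\<exists>n. Qn n (opened \<omega>))" for \<omega>
    using Q opened_sub[of \<omega>] mono unfolding growing_def Qn_def by (meson inf_le1)
  then have UB: "{\<omega> \<in> space M. Q (opened \<omega>)} = (\<Union>n. B n)" by (auto simp: B_def)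
  then show sets: "{\<omega> \<in> space M. Q (opened \<omega>)} \<in> sets M" using B(1) by auto
  have mb: "of_bool (Qn n X) \<le> (of_bool (Qn n Y) :: real)" if "X \<subseteq> Y" for n X Y
    using mono[of "X \<inter> edges_in (cube n)" "Y \<inter> edges_in (cube n)"] that by (auto simp: Qn_def)
  show "box_mean (\<lambda>X. of_bool (Q X)) S \<le> measure M {\<omega> \<in> space M. Q (opened \<omega>)}" if S: "finite S"
  proof -
    obtain n where n: "S \<subseteq> cube n" using finite_in_cube[OF S] by blast
    have "box_mean (\<lambda>X. of_bool (Q X)) S = box_mean (\<lambda>X. of_bool (Qn n X)) S"
      unfolding box_mean_def using edges_in_mono[OF n]
      by (intro rc_mean_cong) (auto simp: Qn_def Int_absorb2)
    also have "\<dots> \<le> limit_mean (\<lambda>X. of_bool (Qn n X))"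
      using mb by (intro increasing_tendsto(2)[of _ 1] S) auto
    also have "\<dots> \<le> measure M {\<omega> \<in> space M. Q (opened \<omega>)}"
      unfolding B(2)[symmetric] UB using B(1) by (intro M.finite_measure_mono) auto
    finally show ?thesis .
  qed
  assume b: "\<And>S. finite S \<Longrightarrow> box_mean (\<lambda>X. of_bool (Q X)) S \<le> b"
  have "measure M (B n) \<le> b" for n
    unfolding B(2)
  proof (rule tendsto_upperbound[OF local_tendsto[OF loc fin]])
    have "box_mean (\<lambda>X. of_bool (Qn n X)) S \<le> b" if "finite S" for S
    proof -
      have "box_mean (\<lambda>X. of_bool (Qn n X)) S \<le> box_mean (\<lambda>X. of_bool (Q X)) S"
        using mono by (intro box_mean_mono that) (auto simp: Qn_def)
      then show ?thesis using b[OF that] by simp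
    qed
    then show "eventually (\<lambda>S. box_mean (\<lambda>X. of_bool (Qn n X)) S \<le> b) (volumes TYPE('d))"
      by (intro eventually_finite_subsets_at_top_weakI)
  qed simp
  moreover have "incseq B"
  proof (rule incseq_SucI, rule subsetI)
    fix n \<omega> assume "\<omega> \<in> B n"
    then show "\<omega> \<in> B (Suc n)"
      using mono[of "opened \<omega> \<inter> edges_in (cube n)" "opened \<omega> \<inter> edges_in (cube (Suc n))"]
        edges_in_mono[OF cube_mono[of n "Suc n"]] by (auto simp: B_def Qn_def)
  qed
  then have "(\<lambda>n. measure M (B n)) \<longlonglongrightarrow> measure M (\<Union>n. B n)"
    using B(1) by (intro M.finite_Lim_measure_incseq) auto
  ultimately show "measure M {\<omega> \<in> space M. Q (opened \<omega>)} \<le> b"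
    unfolding UB by (intro LIMSEQ_le_const2) auto
qed

text \<open>
  The random-cluster model is dominated by independent percolation with the same \<open>p\<close>, where \<open>v\<close> is
  isolated with probability \<open>(1 - p) ^ deg v\<close>.
\<close>

lemma isolated_site:
  assumes E: "graph_edges E" and m: "card {e \<in> E. v \<in> e} \<le> m" and x: "x \<noteq> v"
  shows "rc_mean p c {} E (\<lambda>X. of_bool (conn X v x)) \<le> 1 - (1 - p) ^ m"
proof -
  interpret free: rc_params p 1 using p by unfold_locales auto
  have finE: "finite E" using graph_edgesD(1)[OF E] .
  have total: "wsum p 1 {} E' (\<lambda>_. 1) = 1" if "finite E'" for E' :: "'a set set"
  proof -
    have "1 = (\<Prod>e\<in>E'. p + (1 - p))" by simp
    also have "\<dots> = (\<Sum>A\<in>Pow E'. (\<Prod>e\<in>A. p) * (\<Prod>e\<in>E' - A. 1 - p))" by (rule prod_add[OF that])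
    finally show ?thesis by (simp add: wsum_def wt_def)
  qed
  let ?F = "{e \<in> E. v \<in> e}" and ?t = "\<lambda>X. of_bool (\<exists>e\<in>X. v \<in> e) :: real"
  have "rc_mean p c {} E (\<lambda>X. of_bool (conn X v x)) \<le> rc_mean p c {} E ?t"
  proof (rule rc_mean_mono[OF finE])
    fix A
    have "\<exists>e\<in>A. v \<in> e" if "conn A v x"
      using conn_in_vertices[OF conn_sym[OF that]] x by blast
    then show "of_bool (conn ({} \<union> A) v x) \<le> ?t ({} \<union> A)" by auto
  qed
  also have "\<dots> \<le> rc_mean p 1 {} E ?t"
    by (rule rc_mean_comparison[OF rc_params_axioms free.rc_params_axioms])
      (use c E in \<open>auto simp: graph_edges_def\<close>)
  also have "\<dots> = wsum p 1 {} E (\<lambda>X. 1 - of_bool (\<forall>e\<in>X. v \<notin> e))"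
    unfolding rc_mean_def total[OF finE] div_by_1 by (intro wsum_cong) auto
  also have "\<dots> = 1 - wsum p 1 {} E (\<lambda>X. of_bool (\<forall>e\<in>X. v \<notin> e))"
    unfolding wsum_diff total[OF finE] ..
  also have "wsum p 1 {} E (\<lambda>X. of_bool (\<forall>e\<in>X. v \<notin> e)) = (\<Sum>A\<in>Pow (E - ?F). wt p 1 {} E A)"
    unfolding wsum_def using finE by (intro sum.mono_neutral_cong_right) auto
  also have "\<dots> = (\<Sum>A\<in>Pow (E - ?F). wt p 1 {} (E - ?F) A * (1 - p) ^ card ?F)"
  proof (intro sum.cong refl)
    fix A assume "A \<in> Pow (E - ?F)"
    then have "E - A = (E - ?F - A) \<union> ?F" "(E - ?F - A) \<inter> ?F = {}" by auto
    then have "card (E - A) = card (E - ?F - A) + card ?F"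
      using finE by (simp add: card_Un_disjoint)
    then show "wt p 1 {} E A = wt p 1 {} (E - ?F) A * (1 - p) ^ card ?F"
      by (simp add: wt_def power_add)
  qed
  also have "\<dots> = (1 - p) ^ card ?F"
    using total[of "E - ?F"] finE by (simp add: wsum_def sum_distrib_right[symmetric])
  finally have "rc_mean p c {} E (\<lambda>X. of_bool (conn X v x)) \<le> 1 - (1 - p) ^ card ?F" .
  also have "\<dots> \<le> 1 - (1 - p) ^ m" using m p by (intro diff_left_mono power_decreasing) auto
  finally show ?thesis .
qed

end

section \<open>Norms on the lattice\<close>

text \<open>
  A norm is convex, hence continuous, and attains its extrema on the Euclidean unit sphere.
\<close>

lemma norm_equivalence:
  fixes N :: "real ^ 'd::finite \<Rightarrow> real"
  assumes "is_norm N"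
  obtains k K where "0 < k" "0 < K" "\<And>x. k * norm x \<le> N x" "\<And>x. N x \<le> K * norm x"
proof -
  have N: "\<And>x. 0 \<le> N x" "\<And>x. N x = 0 \<longleftrightarrow> x = 0" "\<And>a x. N (a *\<^sub>R x) = \<bar>a\<bar> * N x"
    "\<And>x y. N (x + y) \<le> N x + N y"
    using assms unfolding is_norm_def by auto
  have "convex_on UNIV N"
  proof (rule convex_onI)
    fix t :: real and x y :: "real ^ 'd" assume "0 < t" "t < 1"
    then show "N ((1 - t) *\<^sub>R x + t *\<^sub>R y) \<le> (1 - t) * N x + t * N y"
      using N(4)[of "(1 - t) *\<^sub>R x" "t *\<^sub>R y"] by (simp add: N(3))
  qed simp
  then have "continuous_on UNIV N" by (intro convex_on_continuous) auto
  then have cont: "continuous_on (sphere 0 1) N" by (rule continuous_on_subset) simp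
  have ne: "sphere (0 :: real ^ 'd) 1 \<noteq> {}" by simp
  obtain a :: "real ^ 'd" where a: "norm a = 1" "\<And>x. norm x = 1 \<Longrightarrow> N a \<le> N x"
    using continuous_attains_inf[OF compact_sphere ne cont] by auto
  obtain b :: "real ^ 'd" where b: "norm b = 1" "\<And>x. norm x = 1 \<Longrightarrow> N x \<le> N b"
    using continuous_attains_sup[OF compact_sphere ne cont] by auto
  have pos: "0 < N x" if "norm x = 1" for x
    using N(1)[of x] N(2)[of x] that by (metis less_le norm_zero zero_neq_one)
  have scale: "N x = norm x * N ((1 / norm x) *\<^sub>R x)" "norm ((1 / norm x) *\<^sub>R x) = 1" if "x \<noteq> 0" for x
    using that by (simp_all add: N(3))
  show thesis
  proof (rule that[of "N a" "N b"])
    fix x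
    show "N a * norm x \<le> N x"
      using scale[of x] a(2)[of "(1 / norm x) *\<^sub>R x"] N(1)[of x]
      by (cases "x = 0") (auto simp: mult.commute intro: mult_left_mono)
    show "N x \<le> N b * norm x"
      using scale[of x] b(2)[of "(1 / norm x) *\<^sub>R x"] N(2)[of x]
      by (cases "x = 0") (auto simp: mult.commute intro: mult_left_mono)
  qed (use pos a b in auto)
qed

lemma lattice_edge_l1: "{x, y} \<in> lattice_edges \<Longrightarrow> (\<Sum>i\<in>UNIV. \<bar>x $ i - y $ i\<bar>) = 1"
  by (auto simp: lattice_edges_def doubleton_eq_iff abs_minus_commute)

lemma norm_lat_edge:
  fixes x y :: "int ^ 'd::finite"
  assumes "{x, y} \<in> lattice_edges"
  shows "norm (lat y - lat x) \<le> 1"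
proof -
  have "norm (lat y - lat x) \<le> (\<Sum>i\<in>UNIV. \<bar>(lat y - lat x) $ i\<bar>)" by (rule norm_le_l1_cart)
  also have "\<dots> = real_of_int (\<Sum>i\<in>UNIV. \<bar>x $ i - y $ i\<bar>)"
    by (simp add: lat_def abs_minus_commute)
  also have "\<dots> = 1" unfolding lattice_edge_l1[OF assms] by simp
  finally show ?thesis .
qed

lemma neighbour_component:
  assumes "{x, y} \<in> lattice_edges"
  shows "\<bar>y $ i\<bar> \<le> \<bar>x $ i\<bar> + 1"
  using member_le_sum[of i UNIV "\<lambda>i. \<bar>x $ i - y $ i\<bar>"] lattice_edge_l1[OF assms] by simp

lemma neighbour_cube:
  assumes "{x, y} \<in> lattice_edges" "x \<in> cube n"
  shows "y \<in> cube (Suc n)"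
  unfolding cube_def
proof (intro CollectI allI)
  fix i
  show "\<bar>y $ i\<bar> \<le> int (Suc n)"
  proof -
    have "\<bar>x $ i\<bar> \<le> int n" using assms(2) by (simp add: cube_def)
    then show ?thesis using neighbour_component[OF assms(1), of i] by simp
  qed
qed

lemma finite_boundary_edges:
  fixes S :: "(int ^ 'd::finite) set"
  assumes "finite S"
  shows "finite (boundary_edges S)"
proof -
  obtain n where "S \<subseteq> cube n" using finite_in_cube[OF assms] by blast
  then have "boundary_edges S \<subseteq> cube n \<times> cube (Suc n)"
    using neighbour_cube by (auto simp: boundary_edges_def)
  then show ?thesis by (rule finite_subset) (simp add: finite_cube)
qed

lemma card_boundary_cube:
  "card (boundary_edges (cube n :: (int ^ 'd::finite) set)) \<le> (2 * n + 3) ^ (2 * CARD('d))"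
proof -
  have "boundary_edges (cube n :: (int ^ 'd) set) \<subseteq> cube n \<times> cube (Suc n)"
    using neighbour_cube by (auto simp: boundary_edges_def)
  then have "card (boundary_edges (cube n :: (int ^ 'd) set)) \<le> card (cube n \<times> cube (Suc n) :: ((int ^ 'd) \<times> (int ^ 'd)) set)"
    by (intro card_mono) (simp_all add: finite_cube)
  also have "\<dots> \<le> (2 * n + 1) ^ CARD('d) * (2 * Suc n + 1) ^ CARD('d)"
    unfolding card_cartesian_product by (intro mult_le_mono card_cube)
  also have "\<dots> \<le> (2 * n + 3) ^ CARD('d) * (2 * n + 3) ^ CARD('d)"
    by (intro mult_le_mono power_mono) auto
  also have "\<dots> = (2 * n + 3) ^ (2 * CARD('d))"
    by (simp only: mult_2[of "CARD('d)"] power_add)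
  finally show ?thesis .
qed

lemma norm_boundary_cube:
  fixes x y :: "int ^ 'd::finite"
  assumes "(x, y) \<in> boundary_edges (cube n)"
  shows "real n \<le> norm (lat x)"
proof -
  have e: "{y, x} \<in> lattice_edges" "y \<notin> cube n"
    using assms by (auto simp: boundary_edges_def insert_commute)
  then obtain i where i: "int n < \<bar>y $ i\<bar>" by (auto simp: cube_def not_le)
  have "{x, y} \<in> lattice_edges" using e(1) by (simp add: insert_commute)
  from neighbour_component[OF this, of i] i have "int n \<le> \<bar>x $ i\<bar>" by simp
  then have "real n \<le> \<bar>lat x $ i\<bar>" by (simp add: lat_def)
  also have "\<dots> \<le> norm (lat x)" by (rule component_le_norm_cart)
  finally show ?thesis .
qed

definition far :: "(real ^ 'd::finite \<Rightarrow> real) \<Rightarrow> nat \<Rightarrow> 'd edge set \<Rightarrow> bool" where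
  "far N n X \<longleftrightarrow> (\<exists>x. real n \<le> N (lat x) \<and> conn X 0 x)"

lemma growing_far: "growing (far N n)"
  unfolding far_def by (rule growing_Ex) (rule growing_conn)

lemma to_infinity_far: "to_infinity N \<omega> \<longleftrightarrow> (\<forall>n. far N n (opened \<omega>))"
  by (simp add: to_infinity_def far_def joined_conn)

locale lattice_norm =
  fixes N :: "real ^ 'd::finite \<Rightarrow> real" and k K :: real
  assumes N: "is_norm N" and k: "0 < k" and K: "0 < K"
    and lower: "\<And>x. k * norm x \<le> N x" and upper: "\<And>x. N x \<le> K * norm x"
begin

lemma N_nonneg: "0 \<le> N x"
  using N by (simp add: is_norm_def)

lemma N_edge:
  assumes "{x, y} \<in> lattice_edges"
  shows "N (lat y) \<le> N (lat x) + K"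
proof -
  have "N (lat y) \<le> N (lat x) + N (lat y - lat x)"
    using N[unfolded is_norm_def] by (metis add.commute diff_add_cancel)
  also have "N (lat y - lat x) \<le> K * norm (lat y - lat x)" by (rule upper)
  also have "\<dots> \<le> K * 1" using norm_lat_edge[OF assms] K by (intro mult_left_mono) auto
  finally show ?thesis by simp
qed

text \<open>
  Along an edge the norm grows by at most \<open>K\<close>, so a path from \<open>0\<close> to \<open>x\<close> visits each of the shells of
  width \<open>K\<close> in between.
\<close>

lemma cluster_card_ge:
  assumes A: "finite A" "A \<subseteq> lattice_edges" and x: "conn A 0 x"
  shows "N (lat x) / K \<le> real (card (cluster A 0))"
proof -
  define d where "d y = nat \<lfloor>N (lat y) / K\<rfloor>" for y
  have zero: "N (lat 0) = 0"
    using N by (simp add: is_norm_def lat_def vec_eq_iff)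
  have fin: "finite (cluster A 0)" by (rule finite_cluster[OF graph_edges_lattice[OF A]])
  have "{..d x} \<subseteq> d ` cluster A 0"
    using x
  proof (induction rule: conn_induct)
    case refl
    have "d 0 = 0" by (simp add: d_def zero)
    moreover have "d 0 \<in> d ` cluster A 0" by (rule imageI) (rule cluster_self)
    ultimately show ?case by simp
  next
    case (step u v)
    have "N (lat v) / K \<le> N (lat u) / K + 1"
      using N_edge[of u v] step(2) A(2) K by (auto simp: field_simps)
    then have "d v \<le> Suc (d u)"
      unfolding d_def using N_nonneg[of "lat u"] K by (simp add: nat_le_iff floor_le_iff) linarith
    then have "{..d v} \<subseteq> insert (d v) {..d u}" by auto
    moreover have "v \<in> cluster A 0"
      using conn_trans[OF step(1) conn_edge[OF step(2)]] by (simp add: cluster_def)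
    then have "d v \<in> d ` cluster A 0" by (rule imageI)
    ultimately show ?case using step.IH by blast
  qed
  then have "card {..d x} \<le> card (cluster A 0)"
    by (intro surj_card_le[OF fin])
  then have "real (d x) + 1 \<le> real (card (cluster A 0))" by simp
  moreover have "N (lat x) / K \<le> real (d x) + 1"
    unfolding d_def using N_nonneg[of "lat x"] K by (simp add: of_nat_nat)
  ultimately show ?thesis by linarith
qed

lemma finite_N_ball: "finite {x. N (lat x) < r}"
proof -
  obtain n where n: "r / k \<le> real n" using real_arch_simple by blast
  have "x \<in> cube n" if "N (lat x) < r" for x
    unfolding cube_def
  proof (intro CollectI allI)
    fix i
    have "r \<le> k * real n" using n k by (simp add: field_simps)
    then have "k * norm (lat x) < k * real n" using lower[of "lat x"] that by linarith
    then have "norm (lat x) < real n" using k by (simp only: mult_less_cancel_left_pos)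
    moreover have "\<bar>lat x $ i\<bar> \<le> norm (lat x)" by (rule component_le_norm_cart)
    ultimately have "\<bar>real_of_int (x $ i)\<bar> \<le> real n" by (simp add: lat_def)
    then show "\<bar>x $ i\<bar> \<le> int n" by linarith
  qed
  then have "{x. N (lat x) < r} \<subseteq> cube n" by blast
  then show ?thesis by (rule finite_subset) (rule finite_cube)
qed

end

section \<open>Finite susceptibility below one\<close>

lemma rc_params_half: "p \<in> {0..1} \<Longrightarrow> rc_params p (1/2)"
  by unfold_locales auto

lemma phi_eq:
  assumes "finite S" "p \<in> {0..1}"
  shows "phi p S = (\<Sum>(x, y)\<in>boundary_edges S. p * conn_mean p (edges_in S) 0 x)"
  using assms by (simp add: phi_def measure_rc_vol sum_distrib_left case_prod_beta)

lemma conn_mean_mono: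
  assumes "E1 \<subseteq> E2" "graph_edges E2" "p1 \<le> p2" "p1 \<in> {0..1}" "p2 \<in> {0..1}"
  shows "conn_mean p1 E1 x y \<le> conn_mean p2 E2 x y"
  by (rule rc_mean_comparison[OF rc_params_half[OF assms(4)] rc_params_half[OF assms(5)]])
    (use assms conn_mono in \<open>auto simp: graph_edges_def\<close>)

lemma conn_mean_nonneg:
  assumes "p \<in> {0..1}" "finite E"
  shows "0 \<le> conn_mean p E x y"
  using rc_params.rc_mean_mono[OF rc_params_half[OF assms(1)] assms(2), of "\<lambda>_. 0" "{}"]
    rc_params.rc_mean_const[OF rc_params_half[OF assms(1)] assms(2), of "{}" 0] by simp

lemma phi_mono:
  assumes "finite S" "p \<le> p'" "p \<in> {0..1}" "p' \<in> {0..1}"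
  shows "phi p S \<le> phi p' S"
  unfolding phi_eq[OF assms(1,3)] phi_eq[OF assms(1,4)]
  using assms conn_mean_mono[OF order_refl graph_edges_in[OF assms(1)] assms(2-4)]
    conn_mean_nonneg[OF assms(3) finite_edges_in[OF assms(1)]]
  by (intro sum_mono) (auto intro!: mult_mono)

lemma conn_mean_translate:
  "conn_mean p (edges_in ((\<lambda>v. v + u) ` S)) (x + u) (y + u) = conn_mean p (edges_in S) x y"
proof -
  have "conn ((`) (\<lambda>v. v + u) ` X) (x + u) (y + u) \<longleftrightarrow> conn X x y" for X
    using conn_image[of "\<lambda>v. v + u" X x "y + u"] by simp
  then show ?thesis unfolding rc_mean_translate by simp
qed

text \<open>
  At a vertex \<open>u\<close> of \<open>V\<close>, use the part of the translate of \<open>S\<close> that lies in \<open>V\<close>. Cutting away the rest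
  only lowers connection probabilities and removes boundary edges, so the hypothesis on \<open>phi\<close> persists.
\<close>

lemma susceptibility_uniform:
  fixes S V :: "(int ^ 'd::finite) set"
  assumes p: "p \<in> {0..1}" and S: "finite S" "0 \<in> S" "phi p S < 1" and V: "finite V" "0 \<in> V"
  shows "(\<Sum>z\<in>V. conn_mean p (edges_in V) 0 z) \<le> real (card S) / (1 - phi p S)"
proof (rule susceptibility_bound[where S = "\<lambda>u. (\<lambda>v. v + u) ` S \<inter> V"])
  let ?T = "\<lambda>u. (\<lambda>v. v + u) ` S"
  show "graph_edges (edges_in V)" "\<Union>(edges_in V) \<subseteq> V"
    by (intro graph_edges_in V edges_in_subset)+
  fix u assume u: "u \<in> V"
  have "card (?T u \<inter> V) \<le> card (?T u)" using S(1) by (intro card_mono) auto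
  also have "\<dots> \<le> card S" using S(1) by (rule card_image_le)
  finally show "u \<in> ?T u \<inter> V \<and> ?T u \<inter> V \<subseteq> V \<and> card (?T u \<inter> V) \<le> card S"
    using u S(2) by (auto intro: image_eqI[of _ _ 0])
  define F where "F = {e \<in> edges_in V. e \<subseteq> ?T u \<inter> V}"
  let ?O = "out_edges (edges_in V) (?T u \<inter> V)"
  let ?s = "\<lambda>(x, y). (x - u, y - u)"
  have gT: "graph_edges (edges_in (?T u))" using S(1) by (intro graph_edges_in) simp
  have FT: "F \<subseteq> edges_in (?T u)" by (auto simp: F_def edges_in_def)
  have inj: "inj_on ?s ?O" by (auto simp: inj_on_def)
  have img: "?s ` ?O \<subseteq> boundary_edges S"
  proof
    fix xy assume "xy \<in> ?s ` ?O"
    then obtain x y where xy: "xy = (x - u, y - u)" "{x, y} \<in> edges_in V" "x \<in> ?T u \<inter> V" "y \<notin> ?T u \<inter> V"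
      by (auto simp: out_edges_def)
    have yT: "y \<notin> ?T u" using xy by (auto simp: edges_in_def)
    have "y - u \<notin> S"
    proof
      assume "y - u \<in> S"
      then have "y - u + u \<in> ?T u" by (rule imageI)
      then show False using yT by simp
    qed
    moreover have "{x - u, y - u} \<in> lattice_edges"
      using lattice_edges_translate[of "x - u" "y - u" u] xy(2) by (simp add: edges_in_def)
    ultimately show "xy \<in> boundary_edges S" using xy by (auto simp: boundary_edges_def)
  qed
  have "(\<Sum>(x, y)\<in>?O. p * conn_mean p F u x) \<le> (\<Sum>(x, y)\<in>?O. p * conn_mean p (edges_in S) 0 (x - u))"
  proof (intro sum_mono)
    fix xy assume "xy \<in> ?O"
    obtain x y where xy: "xy = (x, y)" by fastforce
    have "conn_mean p F u x \<le> conn_mean p (edges_in (?T u)) u x"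
      by (rule conn_mean_mono[OF FT gT order_refl p p])
    also have "\<dots> = conn_mean p (edges_in S) 0 (x - u)"
      using conn_mean_translate[of p u S 0 "x - u"] by simp
    finally show "(case xy of (x, y) \<Rightarrow> p * conn_mean p F u x) \<le> (case xy of (x, y) \<Rightarrow> p * conn_mean p (edges_in S) 0 (x - u))"
      using p by (simp add: xy mult_left_mono)
  qed
  also have "\<dots> = (\<Sum>(x, y)\<in>?s ` ?O. p * conn_mean p (edges_in S) 0 x)"
    unfolding sum.reindex[OF inj] by (intro sum.cong) auto
  also have "\<dots> \<le> phi p S"
    unfolding phi_eq[OF S(1) p]
    using p conn_mean_nonneg[OF p finite_edges_in[OF S(1)]]
    by (intro sum_mono2 finite_boundary_edges S img) auto
  finally show "(\<Sum>(x, y)\<in>?O. p * conn_mean p {e \<in> edges_in V. e \<subseteq> ?T u \<inter> V} u x) \<le> phi p S"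
    by (simp add: F_def)
qed (use p S V in auto)

text \<open>
  Reaching distance \<open>n\<close> forces a cluster of size at least \<open>n / K\<close>, and the expected cluster size is
  bounded uniformly in the volume: apply Markov's inequality.
\<close>

theorem (in lattice_norm) no_percolation_if_phi_lt_1:
  fixes S :: "(int ^ 'd) set"
  assumes p: "p \<in> {0..1}" and S: "finite S" "0 \<in> S" "phi p S < 1"
  shows "perc_prob N p 2 = 0"
proof -
  interpret rc_params p "1/2" using rc_params_half[OF p] .
  let ?M = "rc_inf p 2 :: 'd config measure"
  have M: "is_limit_measure ?M" by (rule rc_inf_limit_measure) auto
  interpret M: prob_space ?M using M by (simp add: is_limit_measure_def)
  define B where "B = real (card S) / (1 - phi p S)"
  have far_le: "measure ?M {\<omega> \<in> space ?M. far N n (opened \<omega>)} \<le> K * B / real n" if n: "0 < n" for n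
  proof (rule growing_event(3)[OF M growing_far])
    fix T :: "(int ^ 'd) set" assume "finite T"
    define V where "V = insert 0 T"
    have V: "finite V" "0 \<in> V" "T \<subseteq> V" using \<open>finite T\<close> by (auto simp: V_def)
    have "box_mean (\<lambda>X. of_bool (far N n X)) T \<le> box_mean (\<lambda>X. of_bool (far N n X)) V"
      using growing_far[of N n] by (intro box_mean_mono_volume V) (auto simp: growing_def)
    also have "\<dots> \<le> box_mean (\<lambda>X. K / real n * (\<Sum>z\<in>V. of_bool (conn X 0 z))) V"
      unfolding box_mean_def
    proof (rule rc_mean_mono[OF finite_edges_in[OF V(1)]])
      fix A assume A: "A \<subseteq> edges_in V"
      have A': "finite A" "A \<subseteq> lattice_edges"
        using A finite_edges_in[OF V(1)] edges_in_subset(1)[of V] finite_subset by auto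
      have "cluster A 0 \<subseteq> V"
        using cluster_subset[of A 0] A edges_in_subset(2)[of V] V(2) by blast
      then have "cluster A 0 = {z \<in> V. conn A 0 z}" by (auto simp: cluster_def)
      then have card: "real (card (cluster A 0)) = (\<Sum>z\<in>V. of_bool (conn A 0 z))"
        using V(1) by (simp add: sum.If_cases of_bool_def Int_def)
      have "of_bool (far N n A) \<le> K / real n * (\<Sum>z\<in>V. of_bool (conn A 0 z))"
      proof (cases "far N n A")
        case True
        then obtain x where x: "real n \<le> N (lat x)" "conn A 0 x" by (auto simp: far_def)
        have "real n / K \<le> N (lat x) / K" using x(1) K by (intro divide_right_mono) auto
        also have "\<dots> \<le> real (card (cluster A 0))" by (rule cluster_card_ge[OF A' x(2)])
        finally show ?thesis using True K n unfolding card by (simp add: field_simps)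
      next
        case False
        then show ?thesis using K by (simp add: sum_nonneg)
      qed
      then show "of_bool (far N n ({} \<union> A)) \<le> K / real n * (\<Sum>z\<in>V. of_bool (conn ({} \<union> A) 0 z))" by simp
    qed
    also have "\<dots> = K / real n * (\<Sum>z\<in>V. conn_mean p (edges_in V) 0 z)"
      by (simp only: box_mean_def rc_mean_cmult rc_mean_sum)
    also have "\<dots> \<le> K / real n * B"
      unfolding B_def using K by (intro mult_left_mono susceptibility_uniform[OF \<open>p \<in> {0..1}\<close> S V(1,2)]) auto
    finally show "box_mean (\<lambda>X. of_bool (far N n X)) T \<le> K * B / real n" by simp
  qed
  have "perc_prob N p 2 \<le> K * B / real (Suc n)" for n
  proof -
    have "perc_prob N p 2 \<le> measure ?M {\<omega> \<in> space ?M. far N (Suc n) (opened \<omega>)}"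
      unfolding perc_prob_def to_infinity_far
      by (intro M.finite_measure_mono growing_event(1)[OF M growing_far]) auto
    also have "\<dots> \<le> K * B / real (Suc n)" by (rule far_le) simp
    finally show ?thesis .
  qed
  moreover have "(\<lambda>n. K * B / real (Suc n)) \<longlonglongrightarrow> 0"
    using LIMSEQ_Suc[OF lim_const_over_n[of "K * B"]] by simp
  ultimately have "perc_prob N p 2 \<le> 0" by (intro LIMSEQ_le_const[of _ 0]) auto
  then show ?thesis unfolding perc_prob_def using measure_nonneg by (metis antisym)
qed

section \<open>Sharpness\<close>

context lattice_norm
begin

text \<open>
  The assumption \<open>few\<close> of the comparison argument. If the infinite-volume cluster of the origin is
  almost surely finite, it reaches a large distance \<open>n\<close> with small probability, and on the complement
  its size is at most the number \<open>m\<close> of lattice points at distance less than \<open>n\<close>. Free measures increase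
  with the volume, so the same bounds hold in every finite volume, and for every \<open>y\<close> by translation.
\<close>

lemma small_clusters:
  assumes p: "p \<in> {0..1}" and perc: "perc_prob N p 2 = 0" and \<delta>: "0 < \<delta>" "\<delta> \<le> 1"
  obtains s where "0 < s" "s < 1"
    "\<And>U (y :: int ^ 'd). finite U \<Longrightarrow> U \<subseteq> lattice_edges \<Longrightarrow>
      rc_mean p (1/2) {} U (\<lambda>X. 1 - s ^ card (cluster X y)) \<le> \<delta>"
proof -
  interpret rc_params p "1/2" using rc_params_half[OF p] .
  let ?M = "rc_inf p 2 :: 'd config measure"
  have M: "is_limit_measure ?M" by (rule rc_inf_limit_measure) auto
  interpret M: prob_space ?M using M by (simp add: is_limit_measure_def)
  define B where "B n = {\<omega> \<in> space ?M. far N n (opened \<omega>)}" for n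
  have Bs: "range B \<subseteq> sets ?M" unfolding B_def using growing_event(1)[OF M growing_far] by auto
  have "decseq B"
  proof (rule decseq_SucI, rule subsetI)
    fix n \<omega> assume "\<omega> \<in> B (Suc n)"
    then show "\<omega> \<in> B n" unfolding B_def far_def by force
  qed
  then have "(\<lambda>n. measure ?M (B n)) \<longlonglongrightarrow> measure ?M (\<Inter>n. B n)"
    using Bs by (intro M.finite_Lim_measure_decseq)
  moreover have "(\<Inter>n. B n) = {\<omega> \<in> space ?M. to_infinity N \<omega>}"
    by (auto simp: B_def to_infinity_far)
  ultimately have "(\<lambda>n. measure ?M (B n)) \<longlonglongrightarrow> 0"
    using perc by (simp add: perc_prob_def)
  then have "eventually (\<lambda>n. measure ?M (B n) < \<delta> / 2) sequentially"
    by (rule order_tendstoD) (use \<delta> in simp)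
  then obtain n where n: "measure ?M (B n) < \<delta> / 2" by (auto simp: eventually_sequentially)
  define m where "m = card {x :: int ^ 'd. N (lat x) < real n}"
  (* Bernoulli's inequality turns this choice into 1 - s ^ m <= \<delta> / 2. *)
  define s where "s = 1 - \<delta> / (2 * (real m + 1))"
  have frac: "0 < \<delta> / (2 * (real m + 1))" "\<delta> / (2 * (real m + 1)) < 1"
    using \<delta> by (simp_all add: field_simps)
  then have s: "0 < s" "s < 1" by (simp_all add: s_def)
  have "1 + real m * (- (\<delta> / (2 * (real m + 1)))) \<le> (1 + - (\<delta> / (2 * (real m + 1)))) ^ m"
    using frac by (intro Bernoulli_inequality) simp
  moreover have "real m * (\<delta> / (2 * (real m + 1))) \<le> \<delta> / 2" using \<delta> by (simp add: field_simps)
  ultimately have sm: "1 - s ^ m \<le> \<delta> / 2" by (simp add: s_def)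
  have sm0: "0 \<le> 1 - s ^ m" using s by (simp add: power_le_one)
  show thesis
  proof (rule that[OF s])
    fix U :: "'d edge set" and y :: "int ^ 'd" assume U: "finite U" "U \<subseteq> lattice_edges"
    let ?g = "\<lambda>y X. 1 - s ^ card (cluster X y)"
    define S0 where "S0 = (\<lambda>v. v - y) ` \<Union>U"
    have finS0: "finite S0"
      unfolding S0_def using graph_edgesD(2)[OF graph_edges_lattice[OF U]] by simp
    have S: "(\<lambda>v. v + y) ` S0 = \<Union>U" by (simp add: S0_def image_image)
    have "rc_mean p (1/2) {} U (?g y) \<le> rc_mean p (1/2) {} (edges_in (\<Union>U)) (?g y)"
    proof (rule rc_mean_comparison[OF rc_params_axioms rc_params_axioms])
      show "U \<subseteq> edges_in (\<Union>U)" using U by (auto simp: edges_in_def)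
      show gE: "graph_edges (edges_in (\<Union>U))"
        by (intro graph_edges_in graph_edgesD(2)[OF graph_edges_lattice[OF U]])
      fix A B :: "'d edge set" assume AB: "A \<subseteq> B" "B \<subseteq> {} \<union> edges_in (\<Union>U)"
      then have "graph_edges B" using graph_edges_subset[OF gE] by simp
      then have "card (cluster A y) \<le> card (cluster B y)"
        using AB(1) by (intro card_mono finite_cluster cluster_mono)
      then show "?g y A \<le> ?g y B" using s by (simp add: power_decreasing)
    qed (auto simp: graph_edges_def)
    also have "\<dots> = box_mean (?g 0) S0"
    proof -
      have "?g y ((`) (\<lambda>v. v + y) ` X) = ?g 0 X" for X
        using cluster_image[of "\<lambda>v. v + y" X 0] card_image[of "\<lambda>v. v + y" "cluster X 0"] by simp
      then show ?thesis
        unfolding S[symmetric] rc_mean_translate box_mean_def by simp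
    qed
    also have "\<dots> \<le> box_mean (\<lambda>X. of_bool (far N n X) + (1 - s ^ m)) S0"
    proof (rule box_mean_mono[OF finS0])
      fix A :: "'d edge set"
      show "?g 0 A \<le> of_bool (far N n A) + (1 - s ^ m)"
      proof (cases "far N n A")
        case True
        have "?g 0 A \<le> 1" using s by simp
        then show ?thesis using True sm0 by simp
      next
        case False
        then have "cluster A 0 \<subseteq> {x. N (lat x) < real n}"
          by (auto simp: far_def cluster_def not_le[symmetric])
        then have "card (cluster A 0) \<le> m" unfolding m_def by (intro card_mono finite_N_ball)
        then have "s ^ m \<le> s ^ card (cluster A 0)" using s by (intro power_decreasing) auto
        then show ?thesis using False by simp
      qed
    qed
    also have "\<dots> = box_mean (\<lambda>X. of_bool (far N n X)) S0 + (1 - s ^ m)"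
      using finS0 by (simp add: box_mean_def rc_mean_add finite_edges_in)
    also have "box_mean (\<lambda>X. of_bool (far N n X)) S0 \<le> measure ?M (B n)"
      unfolding B_def by (rule growing_event(2)[OF M growing_far finS0])
    finally show "rc_mean p (1/2) {} U (?g y) \<le> \<delta>" using n sm by linarith
  qed
qed

text \<open>
  The odds condition at margin \<open>\<delta>\<close> amounts to \<open>\<delta> * p * (1 - p') \<le> p - p'\<close>, so \<open>\<delta> = (p - p') / 2\<close> is
  small enough; \<open>cluster_tail\<close> then gives exponential tails of the cluster size at \<open>p'\<close>.
\<close>

theorem exponential_decay:
  assumes p: "p \<in> {0..1}" and perc: "perc_prob N p 2 = 0" and p': "0 \<le> p'" "p' < p"
  obtains c where "0 < c" "\<And>S (x :: int ^ 'd). finite S \<Longrightarrow>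
    conn_mean p' (edges_in S) 0 x \<le> 2 * exp (- c * N (lat x))"
proof -
  define \<delta> where "\<delta> = (p - p') / 2"
  have \<delta>: "0 < \<delta>" "\<delta> \<le> 1/2" using p p' by (auto simp: \<delta>_def)
  obtain s where s: "0 < s" "s < 1" "\<And>U (y :: int ^ 'd). finite U \<Longrightarrow> U \<subseteq> lattice_edges \<Longrightarrow>
      rc_mean p (1/2) {} U (\<lambda>X. 1 - s ^ card (cluster X y)) \<le> \<delta>"
    using small_clusters[OF p perc \<delta>(1)] \<delta>(2) by auto
  have odds: "p' * (1 - p) \<le> p * (1 - p') * (1 - \<delta>)"
  proof -
    have "p * (1 - p') \<le> 1 * 1" using p p' by (intro mult_mono) auto
    then have "\<delta> * (p * (1 - p')) \<le> \<delta>" using \<delta> by (simp add: mult_left_le)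
    also have "\<dots> \<le> p - p'" using p' by (simp add: \<delta>_def)
    finally show ?thesis by (simp add: algebra_simps)
  qed
  have p'01: "p' \<in> {0..1}" using p p' by auto
  interpret lo: rc_params p' "1/2" using rc_params_half[OF p'01] .
  show thesis
  proof (rule that[of "- ln s / K"])
    show "0 < - ln s / K" using s K by (simp add: divide_neg_pos)
    fix S :: "(int ^ 'd) set" and x :: "int ^ 'd" assume S: "finite S"
    interpret sprinkling p p' "1/2" s \<delta> "edges_in S"
    proof (intro sprinkling.intro sprinkling_axioms.intro)
      show "rc_params p (1/2)" "rc_params p' (1/2)" using p p'01 by (auto intro: rc_params_half)
      show "graph_edges (edges_in S)" by (rule graph_edges_in[OF S])
      fix U :: "'d edge set" and y assume "U \<subseteq> edges_in S"
      then show "rc_mean p (1/2) {} U (\<lambda>X. 1 - s ^ card (cluster X y)) \<le> \<delta>"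
        using edges_in_subset(1)[of S] finite_subset[OF _ finite_edges_in[OF S]] by (intro s(3)) auto
    qed (use s \<delta> odds in auto)
    define n where "n = nat \<lceil>N (lat x) / K\<rceil>"
    have n: "N (lat x) / K \<le> real n" unfolding n_def by (rule real_nat_ceiling_ge)
    have "conn_mean p' (edges_in S) 0 x \<le> rc_mean p' (1/2) {} (edges_in S) (\<lambda>X. of_bool (n \<le> card (cluster X 0)))"
    proof (rule lo.rc_mean_mono[OF finite_edges_in[OF S]])
      fix A assume A: "A \<subseteq> edges_in S"
      then have A': "finite A" "A \<subseteq> lattice_edges"
        using edges_in_subset(1)[of S] finite_subset[OF A finite_edges_in[OF S]] by auto
      have "n \<le> card (cluster A 0)" if "conn A 0 x"
        using cluster_card_ge[OF A' that] by (simp add: n_def nat_le_iff ceiling_le_iff)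
      then show "of_bool (conn ({} \<union> A) 0 x) \<le> (of_bool (n \<le> card (cluster ({} \<union> A) 0)) :: real)" by auto
    qed
    also have "\<dots> \<le> s ^ n / (1 - \<delta>)" by (rule cluster_tail)
    also have "\<dots> \<le> s ^ n / (1/2)" using s \<delta> by (intro divide_left_mono) auto
    also have "\<dots> = 2 * exp (ln s * real n)" using s by (simp add: exp_of_nat2_mult exp_ln mult.commute flip: powr_realpow add: powr_def)
    also have "\<dots> \<le> 2 * exp (ln s * (N (lat x) / K))"
      using mult_left_mono_neg[OF n, of "ln s"] s by simp
    finally show "conn_mean p' (edges_in S) 0 x \<le> 2 * exp (- (- ln s / K) * N (lat x))"
      by (simp add: field_simps)
  qed
qed

text \<open>
  The boundary of a cube grows polynomially, while the connection probabilities to it decay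
  exponentially.
\<close>

lemma phi_cube_lt_1:
  assumes p: "p \<in> {0..1}" and c: "0 < c"
    and decay: "\<And>S (x :: int ^ 'd). finite S \<Longrightarrow> conn_mean p (edges_in S) 0 x \<le> 2 * exp (- c * N (lat x))"
  obtains n where "phi p (cube n :: (int ^ 'd) set) < 1"
proof -
  have bound: "phi p (cube n :: (int ^ 'd) set) \<le> (2 * real n + 3) ^ (2 * CARD('d)) * (2 * exp (- (c * k) * real n))" for n
  proof -
    have "phi p (cube n :: (int ^ 'd) set) \<le> (\<Sum>(x, y)\<in>boundary_edges (cube n :: (int ^ 'd) set). 2 * exp (- (c * k) * real n))"
      unfolding phi_eq[OF finite_cube p]
    proof (rule sum_mono)
      fix xy assume "xy \<in> boundary_edges (cube n :: (int ^ 'd) set)"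
      then obtain x y where xy: "xy = (x, y)" "(x, y) \<in> boundary_edges (cube n :: (int ^ 'd) set)" by (cases xy) auto
      have "k * real n \<le> k * norm (lat x)" using norm_boundary_cube[OF xy(2)] k by (intro mult_left_mono) auto
      also have "\<dots> \<le> N (lat x)" by (rule lower)
      finally have far: "c * (k * real n) \<le> c * N (lat x)" using c by (intro mult_left_mono) auto
      have "p * conn_mean p (edges_in (cube n)) 0 x \<le> 1 * conn_mean p (edges_in (cube n)) 0 x"
        using p conn_mean_nonneg[OF p finite_edges_in[OF finite_cube]] by (intro mult_right_mono) auto
      also have "\<dots> \<le> 2 * exp (- c * N (lat x))" using decay[OF finite_cube] by simp
      also have "\<dots> \<le> 2 * exp (- (c * k) * real n)" using far by (simp add: mult.assoc)
      finally show "(case xy of (x, y) \<Rightarrow> p * conn_mean p (edges_in (cube n)) 0 x) \<le> (case xy of (x, y) \<Rightarrow> 2 * exp (- (c * k) * real n))"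
        by (simp add: xy)
    qed
    also have "\<dots> = real (card (boundary_edges (cube n :: (int ^ 'd) set))) * (2 * exp (- (c * k) * real n))"
      by (simp add: case_prod_beta)
    also have "\<dots> \<le> real ((2 * n + 3) ^ (2 * CARD('d))) * (2 * exp (- (c * k) * real n))"
      by (intro mult_right_mono of_nat_mono card_boundary_cube) auto
    finally show ?thesis by simp
  qed
  have ck: "0 < c * k" using c k by simp
  define D where "D = 2 * CARD('d)"
  have D: "0 < D" by (simp add: D_def)
  (* The exponential is distributed over the D factors of the power. *)
  define a where "a = c * k / real D"
  have a: "0 < a" "c * k = real D * a" using ck D by (simp_all add: a_def)
  have "(\<lambda>n. (2 * real n + 3) * exp (- a * real n)) \<longlonglongrightarrow> 0"
    using a(1) by real_asymp
  then have "(\<lambda>n. ((2 * real n + 3) * exp (- a * real n)) ^ D * 2) \<longlonglongrightarrow> 0 ^ D * 2"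
    by (intro tendsto_mult_right tendsto_power)
  moreover have "((2 * real n + 3) * exp (- a * real n)) ^ D * 2 = (2 * real n + 3) ^ D * (2 * exp (- (c * k) * real n))" for n
    by (simp add: power_mult_distrib a(2) mult.assoc exp_of_nat_mult[symmetric])
  ultimately have "(\<lambda>n. (2 * real n + 3) ^ (2 * CARD('d)) * (2 * exp (- (c * k) * real n))) \<longlonglongrightarrow> 0"
    by (simp only: zero_power[OF D] mult_zero_left D_def[symmetric])
  then have "eventually (\<lambda>n. (2 * real n + 3) ^ (2 * CARD('d)) * (2 * exp (- (c * k) * real n)) < 1) sequentially"
    by (rule order_tendstoD) simp
  then obtain n where "(2 * real n + 3) ^ (2 * CARD('d)) * (2 * exp (- (c * k) * real n)) < 1"
    by (auto simp: eventually_sequentially)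
  then show thesis using bound[of n] that[of n] by linarith
qed

definition subcritical :: "real set" where
  "subcritical = {p \<in> {0..1}. \<exists>S :: (int ^ 'd) set. finite S \<and> 0 \<in> S \<and> phi p S < 1}"

lemma crit_p_tilde_Sup: "crit_p_tilde TYPE('d) = Sup subcritical"
  by (simp add: crit_p_tilde_def subcritical_def)

lemma crit_p_tilde_bounds:
  "0 \<in> subcritical" "bdd_above subcritical" "crit_p_tilde TYPE('d) \<in> {0..1}"
proof -
  have "phi 0 {0 :: int ^ 'd} < 1" by (simp add: phi_def)
  then show z: "0 \<in> subcritical"
    unfolding subcritical_def by (intro CollectI conjI exI[of _ "{0}"]) auto
  show bdd: "bdd_above subcritical" by (rule bdd_aboveI[of _ 1]) (auto simp: subcritical_def)
  have "Sup subcritical \<le> 1"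
  proof (rule cSup_least)
    show "subcritical \<noteq> {}" using z by blast
  qed (simp add: subcritical_def)
  then show "crit_p_tilde TYPE('d) \<in> {0..1}"
    using cSup_upper[OF z bdd] by (simp add: crit_p_tilde_Sup)
qed

lemma perc_prob_below:
  assumes p: "p \<in> {0..1}" "p < crit_p_tilde TYPE('d)"
  shows "perc_prob N p 2 = 0"
proof -
  have "subcritical \<noteq> {}" using crit_p_tilde_bounds(1) by blast
  then obtain p' where p': "p' \<in> subcritical" "p < p'"
    using p(2) less_cSup_iff[OF _ crit_p_tilde_bounds(2)]
    by (auto simp: crit_p_tilde_Sup)
  then obtain S :: "(int ^ 'd) set" where S: "finite S" "0 \<in> S" "phi p' S < 1" "p' \<in> {0..1}"
    by (auto simp: subcritical_def)
  have "phi p S \<le> phi p' S" using phi_mono[OF S(1) _ p(1) S(4)] p'(2) by simp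
  then show ?thesis using no_percolation_if_phi_lt_1[OF p(1) S(1,2)] S(3) by simp
qed

text \<open>
  If there were no percolation at \<open>p\<close>, the decay at a smaller \<open>p'\<close> that still exceeds the supremum would
  put \<open>p'\<close> into the set over which the supremum is taken.
\<close>

lemma perc_prob_above:
  assumes p: "p \<in> {0..1}" "crit_p_tilde TYPE('d) < p"
  shows "0 < perc_prob N p 2"
proof (rule ccontr)
  assume "\<not> 0 < perc_prob N p 2"
  then have zero: "perc_prob N p 2 = 0" unfolding perc_prob_def by (simp add: measure_le_0_iff not_less)
  define p' where "p' = (crit_p_tilde TYPE('d) + p) / 2"
  have p': "crit_p_tilde TYPE('d) < p'" "p' < p" "p' \<in> {0..1}"
    using p crit_p_tilde_bounds(3) by (auto simp: p'_def)
  obtain c where c: "0 < c" "\<And>S (x :: int ^ 'd). finite S \<Longrightarrow>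
      conn_mean p' (edges_in S) 0 x \<le> 2 * exp (- c * N (lat x))"
    using exponential_decay[OF p(1) zero _ p'(2)] p'(3) by auto
  obtain n where "phi p' (cube n :: (int ^ 'd) set) < 1" using phi_cube_lt_1[OF p'(3) c] by auto
  then have "p' \<in> subcritical"
    using p'(3) finite_cube zero_in_cube by (auto simp: subcritical_def)
  then have "p' \<le> Sup subcritical" using crit_p_tilde_bounds(2) by (rule cSup_upper)
  then show False using p'(1) by (simp add: crit_p_tilde_Sup)
qed

theorem crit_p_eq: "crit_p N 2 = crit_p_tilde TYPE('d)"
  unfolding crit_p_def
proof (rule the_equality)
  show "crit_p_tilde TYPE('d) \<in> {0..1} \<and>
    (\<forall>p\<in>{0..1}. (p < crit_p_tilde TYPE('d) \<longrightarrow> perc_prob N p 2 = 0) \<and>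
      (crit_p_tilde TYPE('d) < p \<longrightarrow> 0 < perc_prob N p 2))"
    using crit_p_tilde_bounds(3) perc_prob_below perc_prob_above by blast
  fix r assume r: "r \<in> {0..1} \<and> (\<forall>p\<in>{0..1}. (p < r \<longrightarrow> perc_prob N p 2 = 0) \<and> (r < p \<longrightarrow> 0 < perc_prob N p 2))"
  let ?t = "crit_p_tilde TYPE('d)" and ?m = "(crit_p_tilde TYPE('d) + r) / 2"
  have m: "?m \<in> {0..1}" using r crit_p_tilde_bounds(3) by auto
  show "r = ?t"
  proof (cases r ?t rule: linorder_cases)
    case less
    then have "r < ?m" "?m < ?t" by simp_all
    then have "0 < perc_prob N ?m 2" "perc_prob N ?m 2 = 0"
      using r m perc_prob_below[OF m] by blast+
    then show ?thesis by simp
  next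
    case greater
    then have "?t < ?m" "?m < r" by simp_all
    then have "perc_prob N ?m 2 = 0" "0 < perc_prob N ?m 2"
      using r m perc_prob_above[OF m] by blast+
    then show ?thesis by simp
  qed
qed

text \<open>
  Removes a multiplicative constant from an exponential bound, at the price of a smaller rate: for small
  \<open>t\<close> the bound \<open>\<kappa>\<close> is enough, and the rate \<open>c\<close> is such that the other bound takes over where \<open>\<kappa>\<close> fails.
\<close>

lemma min_le_exp:
  fixes c0 :: real
  assumes "0 < c0" "0 < \<kappa>" "\<kappa> < 1"
  obtains c where "0 < c" "\<And>a t. a \<le> \<kappa> \<Longrightarrow> a \<le> 2 * exp (- c0 * t) \<Longrightarrow> a \<le> exp (- c * t)"
proof -
  define L where "L = - ln \<kappa>"
  have L: "0 < L" "\<kappa> = exp (- L)" using assms by (auto simp: L_def)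
  define c where "c = c0 * L / (ln 2 + L)"
  have D: "0 < ln 2 + L" using L by (simp add: add_pos_pos)
  have c: "0 < c" using assms(1) L D by (simp add: c_def)
  have diff: "c0 - c = c0 * ln 2 / (ln 2 + L)" using D by (simp add: c_def field_simps)
  show thesis
  proof (rule that[OF c])
    fix a t assume a: "a \<le> \<kappa>" "a \<le> 2 * exp (- c0 * t)"
    show "a \<le> exp (- c * t)"
    proof (cases "c * t \<le> L")
      case True
      then have "exp (- L) \<le> exp (- c * t)" by simp
      then show ?thesis using a(1) unfolding L(2) by linarith
    next
      case False
      then have "(ln 2 + L) * L < c0 * L * t" using D by (simp add: c_def field_simps)
      then have "ln 2 + L < c0 * t" using L by (simp add: mult.commute mult.left_commute)
      then have "ln 2 * (ln 2 + L) \<le> ln 2 * (c0 * t)" by (intro mult_left_mono) auto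
      then have "ln 2 \<le> (c0 - c) * t" unfolding diff using D by (simp add: field_simps)
      then have "ln 2 - c0 * t \<le> - c * t" by (simp add: algebra_simps)
      then have "exp (ln 2 - c0 * t) \<le> exp (- c * t)" by simp
      moreover have "exp (ln 2 - c0 * t) = 2 * exp (- c0 * t)" by (simp add: exp_diff exp_minus field_simps)
      ultimately show ?thesis using a(2) by simp
    qed
  qed
qed

text \<open>
  There is no percolation at a parameter between \<open>p\<close> and the critical one, so \<open>exponential_decay\<close>
  applies. Its factor \<open>2\<close> is absorbed with the help of \<open>isolated_site\<close>, which keeps the connection
  probabilities to all vertices other than the origin away from 1.
\<close>

theorem subcritical_decay:
  assumes p01: "p \<in> {0..1}" and pc: "p < crit_p N 2"
  shows "\<exists>c>0. \<forall>x :: int ^ 'd. conn_prob p 2 x \<le> exp (- c * N (lat x))"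
proof -
  interpret rc_params p "1/2" using rc_params_half[OF p01] .
  let ?M = "rc_inf p 2 :: 'd config measure"
  have M: "is_limit_measure ?M" by (rule rc_inf_limit_measure) auto
  interpret M: prob_space ?M using M by (simp add: is_limit_measure_def)
  define p1 where "p1 = (p + crit_p N 2) / 2"
  have p1: "p < p1" "p1 < crit_p_tilde TYPE('d)" "p1 \<in> {0..1}"
    using p01 pc crit_p_tilde_bounds(3) by (auto simp: p1_def crit_p_eq)
  obtain c0 where c0: "0 < c0" "\<And>S (x :: int ^ 'd). finite S \<Longrightarrow>
      conn_mean p (edges_in S) 0 x \<le> 2 * exp (- c0 * N (lat x))"
    using exponential_decay[OF p1(3) perc_prob_below[OF p1(3,2)] _ p1(1)] p01 by auto
  define E0 where "E0 = {e \<in> edges_in (cube 1 :: (int ^ 'd) set). 0 \<in> e}"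
  have E0: "finite E0"
    unfolding E0_def by (rule finite_subset[OF _ finite_edges_in[OF finite_cube[of 1]]]) blast
  define \<kappa> where "\<kappa> = 1 - (1 - p) ^ card E0 / 2"
  have pow: "0 < (1 - p) ^ card E0" "(1 - p) ^ card E0 \<le> 1"
    using p01 p1 by (auto simp: power_le_one)
  then have \<kappa>: "0 < \<kappa>" "\<kappa> < 1" by (simp_all add: \<kappa>_def)
  obtain c where c: "0 < c" "\<And>a t. a \<le> \<kappa> \<Longrightarrow> a \<le> 2 * exp (- c0 * t) \<Longrightarrow> a \<le> exp (- c * t)"
    using min_le_exp[OF c0(1) \<kappa>] by metis
  have prob: "conn_prob p 2 x = measure ?M {\<omega> \<in> space ?M. conn (opened \<omega>) 0 x}" for x :: "int ^ 'd"
    by (simp add: conn_prob_def joined_conn)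
  have decay: "conn_prob p 2 x \<le> 2 * exp (- c0 * N (lat x))" for x :: "int ^ 'd"
    unfolding prob by (rule growing_event(3)[OF M growing_conn]) (use c0(2) in \<open>simp add: box_mean_def\<close>)
  have isolated: "conn_prob p 2 x \<le> \<kappa>" if x: "x \<noteq> 0" for x :: "int ^ 'd"
    unfolding prob
  proof (rule growing_event(3)[OF M growing_conn])
    fix S :: "(int ^ 'd) set" assume S: "finite S"
    have "{e \<in> edges_in S. 0 \<in> e} \<subseteq> E0"
    proof
      fix e assume e: "e \<in> {e \<in> edges_in S. 0 \<in> e}"
      then have le: "e \<in> lattice_edges" by (simp add: edges_in_def)
      obtain a b where ab: "e = {a, b}" using lattice_edge_obtain[OF le] .
      then obtain y where y: "e = {0, y}" using e by auto
      then have "y \<in> cube (Suc 0)" using le zero_in_cube by (intro neighbour_cube[of 0 y 0]) auto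
      then show "e \<in> E0" using le y zero_in_cube[of 1] by (simp add: E0_def edges_in_def)
    qed
    then have "card {e \<in> edges_in S. 0 \<in> e} \<le> card E0" by (rule card_mono[OF E0])
    from isolated_site[OF graph_edges_in[OF S] this x]
    show "box_mean (\<lambda>X. of_bool (conn X 0 x)) S \<le> \<kappa>"
      using pow unfolding box_mean_def \<kappa>_def by linarith
  qed
  have "conn_prob p 2 x \<le> exp (- c * N (lat x))" for x :: "int ^ 'd"
  proof (cases "x = 0")
    case True
    have "N (lat 0) = 0" using N by (simp add: is_norm_def lat_def vec_eq_iff)
    then show ?thesis using True unfolding prob by simp
  next
    case False
    from c(2)[OF isolated[OF False] decay] show ?thesis .
  qed
  then show ?thesis using c(1) by blast
qed

end

theorem corollary1:
  fixes N :: "real ^ 'd::finite \<Rightarrow> real"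
  assumes "is_norm N"
  shows "crit_p N 2 = crit_p_tilde TYPE('d) \<and>
    (\<forall>p\<in>{0..1}. p < crit_p N 2 \<longrightarrow>
      (\<exists>c>0. \<forall>x :: int ^ 'd. conn_prob p 2 x \<le> exp (- c * N (lat x))))"
proof -
  obtain k K where kK: "0 < k" "0 < K" "\<And>x. k * norm x \<le> N x" "\<And>x. N x \<le> K * norm x"
    using norm_equivalence[OF assms] by metis
  interpret lattice_norm N k K by (intro lattice_norm.intro assms kK)
  show ?thesis using crit_p_eq subcritical_decay by blast
qed

end
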